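(* Assume $H=K$. Let $\Phi$ be a nonnegative continuous nondecreasing function on $[0,\infty)$ such that $\Phi(0)=0$ and $$\Phi(x)=x^{1/H}(-\log x)^{-1/(2H)},\qquad 0<x<\frac1e.$$ Then, $\mathbb P$-a.s. for every $t\in[0,1]$, $$\lim_{n\uparrow\infty}\sum_{k=0}^{\lfloor tb^n\rfloor-1}\Phi\Big(\big|Y((k+1)b^{-n})-Y(kb^{-n})\big|\Big)=\frac{2^{1/(2H)}\,\Gamma\big(\frac{H+1}{2H}\big)}{\sqrt\pi\,(-\log\alpha)^{1/(2H)}}\,t.$$
   Context: Let $(\Omega,\mathcal F,\mathbb P)$ be a probability space, $H\in(0,1)$, and let $W_H=\{W_H(t):0\le t\le 1\}$ be a continuous fractional Brownian motion with Hurst parameter $H$, i.e. a continuous centered Gaussian process with $\mathbb E[W_H(s)W_H(t)]=\frac12(s^{2H}+t^{2H}-|t-s|^{2H})$. Let $\kappa:[0,1]\to[0,1]$ be a deterministic function with $\kappa(0)=0$, $\kappa(1)=1$, Hölder continuous with some exponent $\tau\in(H,1]$, and put $B_H(u):=W_H(u)-\kappa(u)W_H(1)$, $0\le u\le1$. Let $\alpha\in(0,1)$ and $b\in\{2,3,\dots\}$. The fractional Wiener--Weierstrass bridge with parameters $\alpha,b,H$ is $$Y(t):=\sum_{n=0}^\infty\alpha^nB_H(\{b^nt\}),\qquad 0\le t\le1,$$ where $\{x\}$ denotes the fractional part of $x\ge0$. Put $K:=\min\{1,-\log_b\alpha\}$. $\Gamma$ is Euler's gamma function and $\log$ is the natural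 logarithm. *)

theory Defs
  imports "HOL-Probability.Probability"
begin

(* Normal distributions with zero variance, i.e. point masses, are included: fractional Brownian
   motion at time 0 and its degenerate linear combinations are Gaussian in this sense. *)
definition gaussian_rv :: "'a measure \<Rightarrow> ('a \<Rightarrow> real) \<Rightarrow> bool" where
  "gaussian_rv M X \<longleftrightarrow> X \<in> borel_measurable M \<and>
     ((\<exists>\<mu> \<sigma>. \<sigma> > 0 \<and> distributed M lborel X (\<lambda>x. ennreal (normal_density \<mu> \<sigma> x))) \<or>
      (\<exists>\<mu>. AE \<omega> in M. X \<omega> = \<mu>))"

(* Joint normality of the finite-dimensional marginals, expressed through linear combinations. *)
definition gaussian_process :: "'a measure \<Rightarrow> real set \<Rightarrow> (real \<Rightarrow> 'a \<Rightarrow> real) \<Rightarrow> bool" where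
  "gaussian_process M T X \<longleftrightarrow>
     (\<forall>I c. finite I \<and> I \<subseteq> T \<longrightarrow> gaussian_rv M (\<lambda>\<omega>. \<Sum>t\<in>I. c t * X t \<omega>))"

definition fractional_brownian_motion ::
  "'a measure \<Rightarrow> real \<Rightarrow> (real \<Rightarrow> 'a \<Rightarrow> real) \<Rightarrow> bool" where
  "fractional_brownian_motion M H W \<longleftrightarrow>
     gaussian_process M {0..1} W \<and>
     (\<forall>t\<in>{0..1}. prob_space.expectation M (W t) = 0) \<and>
     (\<forall>s\<in>{0..1}. \<forall>t\<in>{0..1}.
        prob_space.expectation M (\<lambda>\<omega>. W s \<omega> * W t \<omega>) =
          (s powr (2 * H) + t powr (2 * H) - \<bar>t - s\<bar> powr (2 * H)) / 2) \<and>
     (\<forall>\<omega>\<in>space M. continuous_on {0..1} (\<lambda>t. W t \<omega>))"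

definition hoelder_continuous_on :: "real \<Rightarrow> real set \<Rightarrow> (real \<Rightarrow> real) \<Rightarrow> bool" where
  "hoelder_continuous_on \<tau> S f \<longleftrightarrow>
     (\<exists>C. \<forall>s\<in>S. \<forall>t\<in>S. \<bar>f s - f t\<bar> \<le> C * \<bar>s - t\<bar> powr \<tau>)"

definition fractional_bridge ::
  "(real \<Rightarrow> real) \<Rightarrow> (real \<Rightarrow> 'a \<Rightarrow> real) \<Rightarrow> real \<Rightarrow> 'a \<Rightarrow> real" where
  "fractional_bridge \<kappa> W u \<omega> = W u \<omega> - \<kappa> u * W 1 \<omega>"

definition wiener_weierstrass_bridge ::
  "real \<Rightarrow> nat \<Rightarrow> (real \<Rightarrow> real) \<Rightarrow> (real \<Rightarrow> 'a \<Rightarrow> real) \<Rightarrow> real \<Rightarrow> 'a \<Rightarrow> real" where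
  "wiener_weierstrass_bridge \<alpha> b \<kappa> W t \<omega> =
     (\<Sum>n. \<alpha> ^ n * fractional_bridge \<kappa> W (frac (real b ^ n * t)) \<omega>)"

end

(* Write D for the increments of Y over the b-adic grid of level n. Because alpha = b^(-H), the term
   of order m = n - i of the series contributes b^(-nH) b^(iH) times an increment of B_H over a grid
   cell of length b^(-i), so D = b^(-nH) S where S is a sum of n standard normal variables, up to a
   term from kappa which stays bounded because tau > H. The covariances of these normal
   variables decay geometrically in the difference of the levels, and for most pairs of cells even
   in the larger level. Hence the variance of S / sqrt n is close to 1 for most cells, and the mean
   squared covariance over pairs of cells is O(1/n^2). The variance of the average of
   cos(u S / sqrt n) over the cells is then O(1/n^2), which is summable; so almost surely the
   empirical law of S / sqrt n converges to the standard normal law. The same argument for cosh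
   gives uniform exponential moments, hence convergence of the empirical moment of order 1/H and a
   bound on max |S| that is polynomial in n. The latter allows to replace Phi by a constant multiple
   of |x|^(1/H), uniformly over the cells. *)

theory Submission
  imports Defs
begin

section \<open>Covariances of increments\<close>

text \<open>The case H = K is critical: all n levels enter S with equal weight, so the variance of S
  grows like n instead of converging. The logarithm in \<open>\<Phi>\<close> compensates this
  growth. The negative logarithm of b^(-nH) is n H ln b, that is, n times
  \<open>- ln \<alpha>\<close>, and n^(1/(2H)) cancels against the normalisation by sqrt n. The rest
  of the constant is the absolute moment of order 1/H of a standard normal variable. The obstacle is
  the dependence between cells. An estimate linear in the covariances would bound the variance of an
  empirical average only by O(1/n), which is not summable. Cosine and hyperbolic cosine are even, so
  the linear term drops out, and their product-to-sum formula makes what remains explicit. The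
  exceptional null sets depend on the frequency u and on the endpoint t. Countably many of each
  suffice: the cosh bound makes the averages equicontinuous in u, and the sums are monotone in t
  because \<open>\<Phi>\<close> is nonnegative.\<close>

lemma powr_add_le_add_powr:
  fixes x y p :: real
  assumes "0 \<le> x" "0 \<le> y" "0 < p" "p \<le> 1"
  shows "(x + y) powr p \<le> x powr p + y powr p"
proof (cases "x + y = 0")
  case True
  then show ?thesis using assms by simp
next
  case False
  then have pos: "x + y > 0" using assms by simp
  have *: "u \<le> u powr p" if "0 \<le> u" "u \<le> 1" for u :: real
  proof (cases "u = 0")
    case False
    then have "u powr 1 \<le> u powr p" using that assms by (intro powr_mono') auto
    then show ?thesis using that by simp
  qed simp
  have "1 = x / (x + y) + y / (x + y)" using pos by (simp add: add_divide_distrib[symmetric])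
  also have "\<dots> \<le> (x / (x + y)) powr p + (y / (x + y)) powr p"
    using assms pos by (intro add_mono *) auto
  also have "\<dots> = (x powr p + y powr p) / (x + y) powr p"
    using assms pos by (simp add: powr_divide add_divide_distrib)
  finally show ?thesis using pos by (simp add: field_simps)
qed

lemma abs_powr_diff_le:
  fixes x y p :: real
  assumes "0 < p" "p \<le> 1"
  shows "\<bar>\<bar>x\<bar> powr p - \<bar>y\<bar> powr p\<bar> \<le> \<bar>x - y\<bar> powr p"
proof -
  have *: "\<bar>u\<bar> powr p - \<bar>v\<bar> powr p \<le> \<bar>u - v\<bar> powr p" for u v :: real
  proof -
    have "\<bar>u\<bar> powr p \<le> (\<bar>v\<bar> + \<bar>u - v\<bar>) powr p"
      using assms by (intro powr_mono2) auto
    also have "\<dots> \<le> \<bar>v\<bar> powr p + \<bar>u - v\<bar> powr p"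
      using assms by (intro powr_add_le_add_powr) auto
    finally show ?thesis by simp
  qed
  show ?thesis using *[of x y] *[of y x] by (simp add: abs_minus_commute abs_le_iff)
qed

text \<open>The signed power is, up to a factor, the derivative of \<bar>x\<bar> powr (p + 1), and
  this bound is its Hoelder continuity. If the signs differ, the two terms add up instead of
  cancelling, and each is at most the distance to the power p; hence the factor 2.\<close>

lemma sgn_powr_diff_le:
  fixes x y p :: real
  assumes "0 < p" "p \<le> 1"
  shows "\<bar>sgn x * \<bar>x\<bar> powr p - sgn y * \<bar>y\<bar> powr p\<bar> \<le> 2 * \<bar>x - y\<bar> powr p"
proof (cases "x * y > 0")
  case True
  then have "sgn x = sgn y" "\<bar>sgn y\<bar> = 1"
    by (auto simp: zero_less_mult_iff)
  then have "\<bar>sgn x * \<bar>x\<bar> powr p - sgn y * \<bar>y\<bar> powr p\<bar> = \<bar>\<bar>x\<bar> powr p - \<bar>y\<bar> powr p\<bar>"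
    by (metis abs_mult mult_1 right_diff_distrib)
  also have "\<dots> \<le> \<bar>x - y\<bar> powr p" using abs_powr_diff_le[OF assms] .
  also have "\<dots> \<le> 2 * \<bar>x - y\<bar> powr p" by simp
  finally show ?thesis .
next
  case False
  then have opp: "\<bar>x\<bar> \<le> \<bar>x - y\<bar>" "\<bar>y\<bar> \<le> \<bar>x - y\<bar>"
    by (auto simp: not_less mult_le_0_iff)
  have "\<bar>sgn u * \<bar>u\<bar> powr p\<bar> \<le> \<bar>u\<bar> powr p" for u :: real
    by (simp add: abs_mult abs_sgn_eq)
  then have "\<bar>sgn x * \<bar>x\<bar> powr p - sgn y * \<bar>y\<bar> powr p\<bar> \<le> \<bar>x\<bar> powr p + \<bar>y\<bar> powr p"
    by (smt (verit, ccfv_SIG))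
  also have "\<dots> \<le> \<bar>x - y\<bar> powr p + \<bar>x - y\<bar> powr p"
    using opp assms by (intro add_mono powr_mono2) auto
  finally show ?thesis by simp
qed

lemma has_real_derivative_abs_powr:
  fixes x p :: real
  assumes "1 < p"
  shows "((\<lambda>x. \<bar>x\<bar> powr p) has_real_derivative p * (sgn x * \<bar>x\<bar> powr (p - 1))) (at x)"
proof -
  consider "x > 0" | "x < 0" | "x = 0" by linarith
  then show ?thesis
  proof cases
    case 1
    have ev: "\<forall>\<^sub>F u in nhds x. \<bar>u\<bar> powr p = u powr p"
      by (rule eventually_nhds_in_open[of "{0<..}" x, THEN eventually_mono]) (use 1 in auto)
    have "((\<lambda>x. x powr p) has_real_derivative p * x powr (p - 1)) (at x)"
      using has_real_derivative_powr[OF 1] .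
    with ev show ?thesis using 1
      by (subst DERIV_cong_ev[OF refl ev refl]) simp
  next
    case 2
    have ev: "\<forall>\<^sub>F u in nhds x. \<bar>u\<bar> powr p = (- u) powr p"
      by (rule eventually_nhds_in_open[of "{..<0}" x, THEN eventually_mono]) (use 2 in auto)
    have "((\<lambda>x. (- x) powr p) has_real_derivative p * (- x) powr (p - 1) * (-1)) (at x)"
      by (rule DERIV_chain2[OF has_real_derivative_powr]) (use 2 in \<open>auto intro!: derivative_eq_intros\<close>)
    with ev show ?thesis using 2
      by (subst DERIV_cong_ev[OF refl ev refl]) simp
  next
    case 3
    have "((\<lambda>h. \<bar>h\<bar> powr (p - 1)) \<longlongrightarrow> \<bar>0\<bar> powr (p - 1)) (at (0::real))"
      using assms by (intro tendsto_powr' tendsto_rabs tendsto_const tendsto_ident_at) auto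
    then have lim: "((\<lambda>h. \<bar>h\<bar> powr (p - 1)) \<longlongrightarrow> 0) (at (0::real))"
      by simp
    have "\<bar>h\<bar> powr (p - 1) = \<bar>\<bar>h\<bar> powr p / h\<bar>" for h :: real
      by (cases "h = 0") (simp_all add: powr_diff)
    with lim have "((\<lambda>h. \<bar>\<bar>h\<bar> powr p / h\<bar>) \<longlongrightarrow> 0) (at (0::real))"
      by simp
    then have "((\<lambda>h. \<bar>h\<bar> powr p / h) \<longlongrightarrow> 0) (at (0::real))"
      by (rule tendsto_rabs_zero_cancel)
    then show ?thesis using 3 by (simp add: has_field_derivative_iff)
  qed
qed

text \<open>The covariance of W (s + L) - W s and W (t + d) - W t for a fractional Brownian motion W,
  where A = t - s - L is the signed gap between the two intervals.\<close>

definition increment_cov :: "real \<Rightarrow> real \<Rightarrow> real \<Rightarrow> real \<Rightarrow> real" where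
  "increment_cov H A L d =
     (\<bar>A + L + d\<bar> powr (2 * H) - \<bar>A + L\<bar> powr (2 * H) - \<bar>A + d\<bar> powr (2 * H) + \<bar>A\<bar> powr (2 * H)) / 2"

text \<open>Time reversal: it turns an interval of length d on the left of the other one into one on
  the right, so only positive gaps need an estimate.\<close>

lemma increment_cov_reflect: "increment_cov H (- (A + L + d)) L d = increment_cov H A L d"
proof -
  have "\<bar>- (A + L + d) + L + d\<bar> = \<bar>A\<bar>" "\<bar>- (A + L + d) + L\<bar> = \<bar>A + d\<bar>"
    "\<bar>- (A + L + d) + d\<bar> = \<bar>A + L\<bar>" "\<bar>- (A + L + d)\<bar> = \<bar>A + L + d\<bar>"
    by linarith+
  then show ?thesis unfolding increment_cov_def by simp
qed

lemma increment_cov_reflect_swap: "increment_cov H (- (A + L + d)) d L = increment_cov H A L d"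
proof -
  have "\<bar>- (A + L + d) + d + L\<bar> = \<bar>A\<bar>" "\<bar>- (A + L + d) + L\<bar> = \<bar>A + d\<bar>"
    "\<bar>- (A + L + d) + d\<bar> = \<bar>A + L\<bar>" "\<bar>- (A + L + d)\<bar> = \<bar>A + L + d\<bar>"
    by linarith+
  then show ?thesis unfolding increment_cov_def by simp
qed

text \<open>The covariance is half a mixed second difference of x powr (2 * H), with steps L and d.
  Two applications of the mean value theorem turn it into H (2H - 1) L d v^(2H - 2) at some v beyond
  the gap, and this power decreases in v.\<close>

lemma increment_cov_far:
  assumes H: "0 < H" "H < 1" and "0 < \<epsilon>" "0 < L" "0 < d" and far: "A \<ge> \<epsilon> \<or> A + L + d \<le> - \<epsilon>"
  shows "\<bar>increment_cov H A L d\<bar> \<le> L * d * \<epsilon> powr (2 * H - 2)"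
proof -
  have *: "\<bar>increment_cov H A L d\<bar> \<le> L * d * \<epsilon> powr (2 * H - 2)" if A: "A \<ge> \<epsilon>" for A
  proof -
    define f where "f x = (x + L) powr (2 * H) - x powr (2 * H)" for x :: real
    define f' where "f' x = 2 * H * ((x + L) powr (2 * H - 1) - x powr (2 * H - 1))" for x :: real
    have "\<exists>u>A. u < A + d \<and> f (A + d) - f A = (A + d - A) * f' u"
    proof (rule MVT2)
      fix x assume x: "A \<le> x" "x \<le> A + d"
      then have x0: "x > 0" "x + L > 0" using A \<open>0 < \<epsilon>\<close> \<open>0 < L\<close> by auto
      show "DERIV f x :> f' x"
        unfolding f_def f'_def using x0
        by (auto intro!: derivative_eq_intros simp: algebra_simps powr_diff)
    qed (use \<open>0 < d\<close> in auto)
    then obtain u where u: "A < u" "f (A + d) - f A = d * f' u" by auto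
    have "\<exists>v>u. v < u + L \<and> (u + L) powr (2 * H - 1) - u powr (2 * H - 1)
        = (u + L - u) * ((2 * H - 1) * v powr (2 * H - 1 - 1))"
    proof (rule MVT2)
      fix x assume "u \<le> x" "x \<le> u + L"
      then have x0: "x > 0" using A u \<open>0 < \<epsilon>\<close> by auto
      show "DERIV (\<lambda>x. x powr (2 * H - 1)) x :> (2 * H - 1) * x powr (2 * H - 1 - 1)"
        by (rule has_real_derivative_powr[OF x0])
    qed (use \<open>0 < L\<close> in auto)
    then obtain v where v: "u < v" "(u + L) powr (2 * H - 1) - u powr (2 * H - 1)
        = L * ((2 * H - 1) * v powr (2 * H - 2))" by (auto simp: algebra_simps)
    have "increment_cov H A L d = (f (A + d) - f A) / 2"
      unfolding increment_cov_def f_def using A assms(3-5) by (simp add: algebra_simps)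
    also have "\<dots> = (H * (2 * H - 1)) * (L * d * v powr (2 * H - 2))"
      by (simp add: u f'_def v)
    finally have "\<bar>increment_cov H A L d\<bar> = \<bar>H * (2 * H - 1)\<bar> * (L * d * v powr (2 * H - 2))"
      using \<open>0 < L\<close> \<open>0 < d\<close> by (simp add: abs_mult)
    also have "\<dots> \<le> 1 * (L * d * \<epsilon> powr (2 * H - 2))"
    proof (intro mult_mono)
      have "\<bar>H\<bar> * \<bar>2 * H - 1\<bar> \<le> 1 * 1" using H by (intro mult_mono) auto
      then show "\<bar>H * (2 * H - 1)\<bar> \<le> 1" by (simp add: abs_mult)
      show "v powr (2 * H - 2) \<le> \<epsilon> powr (2 * H - 2)"
        using H A u v assms(3) by (intro powr_mono2') auto
    qed (use \<open>0 < L\<close> \<open>0 < d\<close> in auto)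
    finally show ?thesis by simp
  qed
  show ?thesis
    using far
  proof
    assume "A + L + d \<le> - \<epsilon>"
    then have "\<epsilon> \<le> - (A + L + d)" by simp
    from *[OF this] show ?thesis by (simp only: increment_cov_reflect)
  qed (rule *)
qed

lemma mult_powr_div_powr:
  fixes L d a c :: real
  assumes "0 < L" "0 < d"
  shows "(L * d) powr a * (d / L) powr c = d powr (a + c) * L powr (a - c)"
  using assms by (simp add: powr_mult powr_divide powr_add powr_diff)

text \<open>No separation is assumed, so singularities at 0 matter. For 2H \<le> 1 the function
  \<bar>x\<bar> powr (2 * H) is itself Hoelder, and differences over the shorter step d give d^(2H).
  For 2H > 1 its derivative is Hoelder of order 2H - 1, which gives d L^(2H - 1). In both cases (L
  d)^H is the product of the standard deviations, and the remaining power of d / L bounds the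
  correlation.\<close>

lemma increment_cov_le:
  assumes H: "0 < H" "H < 1" and d: "0 < d" "d \<le> L"
  shows "\<bar>increment_cov H A L d\<bar> \<le> 2 * ((L * d) powr H * (d / L) powr (min H (1 - H)))"
proof (cases "2 * H \<le> 1")
  case True
  have tri: "\<bar>(a - b - c + e) / 2\<bar> \<le> (\<bar>a - b\<bar> + \<bar>c - e\<bar>) / 2" for a b c e :: real
    using abs_triangle_ineq4[of "a - b" "c - e"] by (simp add: algebra_simps)
  have "\<bar>increment_cov H A L d\<bar> \<le> (\<bar>\<bar>A + L + d\<bar> powr (2 * H) - \<bar>A + L\<bar> powr (2 * H)\<bar>
      + \<bar>\<bar>A + d\<bar> powr (2 * H) - \<bar>A\<bar> powr (2 * H)\<bar>) / 2"
    using tri unfolding increment_cov_def by blast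
  also have "\<dots> \<le> (d powr (2 * H) + d powr (2 * H)) / 2"
    using abs_powr_diff_le[of "2 * H" "A + L + d" "A + L"] abs_powr_diff_le[of "2 * H" "A + d" A] H True d
    by simp
  also have "\<dots> = (L * d) powr H * (d / L) powr H"
    using d by (simp add: mult_powr_div_powr)
  also have "min H (1 - H) = H" using True by simp
  then have "(L * d) powr H * (d / L) powr H \<le> 2 * ((L * d) powr H * (d / L) powr (min H (1 - H)))"
    by simp
  finally show ?thesis .
next
  case False
  define s where "s x = 2 * H * (sgn x * \<bar>x\<bar> powr (2 * H - 1))" for x :: real
  define f where "f x = \<bar>x + L\<bar> powr (2 * H) - \<bar>x\<bar> powr (2 * H)" for x :: real
  have D: "DERIV (\<lambda>x. \<bar>x\<bar> powr (2 * H)) x :> s x" for x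
    unfolding s_def by (rule has_real_derivative_abs_powr) (use False in auto)
  have "\<exists>u>A. u < A + d \<and> f (A + d) - f A = (A + d - A) * (s (u + L) - s u)"
  proof (rule MVT2)
    fix x
    show "DERIV f x :> s (x + L) - s x"
      unfolding f_def by (intro DERIV_diff D) (use D[of "x + L"] in \<open>simp add: DERIV_shift\<close>)
  qed (use d in auto)
  then obtain u where u: "f (A + d) - f A = d * (s (u + L) - s u)" by auto
  have "increment_cov H A L d = (f (A + d) - f A) / 2"
    unfolding increment_cov_def f_def by (simp add: algebra_simps)
  then have "increment_cov H A L d = d * (s (u + L) - s u) / 2"
    by (simp add: u)
  then have "\<bar>increment_cov H A L d\<bar> = d * \<bar>s (u + L) - s u\<bar> / 2"
    using d by (simp only: abs_mult abs_divide)
  also have "s (u + L) - s u = 2 * H * (sgn (u + L) * \<bar>u + L\<bar> powr (2 * H - 1) - sgn u * \<bar>u\<bar> powr (2 * H - 1))"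
    unfolding s_def by (simp add: algebra_simps)
  also have "\<bar>\<dots>\<bar> = 2 * H * \<bar>sgn (u + L) * \<bar>u + L\<bar> powr (2 * H - 1) - sgn u * \<bar>u\<bar> powr (2 * H - 1)\<bar>"
    using H by (simp add: abs_mult)
  also have "d * \<dots> / 2 \<le> d * (2 * 1 * (2 * \<bar>u + L - u\<bar> powr (2 * H - 1))) / 2"
    using H d False by (intro divide_right_mono mult_left_mono mult_mono sgn_powr_diff_le) auto
  also have "\<dots> = 2 * (d * L powr (2 * H - 1))" using d by simp
  also have "d * L powr (2 * H - 1) = (L * d) powr H * (d / L) powr (1 - H)"
    using d by (simp add: mult_powr_div_powr)
  also have "1 - H = min H (1 - H)" using False by simp
  finally show ?thesis by simp
qed

text \<open>The covariance of the normalised increments over the p-th cell of level i and the q-th cell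
  of level j, where the cells of level i have length 1 / b ^ i.\<close>

definition digit_cov :: "real \<Rightarrow> nat \<Rightarrow> nat \<Rightarrow> nat \<Rightarrow> nat \<Rightarrow> nat \<Rightarrow> real" where
  "digit_cov H b i j p q = real b powr (H * (real i + real j)) *
     increment_cov H (real q / real b ^ j - real p / real b ^ i - 1 / real b ^ i) (1 / real b ^ i) (1 / real b ^ j)"

text \<open>The factor by which the correlation bound shrinks per level of difference; the exponent
  is that of d / L in \<open>increment_cov_le\<close>.\<close>

definition cov_rate :: "real \<Rightarrow> nat \<Rightarrow> real" where
  "cov_rate H b = real b powr (- min H (1 - H))"

lemma digit_cov_commute: "digit_cov H b j i q p = digit_cov H b i j p q"
proof -
  define A where "A = real q / real b ^ j - real p / real b ^ i - 1 / real b ^ i"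
  have "- (A + 1 / real b ^ i + 1 / real b ^ j) = real p / real b ^ i - real q / real b ^ j - 1 / real b ^ j"
    unfolding A_def by simp
  then have "increment_cov H (real p / real b ^ i - real q / real b ^ j - 1 / real b ^ j) (1 / real b ^ j) (1 / real b ^ i)
    = increment_cov H A (1 / real b ^ i) (1 / real b ^ j)"
    using increment_cov_reflect_swap[of H A "1 / real b ^ i" "1 / real b ^ j"] by simp
  then show ?thesis unfolding digit_cov_def A_def by (simp add: add.commute)
qed

section \<open>Counting grid points and summing over residues\<close>

lemma card_le_of_bounds:
  fixes S :: "nat set" and lo hi :: real
  assumes "finite S" "\<And>p. p \<in> S \<Longrightarrow> lo \<le> real p \<and> real p \<le> hi" "lo \<le> hi"
  shows "real (card S) \<le> hi - lo + 1"
proof (cases "S = {}")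
  case False
  have "S \<subseteq> {Min S..Max S}" using assms by auto
  then have "card S \<le> card {Min S..Max S}" by (rule card_mono[rotated]) simp
  then have "real (card S) \<le> real (Max S) - real (Min S) + 1"
    using Max_ge[OF assms(1) Min_in[OF assms(1) False]] by simp
  then show ?thesis
    using assms(2)[OF Min_in[OF assms(1) False]] assms(2)[OF Max_in[OF assms(1) False]] by linarith
qed (use assms in simp)

lemma card_near_le:
  fixes c x y :: real
  assumes "0 < c" "0 \<le> y"
  shows "real (card {p. p < N \<and> \<bar>c * real p - x\<bar> < y}) \<le> 2 * y / c + 1"
proof -
  have "real (card {p. p < N \<and> \<bar>c * real p - x\<bar> < y}) \<le> (x + y) / c - (x - y) / c + 1"
  proof (rule card_le_of_bounds)
    fix p assume "p \<in> {p. p < N \<and> \<bar>c * real p - x\<bar> < y}"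
    then have "x - y \<le> c * real p" "c * real p \<le> x + y" by auto
    then show "(x - y) / c \<le> real p \<and> real p \<le> (x + y) / c"
      using assms by (simp add: field_simps)
  qed (use assms in \<open>auto intro!: divide_right_mono\<close>)
  also have "(x + y) / c - (x - y) / c = 2 * y / c" by (simp add: diff_divide_distrib add_divide_distrib)
  finally show ?thesis .
qed

lemma sum_lessThan_mult:
  fixes f :: "nat \<Rightarrow> 'a :: comm_monoid_add"
  shows "(\<Sum>k<m * n. f k) = (\<Sum>a<m. \<Sum>p<n. f (a * n + p))"
proof (induction m)
  case (Suc m)
  have "(\<Sum>k<Suc m * n. f k) = (\<Sum>k<m * n. f k) + (\<Sum>k=m * n..<m * n + n. f k)"
    using sum.atLeastLessThan_concat[of 0 "m * n" "m * n + n" f]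
    by (simp add: lessThan_atLeast0 add.commute)
  also have "(\<Sum>k=m * n..<m * n + n. f k) = (\<Sum>p<n. f (m * n + p))"
    using sum.shift_bounds_nat_ivl[of f 0 "m * n" n] by (simp add: lessThan_atLeast0 add.commute)
  finally show ?case using Suc by simp
qed simp

lemma sum_mod_power:
  fixes f :: "nat \<Rightarrow> real"
  assumes "j \<le> n"
  shows "(\<Sum>k<b ^ n. f (k mod b ^ j)) = real b ^ (n - j) * (\<Sum>q<b ^ j. f q)"
proof -
  have "b ^ n = b ^ (n - j) * b ^ j" using assms by (simp add: power_add[symmetric])
  then have "(\<Sum>k<b ^ n. f (k mod b ^ j)) = (\<Sum>a<b ^ (n - j). \<Sum>p<b ^ j. f ((a * b ^ j + p) mod b ^ j))"
    by (simp only: sum_lessThan_mult)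
  also have "\<dots> = (\<Sum>a<b ^ (n - j). \<Sum>p<b ^ j. f p)" by (intro sum.cong refl) simp
  finally show ?thesis by simp
qed

lemma sum_inj_power_le:
  fixes x :: real
  assumes "0 \<le> x" "x < 1" "finite S" "inj_on g S"
  shows "(\<Sum>j\<in>S. x ^ g j) \<le> 1 / (1 - x)"
proof -
  have "(\<Sum>j\<in>S. x ^ g j) = (\<Sum>m\<in>g ` S. x ^ m)" using assms by (simp add: sum.reindex)
  also have "\<dots> \<le> (\<Sum>m. x ^ m)" using assms by (intro sum_le_suminf summable_geometric) auto
  finally show ?thesis using assms by (simp add: suminf_geometric)
qed

lemma sum_indicator_le:
  fixes c :: real and N :: nat
  shows "(\<Sum>p<N. if P p then c else 0) = real (card {p. p < N \<and> P p}) * c"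
proof -
  have "{p. p < N \<and> P p} = {..<N} \<inter> {p. P p}" by auto
  then show ?thesis using sum.inter_restrict[of "{..<N}" "\<lambda>_. c" "{p. P p}"] by simp
qed

text \<open>The covariance of S over the cells k and l. The map t to b^(n-i) t modulo 1 sends the
  cell k of level n to the cell k mod b^i of level i. Level 0 is absent because the bridge vanishes
  at both ends of [0,1].\<close>

definition path_cov :: "real \<Rightarrow> nat \<Rightarrow> nat \<Rightarrow> nat \<Rightarrow> nat \<Rightarrow> real" where
  "path_cov H b n k l = (\<Sum>i\<in>{1..n}. \<Sum>j\<in>{1..n}. digit_cov H b i j (k mod b ^ i) (l mod b ^ j))"

section \<open>Decay of covariances across levels and cells\<close>

context
  fixes H :: real and b :: nat
  assumes H: "0 < H" "H < 1" and b: "b \<ge> 2"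
begin

lemma cov_rate_pos: "0 < cov_rate H b" and cov_rate_less_1: "cov_rate H b < 1"
proof -
  have "real b powr (- min H (1 - H)) < real b powr 0" using H b by (intro powr_less_mono) auto
  then show "cov_rate H b < 1" using b by (simp add: cov_rate_def)
qed (use b in \<open>simp add: cov_rate_def\<close>)

lemma cov_rate_power: "cov_rate H b ^ k = real b powr (- (min H (1 - H) * real k))"
  unfolding cov_rate_def using b by (simp add: powr_realpow[symmetric] powr_powr)

lemma inverse_power_eq_powr: "1 / real b ^ i = real b powr (- real i)"
  using b by (simp add: powr_minus_divide powr_realpow)

lemma digit_cov_le:
  assumes "i \<le> j"
  shows "\<bar>digit_cov H b i j p q\<bar> \<le> 2 * cov_rate H b ^ (j - i)"
proof -
  define L d where "L = real b powr (- real i)" and "d = real b powr (- real j)"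
  have comb: "real b powr u * ((real b powr v) powr H * (real b powr w) powr e) = real b powr (u + v * H + w * e)"
    for u v w e by (simp only: powr_powr powr_add mult.assoc)
  have Ld: "L * d = real b powr (- real i + - real j)" and dL: "d / L = real b powr (- real j - - real i)"
    by (simp_all only: L_def d_def powr_add powr_diff)
  have "\<bar>increment_cov H A L d\<bar> \<le> 2 * ((L * d) powr H * (d / L) powr (min H (1 - H)))" for A
    unfolding L_def d_def using H b assms by (intro increment_cov_le powr_mono) auto
  then have "\<bar>digit_cov H b i j p q\<bar> \<le> real b powr (H * (real i + real j)) * (2 * ((L * d) powr H * (d / L) powr (min H (1 - H))))"
    unfolding digit_cov_def inverse_power_eq_powr L_def d_def abs_mult by (intro mult_mono) auto
  also have "\<dots> = 2 * (real b powr (H * (real i + real j)) * ((real b powr (- real i + - real j)) powr H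
      * (real b powr (- real j - - real i)) powr (min H (1 - H))))"
    unfolding Ld dL by simp
  also have "\<dots> = 2 * real b powr (H * (real i + real j) + (- real i + - real j) * H + (- real j - - real i) * min H (1 - H))"
    by (simp only: comb)
  also have "H * (real i + real j) + (- real i + - real j) * H + (- real j - - real i) * min H (1 - H) = - (min H (1 - H) * real (j - i))"
    using assms by (simp add: algebra_simps of_nat_diff)
  finally show ?thesis by (simp add: cov_rate_power)
qed

text \<open>The distance b^(-i/2) is tuned so that the loss \<delta>^(2H - 2) cancels exactly the
  decay in i and leaves b^(-(1-H) j), decay in the larger level alone. The factor 2 absorbs the
  lengths of the two cells, both at most \<delta>.\<close>

lemma digit_cov_far:
  assumes "i \<le> j" "2 * real b powr (- real i / 2) \<le> \<bar>real q / real b ^ j - real p / real b ^ i\<bar>"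
  shows "\<bar>digit_cov H b i j p q\<bar> \<le> cov_rate H b ^ j"
proof -
  define L d where "L = real b powr (- real i)" and "d = real b powr (- real j)"
  define \<delta> where "\<delta> = real b powr (- real i / 2)"
  define A where "A = real q / real b ^ j - real p / real b ^ i - L"
  have pos: "L > 0" "d > 0" "\<delta> > 0" using b by (auto simp: L_def d_def \<delta>_def)
  have small: "L \<le> \<delta>" "d \<le> L" unfolding L_def d_def \<delta>_def using assms b by (auto intro!: powr_mono)
  have "\<bar>increment_cov H A L d\<bar> \<le> L * d * \<delta> powr (2 * H - 2)"
  proof (rule increment_cov_far)
    show "\<delta> \<le> A \<or> A + L + d \<le> - \<delta>"
      using assms(2) small unfolding A_def \<delta>_def[symmetric] by linarith
  qed (use pos H in auto)
  then have "\<bar>digit_cov H b i j p q\<bar> \<le> real b powr (H * (real i + real j)) * (L * d * \<delta> powr (2 * H - 2))"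
    unfolding digit_cov_def inverse_power_eq_powr L_def[symmetric] d_def[symmetric] A_def abs_mult by (intro mult_mono) auto
  also have "\<dots> = real b powr (H * (real i + real j) + (- real i + - real j + (- real i / 2) * (2 * H - 2)))"
    by (simp only: L_def d_def \<delta>_def powr_add powr_powr)
  also have "H * (real i + real j) + (- real i + - real j + (- real i / 2) * (2 * H - 2)) = - ((1 - H) * real j)"
    by (simp add: field_simps)
  also have "real b powr - ((1 - H) * real j) \<le> real b powr - (min H (1 - H) * real j)"
    using b by (intro powr_mono) (auto intro!: mult_right_mono)
  finally show ?thesis by (simp add: cov_rate_power)
qed

lemma digit_cov_near_far:
  assumes "i \<le> j"
  shows "\<bar>digit_cov H b i j p q\<bar> \<le> cov_rate H b ^ j +
    (if \<bar>real q / real b ^ j - real p / real b ^ i\<bar> < 2 * real b powr (- real i / 2) then 2 * cov_rate H b ^ (j - i) else 0)"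
proof (cases "\<bar>real q / real b ^ j - real p / real b ^ i\<bar> < 2 * real b powr (- real i / 2)")
  case True
  have "0 \<le> cov_rate H b ^ j" using cov_rate_pos by simp
  with digit_cov_le[OF assms, of p q] True show ?thesis by simp
next
  case False
  with digit_cov_far[OF assms, of q p] show ?thesis by simp
qed

text \<open>Near pairs only decay in j - i, but they are rare. Since min H (1 - H) \<le> 1/2, the
  missing factor b^(min H (1 - H) i) is at most b^(i/2), exactly what is saved by having only about
  b^(i/2) near cells among b^i.\<close>

lemma near_count_decay:
  assumes "i \<le> j" "0 \<le> c" "N \<le> c * real b powr (real i / 2)"
  shows "real b ^ i * cov_rate H b ^ j + N * (2 * cov_rate H b ^ (j - i)) \<le> (1 + 2 * c) * (real b ^ i * cov_rate H b ^ j)"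
proof -
  have "real b powr (real i / 2) * cov_rate H b ^ (j - i) = real b powr (real i / 2 - min H (1 - H) * real (j - i))"
    by (simp only: cov_rate_power powr_add[symmetric]) simp
  also have "\<dots> \<le> real b powr (real i - min H (1 - H) * real j)"
  proof (intro powr_mono)
    have "min H (1 - H) * real i \<le> 1 / 2 * real i" by (intro mult_right_mono) (auto simp: min_def)
    then show "real i / 2 - min H (1 - H) * real (j - i) \<le> real i - min H (1 - H) * real j"
      using assms by (simp add: of_nat_diff algebra_simps)
  qed (use b in auto)
  also have "\<dots> = real b ^ i * cov_rate H b ^ j"
    using b by (simp add: cov_rate_power powr_diff powr_minus_divide powr_realpow)
  finally have *: "real b powr (real i / 2) * cov_rate H b ^ (j - i) \<le> real b ^ i * cov_rate H b ^ j" .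
  have "N * (2 * cov_rate H b ^ (j - i)) \<le> c * real b powr (real i / 2) * (2 * cov_rate H b ^ (j - i))"
    using assms cov_rate_pos by (intro mult_right_mono) auto
  also have "\<dots> = 2 * c * (real b powr (real i / 2) * cov_rate H b ^ (j - i))" by simp
  also have "\<dots> \<le> 2 * c * (real b ^ i * cov_rate H b ^ j)" using assms * by (intro mult_left_mono) auto
  finally show ?thesis by (simp add: algebra_simps)
qed

lemma one_le_powr_half: "1 \<le> real b powr (real i / 2)"
  using b by (intro ge_one_powr_ge_zero) auto

lemma sum_digit_cov_pairs:
  assumes "i \<le> j"
  shows "(\<Sum>p<b ^ i. \<bar>digit_cov H b i j p q\<bar>) \<le> 11 * (real b ^ i * cov_rate H b ^ j)"
proof -
  let ?near = "\<lambda>p. \<bar>real q / real b ^ j - real p / real b ^ i\<bar> < 2 * real b powr (- real i / 2)"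
  have "(\<Sum>p<b ^ i. \<bar>digit_cov H b i j p q\<bar>) \<le> (\<Sum>p<b ^ i. cov_rate H b ^ j + (if ?near p then 2 * cov_rate H b ^ (j - i) else 0))"
    by (intro sum_mono digit_cov_near_far assms)
  also have "\<dots> = real b ^ i * cov_rate H b ^ j + real (card {p. p < b ^ i \<and> ?near p}) * (2 * cov_rate H b ^ (j - i))"
    by (simp only: sum.distrib sum_indicator_le) simp
  \<comment> \<open>Spacing b^(-i) and radius 2 b^(-i/2) leave at most 4 b^(i/2) + 1 near cells,
    which is at most 5 b^(i/2).\<close>
  also have "\<dots> \<le> (1 + 2 * 5) * (real b ^ i * cov_rate H b ^ j)"
  proof (rule near_count_decay[OF assms])
    have "real (card {p. p < b ^ i \<and> ?near p}) = real (card {p. p < b ^ i \<and>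
        \<bar>1 / real b ^ i * real p - real q / real b ^ j\<bar> < 2 * real b powr (- real i / 2)})"
      by (simp add: abs_minus_commute)
    also have "\<dots> \<le> 2 * (2 * real b powr (- real i / 2)) / (1 / real b ^ i) + 1"
      using b by (intro card_near_le) auto
    also have "\<dots> = 4 * real b powr (- real i / 2 - - real i) + 1"
      unfolding inverse_power_eq_powr powr_diff by simp
    also have "\<dots> \<le> 5 * real b powr (real i / 2)" using one_le_powr_half[of i] by simp
    finally show "real (card {p. p < b ^ i \<and> ?near p}) \<le> 5 * real b powr (real i / 2)" .
  qed simp
  finally show ?thesis by simp
qed

text \<open>Here the two cells belong to the same point and are not independent. Within a block of
  b^i consecutive q the residue at level i runs through all p, and the distance of the two cells is
  affine in p, so near cells can again be counted.\<close>

lemma sum_digit_cov_diagonal: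
  assumes "i < j"
  shows "(\<Sum>q<b ^ j. \<bar>digit_cov H b i j (q mod b ^ i) q\<bar>) \<le> 19 * (real b ^ j * cov_rate H b ^ j)"
proof -
  have block: "(\<Sum>p<b ^ i. \<bar>digit_cov H b i j p (a * b ^ i + p)\<bar>) \<le> 19 * (real b ^ i * cov_rate H b ^ j)" for a
  proof -
    let ?near = "\<lambda>p. \<bar>real (a * b ^ i + p) / real b ^ j - real p / real b ^ i\<bar> < 2 * real b powr (- real i / 2)"
    have "(\<Sum>p<b ^ i. \<bar>digit_cov H b i j p (a * b ^ i + p)\<bar>) \<le>
        (\<Sum>p<b ^ i. cov_rate H b ^ j + (if ?near p then 2 * cov_rate H b ^ (j - i) else 0))"
      using assms by (intro sum_mono digit_cov_near_far) simp
    also have "\<dots> = real b ^ i * cov_rate H b ^ j + real (card {p. p < b ^ i \<and> ?near p}) * (2 * cov_rate H b ^ (j - i))"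
      by (simp only: sum.distrib sum_indicator_le) simp
    also have "\<dots> \<le> (1 + 2 * 9) * (real b ^ i * cov_rate H b ^ j)"
    proof (rule near_count_decay)
      \<comment> \<open>The slope in p of the difference of the positions. As i < j it is at least
        half of b^(-i), which costs a factor 2 compared with the count for fixed q.\<close>
      define c where "c = 1 / real b ^ i - 1 / real b ^ j"
      have "real b ^ Suc i \<le> real b ^ j" using assms b by (intro power_increasing) auto
      moreover have "2 * real b ^ i \<le> real b ^ Suc i" using b by simp
      ultimately have "2 * real b ^ i \<le> real b ^ j" by linarith
      then have c: "1 / (2 * real b ^ i) \<le> c"
        unfolding c_def using b by (simp add: field_simps)
      have "0 < 1 / (2 * real b ^ i)" using b by simp
      with c have "0 < c" by linarith
      have "real (card {p. p < b ^ i \<and> ?near p}) = real (card {p. p < b ^ i \<and>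
          \<bar>c * real p - real (a * b ^ i) / real b ^ j\<bar> < 2 * real b powr (- real i / 2)})"
        unfolding c_def by (simp add: abs_minus_commute algebra_simps add_divide_distrib)
      also have "\<dots> \<le> 2 * (2 * real b powr (- real i / 2)) / c + 1"
        using \<open>0 < c\<close> by (intro card_near_le) auto
      also have "\<dots> \<le> 2 * (2 * real b powr (- real i / 2)) / (1 / (2 * real b ^ i)) + 1"
        using c b \<open>0 < c\<close> by (intro add_right_mono divide_left_mono) auto
      also have "\<dots> = 8 * (real b powr (- real i / 2) * real b powr real i) + 1"
        using b by (simp add: powr_realpow)
      also have "\<dots> = 8 * real b powr (real i / 2) + 1"
        by (simp only: powr_add[symmetric]) simp
      also have "\<dots> \<le> 9 * real b powr (real i / 2)" using one_le_powr_half[of i] by simp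
      finally show "real (card {p. p < b ^ i \<and> ?near p}) \<le> 9 * real b powr (real i / 2)" .
    qed (use assms in auto)
    finally show ?thesis by simp
  qed
  have "b ^ j = b ^ (j - i) * b ^ i" using assms by (simp add: power_add[symmetric])
  then have "(\<Sum>q<b ^ j. \<bar>digit_cov H b i j (q mod b ^ i) q\<bar>) =
      (\<Sum>a<b ^ (j - i). \<Sum>p<b ^ i. \<bar>digit_cov H b i j ((a * b ^ i + p) mod b ^ i) (a * b ^ i + p)\<bar>)"
    by (simp only: sum_lessThan_mult)
  also have "\<dots> = (\<Sum>a<b ^ (j - i). \<Sum>p<b ^ i. \<bar>digit_cov H b i j p (a * b ^ i + p)\<bar>)"
    by (intro sum.cong refl) simp
  also have "\<dots> \<le> (\<Sum>a<b ^ (j - i). 19 * (real b ^ i * cov_rate H b ^ j))"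
    by (intro sum_mono block)
  also have "\<dots> = 19 * ((real b ^ (j - i) * real b ^ i) * cov_rate H b ^ j)" by simp
  also have "real b ^ (j - i) * real b ^ i = real b ^ j" using assms by (simp add: power_add[symmetric])
  finally show ?thesis .
qed

lemma digit_cov_self: "digit_cov H b i i p p = 1"
proof -
  have "increment_cov H (- (1 / real b ^ i)) (1 / real b ^ i) (1 / real b ^ i) = real b powr (- real i * (2 * H))"
    unfolding increment_cov_def inverse_power_eq_powr by (simp add: powr_powr)
  then show ?thesis unfolding digit_cov_def using b by (simp add: powr_add[symmetric] algebra_simps)
qed

text \<open>The maximum is at least the mean of i and j; the product form splits double sums over
  levels into products of geometric series.\<close>

lemma power_max_le:
  "cov_rate H b ^ max i j \<le> sqrt (cov_rate H b) ^ (i + j)"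
proof -
  have "cov_rate H b ^ max i j = sqrt (cov_rate H b) ^ (2 * max i j)"
    using cov_rate_pos by (simp add: power_mult)
  also have "\<dots> \<le> sqrt (cov_rate H b) ^ (i + j)"
    using cov_rate_pos cov_rate_less_1 by (intro power_decreasing) auto
  finally show ?thesis .
qed

lemma digit_cov_dist_le:
  "\<bar>digit_cov H b i j p q\<bar> \<le> 2 * cov_rate H b ^ (max i j - min i j)"
  using digit_cov_le[of i j p q] digit_cov_le[of j i q p] by (cases "i \<le> j") (auto simp: digit_cov_commute max_def min_def)

lemma sum_digit_cov_square:
  assumes "i \<le> n" "j \<le> n"
  shows "(\<Sum>k<b ^ n. \<Sum>l<b ^ n. \<bar>digit_cov H b i j (k mod b ^ i) (l mod b ^ j)\<bar>)
    \<le> 11 * ((real b ^ n)\<^sup>2 * cov_rate H b ^ max i j)"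
proof -
  have *: "(\<Sum>q<b ^ j. \<Sum>p<b ^ i. \<bar>digit_cov H b i j p q\<bar>) \<le> 11 * (real b ^ i * real b ^ j * cov_rate H b ^ j)"
    if "i \<le> j" for i j
  proof -
    have "(\<Sum>q<b ^ j. \<Sum>p<b ^ i. \<bar>digit_cov H b i j p q\<bar>) \<le> (\<Sum>q<b ^ j. 11 * (real b ^ i * cov_rate H b ^ j))"
      by (intro sum_mono sum_digit_cov_pairs that)
    then show ?thesis by (simp add: algebra_simps)
  qed
  have **: "(\<Sum>p<b ^ i. \<Sum>q<b ^ j. \<bar>digit_cov H b i j p q\<bar>) \<le> 11 * (real b ^ i * real b ^ j * cov_rate H b ^ max i j)"
  proof (cases "i \<le> j")
    case True
    then show ?thesis using *[OF True] by (subst sum.swap) (simp add: max_def)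
  next
    case False
    then have "j \<le> i" by simp
    from *[OF this] False show ?thesis
      by (simp add: max_def digit_cov_commute[of H b j i] mult.commute mult.left_commute)
  qed
  have "(\<Sum>k<b ^ n. \<Sum>l<b ^ n. \<bar>digit_cov H b i j (k mod b ^ i) (l mod b ^ j)\<bar>)
      = real b ^ (n - i) * real b ^ (n - j) * (\<Sum>p<b ^ i. \<Sum>q<b ^ j. \<bar>digit_cov H b i j p q\<bar>)"
    using sum_mod_power[OF assms(1), where b = b and f = "\<lambda>p. \<Sum>l<b ^ n. \<bar>digit_cov H b i j p (l mod b ^ j)\<bar>"]
      sum_mod_power[OF assms(2), where b = b and f = "\<lambda>q. \<bar>digit_cov H b i j _ q\<bar>"]
    by (simp add: sum_distrib_left mult.assoc)
  also have "\<dots> \<le> real b ^ (n - i) * real b ^ (n - j) * (11 * (real b ^ i * real b ^ j * cov_rate H b ^ max i j))"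
    by (intro mult_left_mono **) auto
  also have "\<dots> = 11 * ((real b ^ (n - i) * real b ^ i) * (real b ^ (n - j) * real b ^ j) * cov_rate H b ^ max i j)"
    by simp
  also have "\<dots> = 11 * ((real b ^ n)\<^sup>2 * cov_rate H b ^ max i j)"
    using assms by (simp add: power_add[symmetric] power2_eq_square)
  finally show ?thesis .
qed

text \<open>For i < j the residue modulo b^i depends only on the one modulo b^j, so every q < b^j is
  met equally often and the diagonal estimate applies. Equal levels are excluded, as they contribute
  1 each.\<close>

lemma sum_digit_cov_same:
  assumes "i \<le> n" "j \<le> n" "i \<noteq> j"
  shows "(\<Sum>k<b ^ n. \<bar>digit_cov H b i j (k mod b ^ i) (k mod b ^ j)\<bar>)
    \<le> 19 * (real b ^ n * cov_rate H b ^ max i j)"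
proof -
  have *: "(\<Sum>k<b ^ n. \<bar>digit_cov H b i j (k mod b ^ i) (k mod b ^ j)\<bar>)
    \<le> 19 * (real b ^ n * cov_rate H b ^ j)" if "i < j" "j \<le> n" for i j
  proof -
    have "b ^ i dvd b ^ j" using that by (intro le_imp_power_dvd) simp
    then have "k mod b ^ i = (k mod b ^ j) mod b ^ i" for k by (simp add: mod_mod_cancel)
    then have "(\<Sum>k<b ^ n. \<bar>digit_cov H b i j (k mod b ^ i) (k mod b ^ j)\<bar>) =
       (\<Sum>k<b ^ n. \<bar>digit_cov H b i j ((k mod b ^ j) mod b ^ i) (k mod b ^ j)\<bar>)" by presburger
    also have "\<dots> = real b ^ (n - j) * (\<Sum>q<b ^ j. \<bar>digit_cov H b i j (q mod b ^ i) q\<bar>)"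
      by (rule sum_mod_power[OF that(2)])
    also have "\<dots> \<le> real b ^ (n - j) * (19 * (real b ^ j * cov_rate H b ^ j))"
      by (intro mult_left_mono sum_digit_cov_diagonal that) auto
    also have "\<dots> = 19 * ((real b ^ (n - j) * real b ^ j) * cov_rate H b ^ j)" by simp
    also have "real b ^ (n - j) * real b ^ j = real b ^ n" using that by (simp add: power_add[symmetric])
    finally show ?thesis .
  qed
  show ?thesis
  proof (cases "i < j")
    case True
    then show ?thesis using *[OF True assms(2)] by (simp add: max_def)
  next
    case False
    then have "j < i" using assms by simp
    from *[OF this assms(1)] False show ?thesis
      by (simp add: max_def digit_cov_commute[of H b j i])
  qed
qed

text \<open>For fixed i each level difference occurs at most once on either side, so a row is
  bounded by two geometric series with factor 2. This holds for every pair of cells, also where the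
  averaged estimates say nothing.\<close>

lemma path_cov_bound: "\<exists>C\<ge>0. \<forall>n k l. \<bar>path_cov H b n k l\<bar> \<le> C * real n"
proof (intro exI conjI allI)
  let ?\<theta> = "cov_rate H b"
  show "4 / (1 - ?\<theta>) \<ge> 0" using cov_rate_less_1 by simp
  fix n k l
  have "\<bar>path_cov H b n k l\<bar> \<le> (\<Sum>i\<in>{1..n}. \<bar>\<Sum>j\<in>{1..n}. digit_cov H b i j (k mod b ^ i) (l mod b ^ j)\<bar>)"
    unfolding path_cov_def by (rule sum_abs)
  also have "\<dots> \<le> (\<Sum>i\<in>{1..n}. 4 / (1 - ?\<theta>))"
  proof (rule sum_mono)
    fix i
    have "\<bar>\<Sum>j\<in>{1..n}. digit_cov H b i j (k mod b ^ i) (l mod b ^ j)\<bar>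
        \<le> (\<Sum>j\<in>{1..n}. \<bar>digit_cov H b i j (k mod b ^ i) (l mod b ^ j)\<bar>)" by (rule sum_abs)
    also have "\<dots> \<le> (\<Sum>j\<in>{1..n}. 2 * ?\<theta> ^ (max i j - min i j))"
      by (intro sum_mono digit_cov_dist_le)
    also have "\<dots> = (\<Sum>j\<in>{1..n} \<inter> {..i}. 2 * ?\<theta> ^ (max i j - min i j)) + (\<Sum>j\<in>{1..n} - {..i}. 2 * ?\<theta> ^ (max i j - min i j))"
      by (rule sum.Int_Diff) simp
    also have "(\<Sum>j\<in>{1..n} \<inter> {..i}. 2 * ?\<theta> ^ (max i j - min i j)) = 2 * (\<Sum>j\<in>{1..n} \<inter> {..i}. ?\<theta> ^ (i - j))"
      unfolding sum_distrib_left by (intro sum.cong refl) (auto simp: max_absorb1 max_absorb2 min_absorb1 min_absorb2)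
    also have "(\<Sum>j\<in>{1..n} - {..i}. 2 * ?\<theta> ^ (max i j - min i j)) = 2 * (\<Sum>j\<in>{1..n} - {..i}. ?\<theta> ^ (j - i))"
      unfolding sum_distrib_left by (intro sum.cong refl) (auto simp: max_absorb1 max_absorb2 min_absorb1 min_absorb2)
    also have "2 * (\<Sum>j\<in>{1..n} \<inter> {..i}. ?\<theta> ^ (i - j)) + 2 * (\<Sum>j\<in>{1..n} - {..i}. ?\<theta> ^ (j - i))
        \<le> 2 * (1 / (1 - ?\<theta>)) + 2 * (1 / (1 - ?\<theta>))"
      using cov_rate_pos cov_rate_less_1
      by (intro add_mono mult_left_mono sum_inj_power_le) (auto simp: inj_on_def)
    finally show "\<bar>\<Sum>j\<in>{1..n}. digit_cov H b i j (k mod b ^ i) (l mod b ^ j)\<bar> \<le> 4 / (1 - ?\<theta>)" by simp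
  qed
  finally show "\<bar>path_cov H b n k l\<bar> \<le> 4 / (1 - ?\<theta>) * real n" by (simp add: mult.commute)
qed

lemma sum_sum_power_add:
  fixes x :: real
  assumes "0 \<le> x" "x < 1"
  shows "(\<Sum>i\<in>{1..n}. \<Sum>j\<in>{1..n}. x ^ (i + j)) \<le> (1 / (1 - x))\<^sup>2"
proof -
  have "(\<Sum>i\<in>{1..n}. \<Sum>j\<in>{1..n}. x ^ (i + j)) = (\<Sum>i\<in>{1..n}. x ^ i)\<^sup>2"
    by (simp add: power_add sum_product power2_eq_square)
  also have "\<dots> \<le> (1 / (1 - x))\<^sup>2"
    using assms by (intro power_mono sum_inj_power_le[where g = "\<lambda>i. i"] sum_nonneg) auto
  finally show ?thesis .
qed

text \<open>The n terms with equal levels give exactly n; the others are summable after averaging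
  over k. So the variance of S / sqrt n deviates from 1 by O(1/n) on average.\<close>

lemma path_cov_diagonal: "\<exists>C\<ge>0. \<forall>n. (\<Sum>k<b ^ n. \<bar>path_cov H b n k k - real n\<bar>) \<le> C * real b ^ n"
proof (intro exI conjI allI)
  let ?s = "sqrt (cov_rate H b)"
  have s: "0 \<le> ?s" "?s < 1" using cov_rate_pos cov_rate_less_1 by auto
  show "19 * (1 / (1 - ?s))\<^sup>2 \<ge> 0" by simp
  fix n
  let ?D = "\<lambda>k i j. digit_cov H b i j (k mod b ^ i) (k mod b ^ j)"
  have "\<bar>path_cov H b n k k - real n\<bar> \<le> (\<Sum>i\<in>{1..n}. \<Sum>j\<in>{1..n}-{i}. \<bar>?D k i j\<bar>)" for k
  proof -
    have split: "(\<Sum>j\<in>{1..n}. ?D k i j) = 1 + (\<Sum>j\<in>{1..n}-{i}. ?D k i j)" if "i \<in> {1..n}" for i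
      using sum.remove[of "{1..n}" i "?D k i"] that by (simp add: digit_cov_self)
    have "path_cov H b n k k = (\<Sum>i\<in>{1..n}. 1 + (\<Sum>j\<in>{1..n}-{i}. ?D k i j))"
      unfolding path_cov_def by (rule sum.cong[OF refl], rule split)
    then have "\<bar>path_cov H b n k k - real n\<bar> = \<bar>\<Sum>i\<in>{1..n}. \<Sum>j\<in>{1..n}-{i}. ?D k i j\<bar>"
      by (simp add: sum.distrib)
    also have "\<dots> \<le> (\<Sum>i\<in>{1..n}. \<bar>\<Sum>j\<in>{1..n}-{i}. ?D k i j\<bar>)" by (rule sum_abs)
    also have "\<dots> \<le> (\<Sum>i\<in>{1..n}. \<Sum>j\<in>{1..n}-{i}. \<bar>?D k i j\<bar>)" by (rule sum_mono, rule sum_abs)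
    finally show ?thesis .
  qed
  then have "(\<Sum>k<b ^ n. \<bar>path_cov H b n k k - real n\<bar>) \<le> (\<Sum>k<b ^ n. \<Sum>i\<in>{1..n}. \<Sum>j\<in>{1..n}-{i}. \<bar>?D k i j\<bar>)"
    by (intro sum_mono)
  also have "\<dots> = (\<Sum>i\<in>{1..n}. \<Sum>j\<in>{1..n}-{i}. \<Sum>k<b ^ n. \<bar>?D k i j\<bar>)"
    by (subst sum.swap) (intro sum.cong refl sum.swap)
  also have "\<dots> \<le> (\<Sum>i\<in>{1..n}. \<Sum>j\<in>{1..n}-{i}. 19 * (real b ^ n * ?s ^ (i + j)))"
    by (intro sum_mono order_trans[OF sum_digit_cov_same] mult_left_mono power_max_le) auto
  also have "\<dots> \<le> (\<Sum>i\<in>{1..n}. \<Sum>j\<in>{1..n}. 19 * (real b ^ n * ?s ^ (i + j)))"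
    using s by (intro sum_mono sum_mono2) auto
  also have "\<dots> = 19 * real b ^ n * (\<Sum>i\<in>{1..n}. \<Sum>j\<in>{1..n}. ?s ^ (i + j))"
    by (simp add: sum_distrib_left mult.assoc)
  also have "\<dots> \<le> 19 * real b ^ n * (1 / (1 - ?s))\<^sup>2"
    by (intro mult_left_mono sum_sum_power_add s) auto
  finally show "(\<Sum>k<b ^ n. \<bar>path_cov H b n k k - real n\<bar>) \<le> 19 * (1 / (1 - ?s))\<^sup>2 * real b ^ n"
    by (simp add: mult_ac)
qed

text \<open>Weighted Cauchy-Schwarz with weights u^(i+j), where u is the fourth root of
  \<open>cov_rate\<close>: the averaged covariances decay like u^(2(i+j)), so dividing by the weight
  still leaves the summable u^(i+j). Since \<bar>\<open>digit_cov\<close>\<bar> \<le> 2, squares of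
  single terms are at most twice their absolute values, to which \<open>sum_digit_cov_square\<close>
  applies.\<close>

lemma path_cov_square: "\<exists>C\<ge>0. \<forall>n::nat. (\<Sum>k<b ^ n. \<Sum>l<b ^ n. (path_cov H b n k l)\<^sup>2) \<le> C * (real b ^ n)\<^sup>2"
proof (intro exI conjI allI)
  let ?s = "sqrt (cov_rate H b)"
  define u where "u = sqrt ?s"
  have u: "0 < u" "u < 1" "u * u = ?s" using cov_rate_pos cov_rate_less_1 by (auto simp: u_def)
  let ?G = "(1 / (1 - u))\<^sup>2"
  show "?G * (22 * ?G) \<ge> 0" by simp
  fix n :: nat
  let ?D = "\<lambda>k l i j. digit_cov H b i j (k mod b ^ i) (l mod b ^ j)"
  let ?I = "{1..n} \<times> {1..n}"
  have CS: "(path_cov H b n k l)\<^sup>2 \<le> ?G * (\<Sum>i\<in>{1..n}. \<Sum>j\<in>{1..n}. 2 * \<bar>?D k l i j\<bar> / u ^ (i + j))" for k l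
  proof -
    let ?a = "\<lambda>(i, j). sqrt (u ^ (i + j))"
    have "path_cov H b n k l = (\<Sum>x\<in>?I. ?a x * ((case x of (i, j) \<Rightarrow> ?D k l i j) / ?a x))"
      unfolding path_cov_def sum.cartesian_product using u by (intro sum.cong) (auto simp: real_sqrt_eq_zero_cancel_iff)
    then have "(path_cov H b n k l)\<^sup>2 \<le> (\<Sum>x\<in>?I. (?a x)\<^sup>2) * (\<Sum>x\<in>?I. ((case x of (i, j) \<Rightarrow> ?D k l i j) / ?a x)\<^sup>2)"
      by (simp only: Cauchy_Schwarz_ineq_sum)
    also have "(\<Sum>x\<in>?I. (?a x)\<^sup>2) = (\<Sum>i\<in>{1..n}. \<Sum>j\<in>{1..n}. u ^ (i + j))"
      unfolding sum.cartesian_product using u by (intro sum.cong) auto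
    also have "(\<Sum>x\<in>?I. ((case x of (i, j) \<Rightarrow> ?D k l i j) / ?a x)\<^sup>2) =
        (\<Sum>i\<in>{1..n}. \<Sum>j\<in>{1..n}. (?D k l i j)\<^sup>2 / u ^ (i + j))"
      unfolding sum.cartesian_product using u by (intro sum.cong) (auto simp: power_divide)
    also have "(\<Sum>i\<in>{1..n}. \<Sum>j\<in>{1..n}. u ^ (i + j)) * (\<Sum>i\<in>{1..n}. \<Sum>j\<in>{1..n}. (?D k l i j)\<^sup>2 / u ^ (i + j))
       \<le> ?G * (\<Sum>i\<in>{1..n}. \<Sum>j\<in>{1..n}. 2 * \<bar>?D k l i j\<bar> / u ^ (i + j))"
    proof (intro mult_mono sum_mono divide_right_mono)
      show "(\<Sum>i\<in>{1..n}. \<Sum>j\<in>{1..n}. u ^ (i + j)) \<le> ?G" using u by (intro sum_sum_power_add) auto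
      fix i j
      have "cov_rate H b ^ (max i j - min i j) \<le> 1" using cov_rate_pos cov_rate_less_1 by (intro power_le_one) auto
      with digit_cov_dist_le[of i j "k mod b ^ i" "l mod b ^ j"] have "\<bar>?D k l i j\<bar> \<le> 2" by linarith
      then have "\<bar>?D k l i j\<bar> * \<bar>?D k l i j\<bar> \<le> 2 * \<bar>?D k l i j\<bar>" by (intro mult_right_mono) auto
      then show "(?D k l i j)\<^sup>2 \<le> 2 * \<bar>?D k l i j\<bar>" by (simp add: power2_eq_square)
    qed (use u in \<open>auto intro!: sum_nonneg\<close>)
    finally show ?thesis .
  qed
  have pairs: "(\<Sum>i\<in>{1..n}. \<Sum>j\<in>{1..n}. 2 * \<bar>?D k l i j\<bar> / u ^ (i + j)) =
      (\<Sum>x\<in>?I. case x of (i, j) \<Rightarrow> 2 * \<bar>?D k l i j\<bar> / u ^ (i + j))" for k l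
    by (rule sum.cartesian_product)
  have "(\<Sum>k<b ^ n. \<Sum>l<b ^ n. (path_cov H b n k l)\<^sup>2) \<le>
      (\<Sum>k<b ^ n. \<Sum>l<b ^ n. ?G * (\<Sum>i\<in>{1..n}. \<Sum>j\<in>{1..n}. 2 * \<bar>?D k l i j\<bar> / u ^ (i + j)))"
    by (intro sum_mono CS)
  also have "\<dots> = ?G * (\<Sum>k<b ^ n. \<Sum>l<b ^ n. \<Sum>x\<in>?I. case x of (i, j) \<Rightarrow> 2 * \<bar>?D k l i j\<bar> / u ^ (i + j))"
    by (simp only: pairs sum_distrib_left)
  also have "(\<Sum>k<b ^ n. \<Sum>l<b ^ n. \<Sum>x\<in>?I. case x of (i, j) \<Rightarrow> 2 * \<bar>?D k l i j\<bar> / u ^ (i + j))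
      = (\<Sum>k<b ^ n. \<Sum>x\<in>?I. \<Sum>l<b ^ n. case x of (i, j) \<Rightarrow> 2 * \<bar>?D k l i j\<bar> / u ^ (i + j))"
    by (intro sum.cong refl sum.swap)
  also have "\<dots> = (\<Sum>x\<in>?I. \<Sum>k<b ^ n. \<Sum>l<b ^ n. case x of (i, j) \<Rightarrow> 2 * \<bar>?D k l i j\<bar> / u ^ (i + j))"
    by (rule sum.swap)
  also have "\<dots> = (\<Sum>(i, j)\<in>?I. 2 * (\<Sum>k<b ^ n. \<Sum>l<b ^ n. \<bar>?D k l i j\<bar>) / u ^ (i + j))"
    by (intro sum.cong refl) (simp add: sum_distrib_left sum_divide_distrib split: prod.split)
  also have "\<dots> \<le> (\<Sum>(i, j)\<in>?I. 22 * (real b ^ n)\<^sup>2 * u ^ (i + j))"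
  proof (intro sum_mono, clarify)
    fix i j assume ij: "i \<in> {1..n}" "j \<in> {1..n}"
    then have "(\<Sum>k<b ^ n. \<Sum>l<b ^ n. \<bar>?D k l i j\<bar>) \<le> 11 * ((real b ^ n)\<^sup>2 * ?s ^ (i + j))"
      by (intro order_trans[OF sum_digit_cov_square] mult_left_mono power_max_le) auto
    then have "2 * (\<Sum>k<b ^ n. \<Sum>l<b ^ n. \<bar>?D k l i j\<bar>) \<le> 2 * (11 * ((real b ^ n)\<^sup>2 * ?s ^ (i + j)))"
      by linarith
    then have "2 * (\<Sum>k<b ^ n. \<Sum>l<b ^ n. \<bar>?D k l i j\<bar>) / u ^ (i + j) \<le> 2 * (11 * ((real b ^ n)\<^sup>2 * ?s ^ (i + j))) / u ^ (i + j)"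
      by (rule divide_right_mono) (use u in simp)
    also have "?s ^ (i + j) = u ^ (i + j) * u ^ (i + j)" by (simp only: u(3)[symmetric] power_mult_distrib)
    also have "2 * (11 * ((real b ^ n)\<^sup>2 * (u ^ (i + j) * u ^ (i + j)))) / u ^ (i + j) = 22 * (real b ^ n)\<^sup>2 * u ^ (i + j)"
      using u by simp
    finally show "2 * (\<Sum>k<b ^ n. \<Sum>l<b ^ n. \<bar>?D k l i j\<bar>) / u ^ (i + j) \<le> 22 * (real b ^ n)\<^sup>2 * u ^ (i + j)" .
  qed
  also have "\<dots> = 22 * (real b ^ n)\<^sup>2 * (\<Sum>i\<in>{1..n}. \<Sum>j\<in>{1..n}. u ^ (i + j))"
    unfolding sum.cartesian_product by (simp add: sum_distrib_left split_def)
  also have "\<dots> \<le> 22 * (real b ^ n)\<^sup>2 * ?G" using u by (intro mult_left_mono sum_sum_power_add) auto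
  finally have "(\<Sum>k<b ^ n. \<Sum>l<b ^ n. (path_cov H b n k l)\<^sup>2) \<le> ?G * (22 * (real b ^ n)\<^sup>2 * ?G)"
    by (simp add: mult_left_mono)
  then show "(\<Sum>k<b ^ n. \<Sum>l<b ^ n. (path_cov H b n k l)\<^sup>2) \<le> ?G * (22 * ?G) * (real b ^ n)\<^sup>2"
    by (simp only: mult_ac)
qed

end

section \<open>Convergence of empirical moments to normal moments\<close>

lemma nn_integral_abs_moment_halfline:
  fixes p :: real
  assumes "0 < p"
  shows "(\<integral>\<^sup>+y. ennreal (indicator {0..} y * (y powr p * exp (- y\<^sup>2 / 2))) \<partial>lborel)
    = ennreal (2 powr ((p - 1) / 2) * Gamma ((p + 1) / 2))"
proof -
  define s where "s = (p + 1) / 2"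
  have s: "s > 0" using assms by (simp add: s_def)
  define f where "f t = ennreal (t powr (s - 1) / exp t)" for t :: real
  \<comment> \<open>Substituting t = y^2/2 turns the Gamma integral at s into the moment. The
    substitution is made on compact intervals, and monotone convergence passes to the half-line on
    both sides.\<close>
  define g where "g y = y\<^sup>2 / 2" for y :: real
  have [measurable]: "f \<in> borel_measurable borel" unfolding f_def by measurable
  have subst: "(\<integral>\<^sup>+t. f t * indicator {0..g (real n)} t \<partial>lborel)
      = (\<integral>\<^sup>+y. f (g y) * ennreal y * indicator {0..real n} y \<partial>lborel)" for n :: nat
  proof -
    have "(\<integral>\<^sup>+t. f t * indicator {g 0..g (real n)} t \<partial>lborel)
      = (\<integral>\<^sup>+y. f (g y) * ennreal y * indicator {0..real n} y \<partial>lborel)"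
    proof (cases "n = 0")
      case True
      then show ?thesis
        by (simp add: g_def nn_integral_0_iff_AE)
    next
      case False
      then show ?thesis unfolding g_def
        by (intro nn_integral_substitution_aux)
          (auto intro!: derivative_eq_intros continuous_intros simp: f_def)
    qed
    then show ?thesis by (simp add: g_def)
  qed
  have "(\<lambda>n. \<integral>\<^sup>+t. f t * indicator {0..g (real n)} t \<partial>lborel) \<longlonglongrightarrow> (\<integral>\<^sup>+t. f t * indicator {0..} t \<partial>lborel)"
  proof (rule nn_integral_LIMSEQ)
    show "incseq (\<lambda>n t. f t * indicator {0..g (real n)} t)"
    proof (intro incseq_SucI le_funI mult_left_mono)
      fix n t
      have "g (real n) \<le> g (real (Suc n))"
        unfolding g_def by (intro divide_right_mono power_mono) auto
      then show "indicator {0..g (real n)} t \<le> (indicator {0..g (real (Suc n))} t :: ennreal)"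
        by (auto split: split_indicator)
    qed auto
    show "(\<lambda>n. f t * indicator {0..g (real n)} t) \<longlonglongrightarrow> f t * indicator {0..} t" for t
    proof (rule tendsto_eventually)
      \<comment> \<open>The summand 2 ensures n \<ge> 2, so that n^2/2 is at least n.\<close>
      have "t \<le> g (real n)" if "n \<ge> nat \<lceil>\<bar>t\<bar>\<rceil> + 2" for n
      proof -
        have n: "\<bar>t\<bar> \<le> real n" "2 \<le> real n" using that by linarith+
        have "real n * 2 \<le> real n * real n" using n by (intro mult_left_mono) auto
        then show ?thesis using n unfolding g_def power2_eq_square by linarith
      qed
      then show "\<forall>\<^sub>F n in sequentially. f t * indicator {0..g (real n)} t = f t * indicator {0..} t"
        by (auto simp: eventually_sequentially split: split_indicator)
    qed
  qed auto
  moreover have "(\<lambda>n. \<integral>\<^sup>+y. f (g y) * ennreal y * indicator {0..real n} y \<partial>lborel)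
      \<longlonglongrightarrow> (\<integral>\<^sup>+y. f (g y) * ennreal y * indicator {0..} y \<partial>lborel)"
  proof (rule nn_integral_LIMSEQ)
    show "incseq (\<lambda>n y. f (g y) * ennreal y * indicator {0..real n} y)"
      by (intro incseq_SucI le_funI mult_left_mono) (auto split: split_indicator)
    show "(\<lambda>n. f (g t) * ennreal t * indicator {0..real n} t) \<longlonglongrightarrow> f (g t) * ennreal t * indicator {0..} t" for t
    proof (rule tendsto_eventually)
      have "t \<le> real n" if "n \<ge> nat \<lceil>\<bar>t\<bar>\<rceil>" for n using that by linarith
      then have "indicator {0..real n} t = (indicator {0..} t :: ennreal)" if "n \<ge> nat \<lceil>\<bar>t\<bar>\<rceil>" for n
        using that by (auto split: split_indicator)
      then show "\<forall>\<^sub>F n in sequentially. f (g t) * ennreal t * indicator {0..real n} t = f (g t) * ennreal t * indicator {0..} t"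
        by (intro eventually_sequentiallyI[of "nat \<lceil>\<bar>t\<bar>\<rceil>"]) simp
    qed
  qed (auto simp: g_def)
  ultimately have eq: "(\<integral>\<^sup>+t. f t * indicator {0..} t \<partial>lborel) = (\<integral>\<^sup>+y. f (g y) * ennreal y * indicator {0..} y \<partial>lborel)"
    unfolding subst by (rule LIMSEQ_unique)
  have "(\<integral>\<^sup>+t. f t * indicator {0..} t \<partial>lborel) = ennreal (Gamma s)"
    unfolding Gamma_conv_nn_integral_real[OF s] f_def
    by (intro nn_integral_cong) (auto split: split_indicator)
  have pw: "f (g y) * ennreal y * indicator {0..} y =
      ennreal (2 powr ((1 - p) / 2)) * ennreal (indicator {0..} y * (y powr p * exp (- y\<^sup>2 / 2)))" for y
  proof (cases "y > 0")
    case True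
    have "g y powr (s - 1) = y powr (p - 1) * 2 powr ((1 - p) / 2)"
    proof -
      have "g y = y powr 2 * 2 powr (-1)" using True by (simp add: g_def powr_minus_divide)
      then have "g y powr (s - 1) = (y powr 2 * 2 powr (-1)) powr (s - 1)" by (simp only:)
      also have "\<dots> = (y powr 2) powr (s - 1) * (2 powr (-1)) powr (s - 1)"
        by (rule powr_mult)
      also have "\<dots> = y powr (2 * (s - 1)) * 2 powr (- 1 * (s - 1))"
        by (simp only: powr_powr)
      also have "2 * (s - 1) = p - 1" by (simp add: s_def field_simps)
      also have "- 1 * (s - 1) = (1 - p) / 2" by (simp add: s_def field_simps)
      finally show ?thesis .
    qed
    moreover have "y powr (p - 1) * y = y powr p" using True by (simp add: powr_diff)
    ultimately have "g y powr (s - 1) / exp (g y) * y = 2 powr ((1 - p) / 2) * (y powr p * exp (- y\<^sup>2 / 2))"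
      by (simp add: g_def exp_minus field_simps)
    then show ?thesis using True unfolding f_def
      by (simp add: ennreal_mult[symmetric])
  next
    case False
    then show ?thesis by (cases "y = 0") (auto split: split_indicator)
  qed
  have "ennreal (2 powr ((1 - p) / 2)) * (\<integral>\<^sup>+y. ennreal (indicator {0..} y * (y powr p * exp (- y\<^sup>2 / 2))) \<partial>lborel) = ennreal (Gamma s)"
    using eq \<open>_ = ennreal (Gamma s)\<close> unfolding pw by (subst nn_integral_cmult[symmetric]) auto
  then have "ennreal (2 powr ((p - 1) / 2)) * (ennreal (2 powr ((1 - p) / 2)) * (\<integral>\<^sup>+y. ennreal (indicator {0..} y * (y powr p * exp (- y\<^sup>2 / 2))) \<partial>lborel)) = ennreal (2 powr ((p - 1) / 2)) * ennreal (Gamma s)"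
    by simp
  moreover have "ennreal (2 powr ((p - 1) / 2)) * ennreal (2 powr ((1 - p) / 2)) = 1"
    by (simp add: ennreal_mult[symmetric] powr_add[symmetric] add_divide_distrib[symmetric])
  ultimately show ?thesis
    using s by (simp add: mult.assoc[symmetric] ennreal_mult[symmetric] Gamma_real_pos less_imp_le s_def)
qed

lemma has_bochner_integral_abs_powr_std_normal:
  fixes p :: real
  assumes "0 < p"
  shows "has_bochner_integral std_normal_distribution (\<lambda>x. \<bar>x\<bar> powr p) (2 powr (p / 2) * Gamma ((p + 1) / 2) / sqrt pi)"
proof -
  let ?I = "2 powr ((p - 1) / 2) * Gamma ((p + 1) / 2)"
  have pos: "?I \<ge> 0" using assms by (simp add: Gamma_real_pos less_imp_le)
  have "has_bochner_integral lborel (\<lambda>y. indicator {0..} y * (y powr p * exp (- y\<^sup>2 / 2))) ?I"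
    using nn_integral_abs_moment_halfline[OF assms] pos
    by (intro has_bochner_integral_nn_integral) auto
  moreover have "(\<lambda>y::real. indicator {0..} y * (y powr p * exp (- y\<^sup>2 / 2)))
      = (\<lambda>y. indicator {0..} y *\<^sub>R (\<bar>y\<bar> powr p * exp (- y\<^sup>2 / 2)))"
    by (auto simp: fun_eq_iff split: split_indicator)
  ultimately have "has_bochner_integral lborel (\<lambda>y. \<bar>y\<bar> powr p * exp (- y\<^sup>2 / 2)) (2 *\<^sub>R ?I)"
    by (intro has_bochner_integral_even_function) auto
  then have "has_bochner_integral lborel (\<lambda>y. 1 / sqrt (2 * pi) * (\<bar>y\<bar> powr p * exp (- y\<^sup>2 / 2))) (1 / sqrt (2 * pi) * (2 *\<^sub>R ?I))"
    by (rule has_bochner_integral_mult_right)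
  moreover have "1 / sqrt (2 * pi) * (2 *\<^sub>R ?I) = 2 powr (p / 2) * Gamma ((p + 1) / 2) / sqrt pi"
  proof -
    have "2 powr ((p - 1) / 2) = 2 powr (p / 2) / sqrt 2"
      by (simp add: diff_divide_distrib powr_diff powr_half_sqrt)
    moreover have "1 / (sqrt 2 * sqrt pi) * (2 * (c / sqrt 2 * d)) = c * d / sqrt pi" for c d :: real
    proof -
      have "1 / (sqrt 2 * sqrt pi) * (2 * (c / sqrt 2 * d)) = 2 * (c * d) / ((sqrt 2 * sqrt 2) * sqrt pi)"
        by (simp only: times_divide_eq_left times_divide_eq_right divide_divide_eq_left mult_1 mult.assoc mult.left_commute mult.commute)
      then show ?thesis by simp
    qed
    ultimately show ?thesis by (simp only: real_sqrt_mult real_scaleR_def)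
  qed
  ultimately have *: "has_bochner_integral lborel (\<lambda>y. std_normal_density y *\<^sub>R \<bar>y\<bar> powr p) (2 powr (p / 2) * Gamma ((p + 1) / 2) / sqrt pi)"
    by (simp add: std_normal_density_def mult.commute mult.left_commute)
  show ?thesis
    using * by (subst has_bochner_integral_density) auto
qed

section \<open>Empirical laws: weak convergence and moments\<close>

lemma abs_le_cosh: "\<bar>x\<bar> \<le> 2 * cosh (x :: real)"
proof -
  have "\<bar>x\<bar> \<le> exp \<bar>x\<bar>" using exp_ge_add_one_self[of "\<bar>x\<bar>"] by linarith
  also have "\<dots> \<le> exp x + exp (- x)" by (cases "x \<ge> 0") auto
  finally show ?thesis by (simp add: cosh_field_def)
qed

text \<open>Raise y \<le> exp y at y = \<bar>x\<bar> / q to the power q; this is the origin of the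
  factor q powr q.\<close>

lemma abs_powr_le_cosh:
  fixes x q :: real
  assumes "0 < q"
  shows "\<bar>x\<bar> powr q \<le> 2 * q powr q * cosh x"
proof -
  have "\<bar>x\<bar> / q \<le> exp (\<bar>x\<bar> / q)" using exp_ge_add_one_self[of "\<bar>x\<bar> / q"] by linarith
  then have "(\<bar>x\<bar> / q) powr q \<le> exp (\<bar>x\<bar> / q) powr q"
    using assms by (intro powr_mono2) auto
  then have "\<bar>x\<bar> powr q \<le> q powr q * exp \<bar>x\<bar>"
    using assms by (simp add: powr_divide exp_powr_real field_simps)
  also have "exp \<bar>x\<bar> \<le> 2 * cosh x" by (cases "x \<ge> 0") (auto simp: cosh_field_def)
  finally show ?thesis using assms by (simp add: mult.assoc mult.left_commute mult_left_mono)
qed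

lemma abs_cos_diff_le: "\<bar>cos a - cos b\<bar> \<le> \<bar>a - b :: real\<bar>"
proof -
  have "cos a - cos b = 2 * sin ((a + b) / 2) * sin ((b - a) / 2)" by (rule cos_diff_cos)
  then have "\<bar>cos a - cos b\<bar> = 2 * \<bar>sin ((a + b) / 2)\<bar> * \<bar>sin ((b - a) / 2)\<bar>"
    by (simp add: abs_mult)
  also have "\<dots> \<le> 2 * 1 * \<bar>(b - a) / 2\<bar>"
    by (intro mult_mono abs_sin_x_le_abs_x) auto
  finally show ?thesis by simp
qed

text \<open>For each n the points are \<open>x n k\<close> with k < \<open>m n\<close>. Rational
  frequencies suffice: the almost sure limit is available for countably many u at once, and the cosh
  bound supplies the others as well as uniform integrability.\<close>

locale empirical_normal =
  fixes m :: "nat \<Rightarrow> nat" and x :: "nat \<Rightarrow> nat \<Rightarrow> real" and C :: real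
  assumes m_pos: "\<And>n. m n > 0"
    and cos_rat: "\<And>u. u \<in> \<rat> \<Longrightarrow> (\<lambda>n. (\<Sum>k<m n. cos (u * x n k)) / m n) \<longlonglongrightarrow> exp (- u\<^sup>2 / 2)"
    and cosh_le: "\<And>n. (\<Sum>k<m n. cosh (x n k)) / m n \<le> C"
begin

lemma C_nonneg: "0 \<le> C"
  using cosh_le[of 0] by (rule order_trans[rotated]) (auto intro!: divide_nonneg_nonneg sum_nonneg)

lemma mean_mono:
  assumes "\<And>k. f k \<le> (g k :: real)"
  shows "(\<Sum>k<m n. f k) / m n \<le> (\<Sum>k<m n. g k) / m n"
  by (intro divide_right_mono sum_mono assms) auto

text \<open>The average of cosines is Lipschitz in u with the average of
  \<bar>\<open>x n k\<close>\<bar> as constant, and this is at most 2 * C uniformly in n.\<close>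

lemma cos_lim: "(\<lambda>n. (\<Sum>k<m n. cos (u * x n k)) / m n) \<longlonglongrightarrow> exp (- u\<^sup>2 / 2)"
proof (rule LIMSEQ_I)
  fix \<epsilon> :: real assume "0 < \<epsilon>"
  define \<delta> where "\<delta> = \<epsilon> / 3"
  have \<delta>: "\<delta> > 0" using \<open>0 < \<epsilon>\<close> by (simp add: \<delta>_def)
  have "isCont (\<lambda>u. exp (- u\<^sup>2 / 2) :: real) u" by (intro continuous_intros) auto
  then obtain \<eta> where \<eta>: "\<eta> > 0" "\<And>v. \<bar>v - u\<bar> < \<eta> \<Longrightarrow> \<bar>exp (- v\<^sup>2 / 2) - exp (- u\<^sup>2 / 2)\<bar> < \<delta>"
    using \<delta> unfolding continuous_at_eps_delta dist_real_def by metis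
  define r where "r = min \<eta> (\<delta> / (2 * C + 1))"
  have r: "r > 0" using \<eta> \<delta> C_nonneg by (simp add: r_def)
  then obtain v where v: "v \<in> \<rat>" "u < v" "v < u + r" using Rats_dense_in_real[of u "u + r"] by auto
  then have vu: "\<bar>v - u\<bar> < \<eta>" "\<bar>v - u\<bar> \<le> \<delta> / (2 * C + 1)" by (auto simp: r_def)
  have near: "\<bar>(\<Sum>k<m n. cos (u * x n k)) / m n - (\<Sum>k<m n. cos (v * x n k)) / m n\<bar> \<le> \<delta>" for n
  proof -
    have "\<bar>(\<Sum>k<m n. cos (u * x n k)) / m n - (\<Sum>k<m n. cos (v * x n k)) / m n\<bar>
        = \<bar>\<Sum>k<m n. cos (u * x n k) - cos (v * x n k)\<bar> / m n"
      by (simp add: sum_subtractf diff_divide_distrib[symmetric])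
    also have "\<dots> \<le> (\<Sum>k<m n. \<bar>cos (u * x n k) - cos (v * x n k)\<bar>) / m n"
      by (intro divide_right_mono sum_abs) auto
    also have "\<dots> \<le> (\<Sum>k<m n. \<bar>v - u\<bar> * (2 * cosh (x n k))) / m n"
    proof (rule mean_mono)
      fix k
      have "\<bar>cos (u * x n k) - cos (v * x n k)\<bar> \<le> \<bar>u * x n k - v * x n k\<bar>" by (rule abs_cos_diff_le)
      also have "\<dots> = \<bar>v - u\<bar> * \<bar>x n k\<bar>" by (simp add: left_diff_distrib[symmetric] abs_mult abs_minus_commute)
      also have "\<dots> \<le> \<bar>v - u\<bar> * (2 * cosh (x n k))" by (intro mult_left_mono abs_le_cosh) auto
      finally show "\<bar>cos (u * x n k) - cos (v * x n k)\<bar> \<le> \<bar>v - u\<bar> * (2 * cosh (x n k))" .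
    qed
    also have "\<dots> = \<bar>v - u\<bar> * (2 * ((\<Sum>k<m n. cosh (x n k)) / m n))"
      by (simp add: sum_distrib_left)
    also have "\<dots> \<le> \<delta> / (2 * C + 1) * (2 * C)"
      using vu C_nonneg \<delta> cosh_le[of n] by (intro mult_mono) (auto intro!: divide_nonneg_nonneg sum_nonneg)
    also have "\<dots> \<le> \<delta>" using C_nonneg \<delta> by (simp add: field_simps)
    finally show ?thesis .
  qed
  obtain n0 where n0: "\<And>n. n \<ge> n0 \<Longrightarrow> \<bar>(\<Sum>k<m n. cos (v * x n k)) / m n - exp (- v\<^sup>2 / 2)\<bar> < \<delta>"
    using LIMSEQ_D[OF cos_rat[OF v(1)] \<delta>] by auto
  have "\<bar>(\<Sum>k<m n. cos (u * x n k)) / m n - exp (- u\<^sup>2 / 2)\<bar> < \<epsilon>" if "n \<ge> n0" for n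
    using near[of n] n0[OF that] \<eta>(2)[OF vu(1)] unfolding \<delta>_def by linarith
  then show "\<exists>n0. \<forall>n\<ge>n0. norm ((\<Sum>k<m n. cos (u * x n k)) / m n - exp (- u\<^sup>2 / 2)) < \<epsilon>"
    by auto
qed

text \<open>Symmetrising the empirical measure makes its characteristic function the average of the
  cosines.\<close>

definition law :: "nat \<Rightarrow> real measure" where
  "law n = distr (measure_pmf (pmf_of_set ({..<m n} \<times> (UNIV :: bool set)))) borel
     (\<lambda>(k, s). if s then x n k else - x n k)"

lemma real_distribution_law: "real_distribution (law n)"
  unfolding law_def real_distribution_def real_distribution_axioms_def
  by (auto intro!: measure_pmf.prob_space_distr)

lemma integral_law:
  fixes f :: "real \<Rightarrow> 'b :: {banach, second_countable_topology}"
  assumes [measurable]: "f \<in> borel_measurable borel"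
  shows "integral\<^sup>L (law n) f = (\<Sum>k<m n. (1 / (2 * real (m n))) *\<^sub>R (f (x n k) + f (- x n k)))"
proof -
  let ?S = "{..<m n} \<times> (UNIV :: bool set)"
  have ne: "?S \<noteq> {}" "finite ?S" using m_pos[of n] by auto
  have "integral\<^sup>L (law n) f = (\<integral>z. f (case z of (k, s) \<Rightarrow> if s then x n k else - x n k) \<partial>measure_pmf (pmf_of_set ?S))"
    unfolding law_def by (rule integral_distr) auto
  also have "\<dots> = (\<Sum>z\<in>?S. pmf (pmf_of_set ?S) z *\<^sub>R f (case z of (k, s) \<Rightarrow> if s then x n k else - x n k))"
    using ne by (intro integral_measure_pmf) auto
  also have "\<dots> = (\<Sum>z\<in>?S. (1 / (2 * real (m n))) *\<^sub>R f (case z of (k, s) \<Rightarrow> if s then x n k else - x n k))"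
    using ne by (intro sum.cong refl) (simp add: card_cartesian_product mult.commute)
  also have "\<dots> = (\<Sum>k<m n. \<Sum>s\<in>UNIV. (1 / (2 * real (m n))) *\<^sub>R f (if s then x n k else - x n k))"
    by (subst sum.cartesian_product) (auto intro!: sum.cong)
  also have "\<dots> = (\<Sum>k<m n. (1 / (2 * real (m n))) *\<^sub>R (f (x n k) + f (- x n k)))"
    by (simp add: UNIV_bool scaleR_add_right add.commute)
  finally show ?thesis .
qed

lemma integral_law_even:
  fixes f :: "real \<Rightarrow> real"
  assumes "f \<in> borel_measurable borel" "\<And>y. f (- y) = f y"
  shows "integral\<^sup>L (law n) f = (\<Sum>k<m n. f (x n k)) / m n"
  unfolding integral_law[OF assms(1)] by (simp add: assms(2) sum_divide_distrib)

lemma char_law: "char (law n) u = complex_of_real ((\<Sum>k<m n. cos (u * x n k)) / m n)"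
proof -
  have "char (law n) u = (\<Sum>k<m n. (1 / (2 * real (m n))) *\<^sub>R (iexp (u * x n k) + iexp (u * (- x n k))))"
    unfolding char_def by (subst integral_law) auto
  also have "\<dots> = (\<Sum>k<m n. complex_of_real (cos (u * x n k) / m n))"
  proof (intro sum.cong refl)
    fix k
    have "iexp (u * x n k) + iexp (u * (- x n k)) = complex_of_real (2 * cos (u * x n k))"
      by (simp only: cis_conv_exp[symmetric]) (simp add: complex_eq_iff)
    then show "(1 / (2 * real (m n))) *\<^sub>R (iexp (u * x n k) + iexp (u * (- x n k))) = complex_of_real (cos (u * x n k) / m n)"
      by (simp add: scaleR_conv_of_real)
  qed
  finally show ?thesis by (simp add: sum_divide_distrib)
qed

lemma weak_conv_law: "weak_conv_m law std_normal_distribution"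
proof (rule levy_continuity)
  show "real_distribution std_normal_distribution"
    by (rule real_dist_normal_dist)
  show "(\<lambda>n. char (law n) u) \<longlonglongrightarrow> char std_normal_distribution u" for u
    unfolding char_law char_std_normal_distribution by (intro tendsto_of_real cos_lim)
qed (rule real_distribution_law)

text \<open>Weak convergence only handles bounded functions, so the power is truncated at R. What is
  cut off is at most \<bar>y\<bar> powr (2 * p) / R, small uniformly in n by the cosh bound.\<close>

lemma abs_moment_lim:
  assumes p: "0 < p"
  shows "(\<lambda>n. (\<Sum>k<m n. \<bar>x n k\<bar> powr p) / m n) \<longlonglongrightarrow> 2 powr (p / 2) * Gamma ((p + 1) / 2) / sqrt pi"
proof (rule LIMSEQ_I)
  fix \<epsilon> :: real assume \<epsilon>: "0 < \<epsilon>"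
  interpret N: real_distribution std_normal_distribution by (rule real_dist_normal_dist)
  let ?M = "\<lambda>f. integral\<^sup>L std_normal_distribution f"
  have int: "integrable std_normal_distribution (\<lambda>y. \<bar>y\<bar> powr q)" if "0 < q" for q
    using has_bochner_integral_abs_powr_std_normal[OF that] by (simp add: has_bochner_integral_iff)
  have val: "?M (\<lambda>y. \<bar>y\<bar> powr p) = 2 powr (p / 2) * Gamma ((p + 1) / 2) / sqrt pi"
    using has_bochner_integral_abs_powr_std_normal[OF p] by (simp add: has_bochner_integral_iff)
  \<comment> \<open>A common bound for the moments of order 2 * p of the normal law and, through
    \<open>abs_powr_le_cosh\<close>, of all empirical laws.\<close>
  define K where "K = max (?M (\<lambda>y. \<bar>y\<bar> powr (2 * p))) (2 * (2 * p) powr (2 * p) * C)"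
  define R where "R = 3 * (\<bar>K\<bar> + 1) / \<epsilon>"
  have R: "R > 0" using \<epsilon> by (simp add: R_def)
  have KR: "K / R < \<epsilon> / 3"
  proof -
    have "K * \<epsilon> < (\<bar>K\<bar> + 1) * \<epsilon>" using \<epsilon> by (intro mult_strict_right_mono) auto
    then show ?thesis using \<epsilon> by (simp add: R_def divide_simps mult.commute)
  qed
  define f where "f y = min (\<bar>y\<bar> powr p) R" for y :: real
  have trunc: "f y \<le> \<bar>y\<bar> powr p" "\<bar>y\<bar> powr p \<le> f y + \<bar>y\<bar> powr (2 * p) / R" for y
  proof -
    have "\<bar>y\<bar> powr (2 * p) = \<bar>y\<bar> powr p * \<bar>y\<bar> powr p" by (simp add: powr_add[symmetric])
    moreover have "\<bar>y\<bar> powr p \<le> \<bar>y\<bar> powr p * \<bar>y\<bar> powr p / R" if "\<bar>y\<bar> powr p \<ge> R"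
      using that R mult_left_mono[OF that, of "\<bar>y\<bar> powr p"] by (simp add: field_simps)
    ultimately show "\<bar>y\<bar> powr p \<le> f y + \<bar>y\<bar> powr (2 * p) / R"
      using R unfolding f_def by (cases "\<bar>y\<bar> powr p \<ge> R") (auto simp: min_def)
  qed (simp add: f_def)
  have f_cont: "continuous_on UNIV f"
    unfolding f_def using p by (intro continuous_intros continuous_on_powr') auto
  have [measurable]: "f \<in> borel_measurable borel" unfolding f_def by measurable
  have f_lim: "(\<lambda>n. (\<Sum>k<m n. f (x n k)) / m n) \<longlonglongrightarrow> ?M f"
  proof -
    have "(\<lambda>n. integral\<^sup>L (law n) f) \<longlonglongrightarrow> ?M f"
    proof (rule weak_conv_imp_integral_bdd_continuous_conv)
      show "isCont f y" for y using f_cont by (simp add: continuous_on_eq_continuous_at)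
      show "norm (f y) \<le> R" for y using R by (simp add: f_def)
    qed (auto intro: real_distribution_law real_dist_normal_dist weak_conv_law)
    then show ?thesis
      by (subst (asm) integral_law_even) (auto simp: f_def)
  qed
  then obtain n0 where n0: "\<And>n. n \<ge> n0 \<Longrightarrow> \<bar>(\<Sum>k<m n. f (x n k)) / m n - ?M f\<bar> < \<epsilon> / 3"
    using LIMSEQ_D[OF f_lim, of "\<epsilon> / 3"] \<epsilon> by auto
  have f_int: "integrable std_normal_distribution f"
    by (rule N.integrable_const_bound[where B = R]) (use R in \<open>auto simp: f_def\<close>)
  have "?M f \<le> ?M (\<lambda>y. \<bar>y\<bar> powr p)"
    by (intro integral_mono f_int int p trunc)
  moreover have "?M (\<lambda>y. \<bar>y\<bar> powr p) \<le> ?M (\<lambda>y. f y + \<bar>y\<bar> powr (2 * p) / R)"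
    using p by (intro integral_mono f_int int trunc Bochner_Integration.integrable_add integrable_divide) auto
  moreover have "?M (\<lambda>y. f y + \<bar>y\<bar> powr (2 * p) / R) = ?M f + ?M (\<lambda>y. \<bar>y\<bar> powr (2 * p)) / R"
    using p by (subst Bochner_Integration.integral_add) (auto intro!: f_int int)
  moreover have "?M (\<lambda>y. \<bar>y\<bar> powr (2 * p)) / R \<le> K / R"
    using R by (intro divide_right_mono) (auto simp: K_def)
  ultimately have M: "?M f \<le> ?M (\<lambda>y. \<bar>y\<bar> powr p)" "?M (\<lambda>y. \<bar>y\<bar> powr p) \<le> ?M f + K / R" by linarith+
  have S: "(\<Sum>k<m n. f (x n k)) / m n \<le> (\<Sum>k<m n. \<bar>x n k\<bar> powr p) / m n"
    "(\<Sum>k<m n. \<bar>x n k\<bar> powr p) / m n \<le> (\<Sum>k<m n. f (x n k)) / m n + K / R" for n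
  proof -
    show "(\<Sum>k<m n. f (x n k)) / m n \<le> (\<Sum>k<m n. \<bar>x n k\<bar> powr p) / m n"
      by (intro mean_mono trunc)
    have "(\<Sum>k<m n. \<bar>x n k\<bar> powr p) / m n \<le> (\<Sum>k<m n. f (x n k) + (2 * (2 * p) powr (2 * p) / R) * cosh (x n k)) / m n"
    proof (rule mean_mono)
      fix k
      have "\<bar>x n k\<bar> powr (2 * p) / R \<le> 2 * (2 * p) powr (2 * p) * cosh (x n k) / R"
        using R p by (intro divide_right_mono abs_powr_le_cosh) auto
      then show "\<bar>x n k\<bar> powr p \<le> f (x n k) + (2 * (2 * p) powr (2 * p) / R) * cosh (x n k)"
        using trunc(2)[of "x n k"] by simp
    qed
    also have "\<dots> = (\<Sum>k<m n. f (x n k)) / m n + 2 * (2 * p) powr (2 * p) * ((\<Sum>k<m n. cosh (x n k)) / m n) / R"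
      by (simp only: sum.distrib sum_distrib_left[symmetric] add_divide_distrib) simp
    also have "2 * (2 * p) powr (2 * p) * ((\<Sum>k<m n. cosh (x n k)) / m n) / R \<le> 2 * (2 * p) powr (2 * p) * C / R"
      using R by (intro divide_right_mono mult_left_mono cosh_le) auto
    also have "2 * (2 * p) powr (2 * p) * C / R \<le> K / R"
      using R by (intro divide_right_mono) (auto simp: K_def)
    finally show "(\<Sum>k<m n. \<bar>x n k\<bar> powr p) / m n \<le> (\<Sum>k<m n. f (x n k)) / m n + K / R" by simp
  qed
  have "\<bar>(\<Sum>k<m n. \<bar>x n k\<bar> powr p) / m n - ?M (\<lambda>y. \<bar>y\<bar> powr p)\<bar> < \<epsilon>" if "n \<ge> n0" for n
    using S[of n] M n0[OF that] KR by linarith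
  then show "\<exists>n0. \<forall>n\<ge>n0. norm ((\<Sum>k<m n. \<bar>x n k\<bar> powr p) / m n - 2 powr (p / 2) * Gamma ((p + 1) / 2) / sqrt pi) < \<epsilon>"
    unfolding val by auto
qed

end

section \<open>Asymptotics of the gauge function\<close>

text \<open>Write y for the argument of \<Phi> and - ln y = n q with q = L - ln n / (2n) - ln
  \<bar>x\<bar> / n. The powers of n in y powr (1/H) and in the logarithmic factor cancel and leave
  \<bar>x\<bar> powr (1/H) * q powr (-1/(2H)). For 1/n \<le> \<bar>x\<bar> \<le> C n the number q is
  close to L. Below 1/n it may be large, but then both expressions are small; the summand 1 in the
  error pays for that.\<close>

lemma Phi_asymptotics:
  fixes \<Phi> :: "real \<Rightarrow> real" and H z C :: real
  assumes H: "0 < H" and z: "1 < z" and C: "0 < C" and \<epsilon>: "0 < \<epsilon>" and \<Phi>0: "\<Phi> 0 = 0"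
    and \<Phi>: "\<forall>x. 0 < x \<and> x < 1 / exp 1 \<longrightarrow> \<Phi> x = x powr (1 / H) * (- ln x) powr (- (1 / (2 * H)))"
  shows "\<forall>\<^sub>F n in sequentially. \<forall>x. \<bar>x\<bar> \<le> C * real n \<longrightarrow>
    \<bar>z ^ n * \<Phi> (z powr (- (real n * H)) * sqrt (real n) * \<bar>x\<bar>)
       - (H * ln z) powr (- (1 / (2 * H))) * \<bar>x\<bar> powr (1 / H)\<bar> \<le> \<epsilon> * (1 + \<bar>x\<bar> powr (1 / H))"
proof -
  define r where "r = 1 / (2 * H)"
  define L where "L = H * ln z"
  have r: "r > 0" "1 / H = 2 * r" using H by (simp_all add: r_def)
  have L: "L > 0" using H z by (simp add: L_def)
  have "isCont (\<lambda>q. q powr (- r)) L" using L by (intro continuous_intros) auto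
  then obtain \<delta>0 where \<delta>0: "\<delta>0 > 0" "\<And>q. \<bar>q - L\<bar> < \<delta>0 \<Longrightarrow> \<bar>q powr (- r) - L powr (- r)\<bar> < \<epsilon>"
    using \<epsilon> unfolding continuous_at_eps_delta dist_real_def by metis
  \<comment> \<open>The cap L / 2 keeps q above L / 2 for all admissible x, however small.\<close>
  define \<delta> where "\<delta> = min \<delta>0 (L / 2)"
  have \<delta>: "\<delta> > 0" using \<delta>0 L by (simp add: \<delta>_def)
  have lim_ln: "(\<lambda>n. ln (real n) / real n) \<longlonglongrightarrow> 0" by (rule lim_ln_over_n)
  have "(\<lambda>n. 3 / 2 * (ln (real n) / real n) + \<bar>ln C\<bar> * (1 / real n)) \<longlonglongrightarrow> 3 / 2 * 0 + \<bar>ln C\<bar> * 0"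
    by (intro tendsto_intros lim_ln lim_1_over_n)
  then have "\<forall>\<^sub>F n in sequentially. 3 / 2 * (ln (real n) / real n) + \<bar>ln C\<bar> * (1 / real n) < \<delta>"
    using \<delta> by (intro order_tendstoD(2)) auto
  moreover have "(\<lambda>n. (1 / real n) powr (2 * r) * (L / 2) powr (- r)) \<longlonglongrightarrow> 0 powr (2 * r) * (L / 2) powr (- r)"
    using r by (intro tendsto_intros tendsto_powr' lim_1_over_n) auto
  then have "\<forall>\<^sub>F n in sequentially. (1 / real n) powr (2 * r) * (L / 2) powr (- r) < \<epsilon>"
    using \<epsilon> by (intro order_tendstoD(2)) auto
  moreover have "\<forall>\<^sub>F n in sequentially. 2 / L < real n"
    using filterlim_real_sequentially by (simp add: filterlim_at_top_dense)
  ultimately show ?thesis using eventually_gt_at_top[of 0]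
  proof eventually_elim
    case (elim n)
    have n: "real n > 0" "1 \<le> real n" using elim by auto
    show ?case
    proof (intro allI impI)
      fix x :: real assume x: "\<bar>x\<bar> \<le> C * real n"
      show "\<bar>z ^ n * \<Phi> (z powr (- (real n * H)) * sqrt (real n) * \<bar>x\<bar>)
          - (H * ln z) powr (- (1 / (2 * H))) * \<bar>x\<bar> powr (1 / H)\<bar> \<le> \<epsilon> * (1 + \<bar>x\<bar> powr (1 / H))"
      proof (cases "x = 0")
        case True
        then show ?thesis using \<Phi>0 \<epsilon> by simp
      next
        case False
        then have x0: "\<bar>x\<bar> > 0" by simp
        define y where "y = z powr (- (real n * H)) * sqrt (real n) * \<bar>x\<bar>"
        define q where "q = L - ln (real n) / (2 * real n) - ln \<bar>x\<bar> / real n"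
        have y: "y > 0" using z n x0 by (simp add: y_def)
        have lny: "- ln y = real n * q"
          using z n x0 by (simp add: y_def q_def ln_mult ln_powr ln_sqrt L_def field_simps)
        have "ln \<bar>x\<bar> \<le> ln (C * real n)" using x x0 C n by (subst ln_le_cancel_iff) auto
        also have "\<dots> \<le> \<bar>ln C\<bar> + ln (real n)" using C n by (simp add: ln_mult)
        finally have "ln \<bar>x\<bar> / real n \<le> (\<bar>ln C\<bar> + ln (real n)) / real n"
          using n by (intro divide_right_mono) auto
        then have q_ge: "q > L - \<delta>" using elim(1) unfolding q_def by (simp add: add_divide_distrib)
        then have q_half: "q > L / 2" unfolding \<delta>_def by linarith
        \<comment> \<open>Thus - ln y > 1, that is y < 1/e, where the explicit formula for \<Phi> is
          valid.\<close>
        have "1 < real n * (L / 2)" using elim(3) L by (simp add: field_simps)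
        also have "\<dots> < real n * q" using q_half n by simp
        finally have "ln y < -1" using lny by linarith
        then have "y < exp (-1)" using y by (metis exp_less_mono exp_ln)
        then have "\<Phi> y = y powr (2 * r) * (real n * q) powr (- r)"
          using y \<Phi>[rule_format, of y] by (simp add: lny r exp_minus inverse_eq_divide flip: r_def)
        also have "y powr (2 * r) = (1 / z ^ n) * real n powr r * \<bar>x\<bar> powr (2 * r)"
        proof -
          have "(z powr (- (real n * H))) powr (2 * r) = z powr (- real n)"
            using H by (simp add: powr_powr r_def)
          moreover have "sqrt (real n) powr (2 * r) = real n powr r"
            using n by (simp add: powr_half_sqrt[symmetric] powr_powr)
          moreover have "z powr (- real n) = 1 / z ^ n"
            using z by (simp add: powr_minus_divide powr_realpow)
          ultimately show ?thesis
            unfolding y_def powr_mult by (simp only:)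
        qed
        also have "(real n * q) powr (- r) = real n powr (- r) * q powr (- r)"
          by (rule powr_mult)
        also have "1 / z ^ n * real n powr r * \<bar>x\<bar> powr (2 * r) * (real n powr (- r) * q powr (- r))
            = (1 / z ^ n) * (real n powr r * real n powr (- r)) * \<bar>x\<bar> powr (2 * r) * q powr (- r)" by simp
        also have "real n powr r * real n powr (- r) = 1" using n by (simp add: powr_add[symmetric])
        finally have Phi_y: "z ^ n * \<Phi> y = \<bar>x\<bar> powr (2 * r) * q powr (- r)" using z by simp
        have "\<bar>z ^ n * \<Phi> y - L powr (- r) * \<bar>x\<bar> powr (2 * r)\<bar> = \<bar>x\<bar> powr (2 * r) * \<bar>q powr (- r) - L powr (- r)\<bar>"
        proof -
          have "z ^ n * \<Phi> y - L powr (- r) * \<bar>x\<bar> powr (2 * r) = \<bar>x\<bar> powr (2 * r) * (q powr (- r) - L powr (- r))"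
            unfolding Phi_y by (simp add: right_diff_distrib)
          then show ?thesis by (simp add: abs_mult)
        qed
        also have "\<dots> \<le> \<epsilon> * (1 + \<bar>x\<bar> powr (2 * r))"
        proof (cases "\<bar>x\<bar> \<ge> 1 / real n")
          case True
          have "ln (1 / real n) \<le> ln \<bar>x\<bar>" using True n x0 by (subst ln_le_cancel_iff) auto
          then have "- ln (real n) / real n \<le> ln \<bar>x\<bar> / real n"
            using n by (intro divide_right_mono) (auto simp: ln_div)
          moreover have "0 \<le> ln (real n) / real n" "0 \<le> \<bar>ln C\<bar> * (1 / real n)" using n by auto
          moreover have "ln (real n) / (2 * real n) = 1 / 2 * (ln (real n) / real n)" by simp
          moreover have "- ln (real n) / real n = - (ln (real n) / real n)" by simp
          ultimately have "q < L + \<delta>" using elim(1) unfolding q_def by linarith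
          then have "\<bar>q powr (- r) - L powr (- r)\<bar> < \<epsilon>"
            using q_ge by (intro \<delta>0(2)) (auto simp: \<delta>_def)
          then have "\<bar>x\<bar> powr (2 * r) * \<bar>q powr (- r) - L powr (- r)\<bar> \<le> \<bar>x\<bar> powr (2 * r) * \<epsilon>"
            by (intro mult_left_mono) auto
          then show ?thesis using \<epsilon> by (simp add: algebra_simps)
        next
          case False
          \<comment> \<open>No upper bound on q is needed here: the negative power of q is bounded,
            and the small factor is the power of \<bar>x\<bar>.\<close>
          have "q powr (- r) \<le> (L / 2) powr (- r)" "L powr (- r) \<le> (L / 2) powr (- r)"
            using q_half L r by (auto intro!: powr_mono2')
          then have "\<bar>q powr (- r) - L powr (- r)\<bar> \<le> (L / 2) powr (- r)"
            using powr_ge_zero[of q "- r"] powr_ge_zero[of L "- r"] by linarith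
          moreover have "\<bar>x\<bar> powr (2 * r) \<le> (1 / real n) powr (2 * r)"
            using False r by (intro powr_mono2) auto
          ultimately have "\<bar>x\<bar> powr (2 * r) * \<bar>q powr (- r) - L powr (- r)\<bar> \<le> (1 / real n) powr (2 * r) * (L / 2) powr (- r)"
            by (intro mult_mono) auto
          also have "\<dots> \<le> \<epsilon> * 1" using elim(2) by simp
          also have "\<dots> \<le> \<epsilon> * (1 + \<bar>x\<bar> powr (2 * r))" using \<epsilon> by (intro mult_left_mono) auto
          finally show ?thesis .
        qed
        finally show ?thesis unfolding y_def L_def r(2) r_def by simp
      qed
    qed
  qed
qed

section \<open>Centred Gaussian processes\<close>

lemma has_bochner_integral_std_normal_exp:
  "has_bochner_integral lborel (\<lambda>x. std_normal_density x * exp (s * x)) (exp (s\<^sup>2 / 2))"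
proof -
  have "std_normal_density x * exp (s * x) = exp (s\<^sup>2 / 2) * normal_density s 1 x" for x
  proof -
    have "- x\<^sup>2 / 2 + s * x = s\<^sup>2 / 2 + (- (x - s)\<^sup>2 / 2)" by (simp add: power2_eq_square field_simps)
    then have "exp (- x\<^sup>2 / 2) * exp (s * x) = exp (s\<^sup>2 / 2) * exp (- (x - s)\<^sup>2 / 2)"
      by (simp only: exp_add[symmetric])
    then show ?thesis by (simp add: normal_density_def)
  qed
  moreover have "has_bochner_integral lborel (normal_density s 1) 1"
    using integral_normal_density[of 1 s] integrable_normal_density[of 1 s] by (simp add: has_bochner_integral_iff)
  then have "has_bochner_integral lborel (\<lambda>x. exp (s\<^sup>2 / 2) * normal_density s 1 x) (exp (s\<^sup>2 / 2) * 1)"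
    by (rule has_bochner_integral_mult_right)
  ultimately show ?thesis by simp
qed

lemma has_bochner_integral_std_normal_cos:
  "has_bochner_integral lborel (\<lambda>x. std_normal_density x * cos (s * x)) (exp (- s\<^sup>2 / 2))"
proof -
  interpret N: real_distribution std_normal_distribution by (rule real_dist_normal_dist)
  have int: "integrable std_normal_distribution (\<lambda>x. iexp (s * x))" by (rule N.integrable_iexp) auto
  have Re_iexp: "Re (iexp y) = cos y" for y :: real by (simp add: Re_exp)
  have "(\<integral>x. cos (s * x) \<partial>std_normal_distribution) = (\<integral>x. Re (iexp (s * x)) \<partial>std_normal_distribution)"
    by (simp only: Re_iexp)
  also have "\<dots> = Re (char std_normal_distribution s)"
    unfolding char_def by (rule integral_Re[OF int])
  also have "\<dots> = exp (- s\<^sup>2 / 2)"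
    by (simp only: char_std_normal_distribution Re_complex_of_real)
  finally have *: "(\<integral>x. cos (s * x) \<partial>std_normal_distribution) = exp (- s\<^sup>2 / 2)" .
  have "integrable std_normal_distribution (\<lambda>x. cos (s * x))"
    by (rule N.integrable_const_bound[where B = 1]) auto
  with * show ?thesis
    by (auto simp: has_bochner_integral_iff integrable_density integral_density)
qed

context prob_space
begin

text \<open>A nondegenerate X is scaled to a standard normal variable, and its mean forces \<mu> =
  0. In the degenerate case X is almost surely 0, and the formulas read 1 = 1.\<close>

lemma centered_gaussian:
  assumes G: "gaussian_rv M X" and E0: "expectation X = 0"
  shows "integrable M X" and "integrable M (\<lambda>\<omega>. (X \<omega>)\<^sup>2)"
    and "expectation (\<lambda>\<omega>. cos (X \<omega>)) = exp (- expectation (\<lambda>\<omega>. (X \<omega>)\<^sup>2) / 2)"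
    and "integrable M (\<lambda>\<omega>. cosh (X \<omega>))"
    and "expectation (\<lambda>\<omega>. cosh (X \<omega>)) = exp (expectation (\<lambda>\<omega>. (X \<omega>)\<^sup>2) / 2)"
proof -
  have [measurable]: "X \<in> borel_measurable M" using G by (simp add: gaussian_rv_def)
  have "integrable M X \<and> integrable M (\<lambda>\<omega>. (X \<omega>)\<^sup>2)
    \<and> expectation (\<lambda>\<omega>. cos (X \<omega>)) = exp (- expectation (\<lambda>\<omega>. (X \<omega>)\<^sup>2) / 2)
    \<and> integrable M (\<lambda>\<omega>. cosh (X \<omega>))
    \<and> expectation (\<lambda>\<omega>. cosh (X \<omega>)) = exp (expectation (\<lambda>\<omega>. (X \<omega>)\<^sup>2) / 2)"
    using G unfolding gaussian_rv_def
  proof (elim conjE disjE exE)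
    fix \<mu> \<sigma> :: real assume \<sigma>: "0 < \<sigma>" and D: "distributed M lborel X (\<lambda>x. ennreal (normal_density \<mu> \<sigma> x))"
    have "\<mu> = 0" using normal_distributed_expectation[OF \<sigma> D] E0 by simp
    define Z where "Z \<omega> = X \<omega> / \<sigma>" for \<omega>
    have X: "X \<omega> = \<sigma> * Z \<omega>" for \<omega> using \<sigma> by (simp add: Z_def)
    have DZ: "distributed M lborel Z (\<lambda>x. ennreal (std_normal_density x))"
      using D normal_standard_normal_convert[OF \<sigma>, of X \<mu>] unfolding \<open>\<mu> = 0\<close> Z_def by simp
    have T: "integrable M (\<lambda>\<omega>. g (Z \<omega>)) \<and> expectation (\<lambda>\<omega>. g (Z \<omega>)) = v"
      if "has_bochner_integral lborel (\<lambda>x. std_normal_density x * g x) v" "g \<in> borel_measurable borel" for g v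
      using that distributed_integrable[OF DZ, of g] distributed_integral[OF DZ, of g]
      by (auto simp: has_bochner_integral_iff)
    have "has_bochner_integral lborel (\<lambda>x. std_normal_density x * (\<sigma> * x)) (\<sigma> * 0)"
      using has_bochner_integral_mult_right[OF std_normal_moment_odd[of 0], of \<sigma>] by (simp add: mult_ac)
    from T[OF this] have 1: "integrable M X" by (simp add: X[abs_def])
    have "has_bochner_integral lborel (\<lambda>x. std_normal_density x * (\<sigma> * x)\<^sup>2) (\<sigma>\<^sup>2 * 1)"
      using has_bochner_integral_mult_right[OF std_normal_moment_even[of 1], of "\<sigma>\<^sup>2"]
      by (simp add: mult_ac power_mult_distrib)
    from T[OF this] have 2: "integrable M (\<lambda>\<omega>. (X \<omega>)\<^sup>2)" "expectation (\<lambda>\<omega>. (X \<omega>)\<^sup>2) = \<sigma>\<^sup>2"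
      by (simp_all add: X)
    from T[OF has_bochner_integral_std_normal_cos[of \<sigma>]]
    have 3: "expectation (\<lambda>\<omega>. cos (X \<omega>)) = exp (- \<sigma>\<^sup>2 / 2)" by (simp add: X)
    have "has_bochner_integral lborel (\<lambda>x. 1 / 2 * (std_normal_density x * exp (\<sigma> * x) + std_normal_density x * exp (- \<sigma> * x)))
       (1 / 2 * (exp (\<sigma>\<^sup>2 / 2) + exp ((- \<sigma>)\<^sup>2 / 2)))"
      by (intro has_bochner_integral_mult_right has_bochner_integral_add has_bochner_integral_std_normal_exp)
    then have "has_bochner_integral lborel (\<lambda>x. std_normal_density x * cosh (\<sigma> * x)) (exp (\<sigma>\<^sup>2 / 2))"
      by (simp add: cosh_field_def algebra_simps add_divide_distrib)
    from T[OF this] have 4: "integrable M (\<lambda>\<omega>. cosh (X \<omega>))" "expectation (\<lambda>\<omega>. cosh (X \<omega>)) = exp (\<sigma>\<^sup>2 / 2)"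
      by (simp_all add: X borel_measurable_continuous_onI continuous_intros)
    show ?thesis using 1 2 3 4 by simp
  next
    fix \<mu> assume ae: "AE \<omega> in M. X \<omega> = \<mu>"
    have T: "integrable M (\<lambda>\<omega>. g (X \<omega>)) \<and> expectation (\<lambda>\<omega>. g (X \<omega>)) = g \<mu>"
      if [measurable]: "g \<in> borel_measurable borel" for g :: "real \<Rightarrow> real"
    proof -
      have ae': "AE \<omega> in M. g (X \<omega>) = g \<mu>" using ae by eventually_elim simp
      have "integrable M (\<lambda>\<omega>. g (X \<omega>)) \<longleftrightarrow> integrable M (\<lambda>_. g \<mu>)"
        by (rule integrable_cong_AE) (use ae' in auto)
      moreover have "expectation (\<lambda>\<omega>. g (X \<omega>)) = expectation (\<lambda>_. g \<mu>)"
        by (rule integral_cong_AE) (use ae' in auto)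
      ultimately show ?thesis by (simp add: prob_space)
    qed
    have "\<mu> = 0" using T[of "\<lambda>x. x"] E0 by simp
    then show ?thesis
      using T[of "\<lambda>x. x"] T[of "\<lambda>x. x\<^sup>2"] T[of cos] T[of cosh]
      by (simp add: borel_measurable_continuous_onI continuous_intros)
  qed
  then show "integrable M X" and "integrable M (\<lambda>\<omega>. (X \<omega>)\<^sup>2)"
    and "expectation (\<lambda>\<omega>. cos (X \<omega>)) = exp (- expectation (\<lambda>\<omega>. (X \<omega>)\<^sup>2) / 2)"
    and "integrable M (\<lambda>\<omega>. cosh (X \<omega>))"
    and "expectation (\<lambda>\<omega>. cosh (X \<omega>)) = exp (expectation (\<lambda>\<omega>. (X \<omega>)\<^sup>2) / 2)"
    by auto
qed

text \<open>The sum of the squares has finite expectation, hence is finite almost surely, and its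
  terms tend to 0.\<close>

lemma AE_tendsto_zero_of_square_summable:
  fixes Z :: "nat \<Rightarrow> 'a \<Rightarrow> real"
  assumes int: "\<And>n. integrable M (\<lambda>\<omega>. (Z n \<omega>)\<^sup>2)" and meas: "\<And>n. Z n \<in> borel_measurable M"
    and summ: "summable (\<lambda>n. expectation (\<lambda>\<omega>. (Z n \<omega>)\<^sup>2))"
  shows "AE \<omega> in M. (\<lambda>n. Z n \<omega>) \<longlonglongrightarrow> 0"
proof -
  note [measurable] = meas
  have "(\<integral>\<^sup>+\<omega>. (\<Sum>n. ennreal ((Z n \<omega>)\<^sup>2)) \<partial>M) = (\<Sum>n. \<integral>\<^sup>+\<omega>. ennreal ((Z n \<omega>)\<^sup>2) \<partial>M)"
    by (rule nn_integral_suminf) measurable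
  also have "\<dots> = (\<Sum>n. ennreal (expectation (\<lambda>\<omega>. (Z n \<omega>)\<^sup>2)))"
    by (intro suminf_cong nn_integral_eq_integral int) auto
  also have "\<dots> = ennreal (\<Sum>n. expectation (\<lambda>\<omega>. (Z n \<omega>)\<^sup>2))"
    by (rule suminf_ennreal2) (auto intro: summ)
  finally have "(\<integral>\<^sup>+\<omega>. (\<Sum>n. ennreal ((Z n \<omega>)\<^sup>2)) \<partial>M) \<noteq> \<infinity>" by simp
  then have "AE \<omega> in M. (\<Sum>n. ennreal ((Z n \<omega>)\<^sup>2)) \<noteq> \<infinity>"
    by (intro nn_integral_PInf_AE) measurable
  then show ?thesis
  proof eventually_elim
    case (elim \<omega>)
    then have "summable (\<lambda>n. (Z n \<omega>)\<^sup>2)" by (intro summable_suminf_not_top) auto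
    then have "(\<lambda>n. (Z n \<omega>)\<^sup>2) \<longlonglongrightarrow> 0" by (rule summable_LIMSEQ_zero)
    then show ?case by simp
  qed
qed

end

text \<open>By the double angle formula the left side is 2 * (sinh (c / 2))^2, and \<bar>sinh
  y\<bar> \<le> \<bar>y\<bar> * cosh y. This is what makes the variance estimate quadratic in the
  covariances.\<close>

lemma cosh_minus_one_le:
  fixes c A :: real
  assumes "\<bar>c\<bar> \<le> A"
  shows "cosh c - 1 \<le> (cosh A)\<^sup>2 * c\<^sup>2"
proof -
  have sinh_le: "sinh y \<le> y * cosh y" if "0 < y" for y :: real
  proof -
    have "\<exists>z>0. z < y \<and> sinh y - sinh 0 = (y - 0) * cosh z"
      by (rule MVT2) (use that in \<open>auto intro!: derivative_eq_intros\<close>)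
    then obtain z where "0 < z" "z < y" "sinh y = y * cosh z" by auto
    then show ?thesis using that by (simp add: cosh_real_nonneg_le_iff)
  qed
  have abs_sinh_le: "\<bar>sinh y\<bar> \<le> \<bar>y\<bar> * cosh y" for y :: real
    using sinh_le[of y] sinh_le[of "- y"] by (cases "y > 0"; cases "y = 0") auto
  have "cosh c - 1 = 2 * (sinh (c / 2))\<^sup>2"
    using cosh_double_cosh[of "c / 2"] by (simp add: cosh_square_eq)
  also have "\<dots> \<le> 2 * (\<bar>c / 2\<bar> * cosh (c / 2))\<^sup>2"
    using abs_sinh_le[of "c / 2"] by (intro mult_left_mono abs_le_square_iff[THEN iffD1]) auto
  also have "\<dots> \<le> 2 * (\<bar>c / 2\<bar> * cosh A)\<^sup>2"
  proof (intro mult_left_mono power_mono)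
    have "cosh \<bar>c / 2\<bar> \<le> cosh A" using assms by (subst cosh_real_nonneg_le_iff) auto
    moreover have "cosh \<bar>c / 2\<bar> = cosh (c / 2)" unfolding abs_if by simp
    ultimately show "cosh (c / 2) \<le> cosh A" by (simp only:)
  qed auto
  also have "\<dots> = (1 / 2) * ((cosh A)\<^sup>2 * c\<^sup>2)" by (simp add: power_mult_distrib power_divide)
  also have "\<dots> \<le> (cosh A)\<^sup>2 * c\<^sup>2" by simp
  finally show ?thesis .
qed

section \<open>Exact variances on the linear span of a Gaussian process\<close>

locale centered_gaussian_process = prob_space M for M :: "'a measure" +
  fixes W :: "real \<Rightarrow> 'a \<Rightarrow> real"
  assumes gaussian: "gaussian_process M {0..1} W"
    and centered: "\<And>t. t \<in> {0..1} \<Longrightarrow> expectation (W t) = 0"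
begin

text \<open>Gaussian variables are not closed under addition; this class is, and the process makes
  all its members Gaussian. Sums and differences are needed for the product-to-sum formula.\<close>

definition lincomb :: "('a \<Rightarrow> real) \<Rightarrow> bool" where
  "lincomb X \<longleftrightarrow> (\<exists>I c. finite I \<and> I \<subseteq> {0..1} \<and> X = (\<lambda>\<omega>. \<Sum>t\<in>I. c t * W t \<omega>))"

lemma lincomb_W: "t \<in> {0..1} \<Longrightarrow> lincomb (W t)"
  unfolding lincomb_def by (intro exI[of _ "{t}"] exI[of _ "\<lambda>_. 1"]) auto

lemma lincomb_zero: "lincomb (\<lambda>_. 0)"
  unfolding lincomb_def by (intro exI[of _ "{}"]) auto

lemma lincomb_scale:
  assumes "lincomb X" shows "lincomb (\<lambda>\<omega>. a * X \<omega>)"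
proof -
  obtain I c where "finite I" "I \<subseteq> {0..1}" "X = (\<lambda>\<omega>. \<Sum>t\<in>I. c t * W t \<omega>)"
    using assms unfolding lincomb_def by blast
  then show ?thesis unfolding lincomb_def
    by (intro exI[of _ I] exI[of _ "\<lambda>t. a * c t"]) (auto simp: sum_distrib_left mult.assoc)
qed

lemma lincomb_add:
  assumes "lincomb X" "lincomb Y" shows "lincomb (\<lambda>\<omega>. X \<omega> + Y \<omega>)"
proof -
  obtain I c where I: "finite I" "I \<subseteq> {0..1}" "X = (\<lambda>\<omega>. \<Sum>t\<in>I. c t * W t \<omega>)"
    using assms(1) unfolding lincomb_def by blast
  obtain J d where J: "finite J" "J \<subseteq> {0..1}" "Y = (\<lambda>\<omega>. \<Sum>t\<in>J. d t * W t \<omega>)"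
    using assms(2) unfolding lincomb_def by blast
  let ?e = "\<lambda>t. (if t \<in> I then c t else 0) + (if t \<in> J then d t else 0)"
  have X: "(\<Sum>t\<in>I. c t * W t \<omega>) = (\<Sum>t\<in>I \<union> J. (if t \<in> I then c t else 0) * W t \<omega>)" for \<omega>
    using I J by (intro sum.mono_neutral_cong_left) auto
  have Y: "(\<Sum>t\<in>J. d t * W t \<omega>) = (\<Sum>t\<in>I \<union> J. (if t \<in> J then d t else 0) * W t \<omega>)" for \<omega>
    using I J by (intro sum.mono_neutral_cong_left) auto
  show ?thesis unfolding lincomb_def
    by (intro exI[of _ "I \<union> J"] exI[of _ ?e])
      (use I(1,2) J(1,2) in \<open>auto simp: I(3) J(3) X Y sum.distrib distrib_right\<close>)
qed

lemma lincomb_diff: "lincomb X \<Longrightarrow> lincomb Y \<Longrightarrow> lincomb (\<lambda>\<omega>. X \<omega> - Y \<omega>)"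
  using lincomb_add[OF _ lincomb_scale[of Y "-1"]] by simp

lemma lincomb_sum:
  assumes "finite A" "\<And>i. i \<in> A \<Longrightarrow> lincomb (X i)"
  shows "lincomb (\<lambda>\<omega>. \<Sum>i\<in>A. X i \<omega>)"
  using assms by (induction A rule: finite_induct) (auto intro: lincomb_zero lincomb_add)

lemma lincomb_gaussian: "lincomb X \<Longrightarrow> gaussian_rv M X"
  using gaussian unfolding gaussian_process_def lincomb_def by auto

lemma lincomb_measurable: "lincomb X \<Longrightarrow> X \<in> borel_measurable M"
  using lincomb_gaussian unfolding gaussian_rv_def by blast

lemma lincomb_expectation:
  assumes "lincomb X" shows "expectation X = 0"
proof -
  obtain I c where I: "finite I" "I \<subseteq> {0..1}" "X = (\<lambda>\<omega>. \<Sum>t\<in>I. c t * W t \<omega>)"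
    using assms unfolding lincomb_def by blast
  have int: "integrable M (W t)" if "t \<in> I" for t
    using that I centered by (intro centered_gaussian lincomb_gaussian lincomb_W) auto
  have "expectation X = (\<Sum>t\<in>I. expectation (\<lambda>\<omega>. c t * W t \<omega>))"
    unfolding I by (rule Bochner_Integration.integral_sum) (auto intro: int)
  also have "\<dots> = 0" using I centered by (intro sum.neutral) auto
  finally show ?thesis .
qed

lemmas lincomb_centered = centered_gaussian[OF lincomb_gaussian lincomb_expectation]

lemma lincomb_mult_integrable:
  assumes "lincomb X" "lincomb Y"
  shows "integrable M (\<lambda>\<omega>. X \<omega> * Y \<omega>)"
proof (rule Bochner_Integration.integrable_bound)
  show "integrable M (\<lambda>\<omega>. (X \<omega>)\<^sup>2 + (Y \<omega>)\<^sup>2)"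
    using assms by (intro Bochner_Integration.integrable_add lincomb_centered(2))
  show "(\<lambda>\<omega>. X \<omega> * Y \<omega>) \<in> borel_measurable M"
    using assms[THEN lincomb_measurable] by measurable
  have "\<bar>x * y\<bar> \<le> x\<^sup>2 + y\<^sup>2" for x y :: real
  proof -
    have "2 * \<bar>x\<bar> * \<bar>y\<bar> \<le> x\<^sup>2 + y\<^sup>2" using sum_squares_bound[of "\<bar>x\<bar>" "\<bar>y\<bar>"] by simp
    moreover have "0 \<le> \<bar>x\<bar> * \<bar>y\<bar>" by simp
    ultimately show ?thesis unfolding abs_mult by linarith
  qed
  then show "AE \<omega> in M. norm (X \<omega> * Y \<omega>) \<le> norm ((X \<omega>)\<^sup>2 + (Y \<omega>)\<^sup>2)" by auto
qed

text \<open>Both cosine (sign -1) and hyperbolic cosine (sign 1) satisfy the product-to-sum formula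
  below, and their expectation on a centred Gaussian variable is explicit. This evaluates the
  variance of a sum exactly; it is of second order in the covariances.\<close>

lemma variance_sum_even_function:
  fixes F :: "real \<Rightarrow> real" and X :: "nat \<Rightarrow> 'a \<Rightarrow> real"
  assumes F_prod: "\<And>x y. F x * F y = (F (x + y) + F (x - y)) / 2"
    and F_int: "\<And>X. lincomb X \<Longrightarrow> integrable M (\<lambda>\<omega>. F (X \<omega>))"
    and F_exp: "\<And>X. lincomb X \<Longrightarrow> expectation (\<lambda>\<omega>. F (X \<omega>)) = exp (s * expectation (\<lambda>\<omega>. (X \<omega>)\<^sup>2) / 2)"
    and s: "\<bar>s\<bar> = 1"
    and X: "\<And>k. lincomb (X k)"
    and A: "\<And>k l. k < m \<Longrightarrow> l < m \<Longrightarrow> \<bar>expectation (\<lambda>\<omega>. X k \<omega> * X l \<omega>)\<bar> \<le> A"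
  defines "D \<equiv> \<lambda>\<omega>. \<Sum>k<m. F (X k \<omega>) - exp (s * expectation (\<lambda>\<omega>. (X k \<omega>)\<^sup>2) / 2)"
  shows "integrable M (\<lambda>\<omega>. (D \<omega>)\<^sup>2)"
    and "expectation (\<lambda>\<omega>. (D \<omega>)\<^sup>2) \<le> exp A * (cosh A)\<^sup>2 * (\<Sum>k<m. \<Sum>l<m. (expectation (\<lambda>\<omega>. X k \<omega> * X l \<omega>))\<^sup>2)"
proof -
  define c where "c k l = expectation (\<lambda>\<omega>. X k \<omega> * X l \<omega>)" for k l
  define e where "e k = exp (s * c k k / 2)" for k
  have e: "exp (s * expectation (\<lambda>\<omega>. (X k \<omega>)\<^sup>2) / 2) = e k" for k
    by (simp add: e_def c_def power2_eq_square)
  have int1: "integrable M (\<lambda>\<omega>. F (X k \<omega>))" for k by (intro F_int X)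
  have E1: "expectation (\<lambda>\<omega>. F (X k \<omega>)) = e k" for k using F_exp[OF X[of k]] e by simp
  have int2: "integrable M (\<lambda>\<omega>. F (X k \<omega>) * F (X l \<omega>))" for k l
    unfolding F_prod by (intro integrable_divide Bochner_Integration.integrable_add F_int lincomb_add lincomb_diff X)
  have c_int: "integrable M (\<lambda>\<omega>. X k \<omega> * X l \<omega>)" for k l by (intro lincomb_mult_integrable X)
  have sq: "expectation (\<lambda>\<omega>. (X k \<omega> + X l \<omega>)\<^sup>2) = c k k + c l l + 2 * c k l"
    "expectation (\<lambda>\<omega>. (X k \<omega> - X l \<omega>)\<^sup>2) = c k k + c l l - 2 * c k l" for k l
  proof -
    have expand: "(X k \<omega> + X l \<omega>)\<^sup>2 = X k \<omega> * X k \<omega> + X l \<omega> * X l \<omega> + 2 * (X k \<omega> * X l \<omega>)"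
      "(X k \<omega> - X l \<omega>)\<^sup>2 = X k \<omega> * X k \<omega> + X l \<omega> * X l \<omega> - 2 * (X k \<omega> * X l \<omega>)" for \<omega>
      by (simp_all add: power2_eq_square algebra_simps)
    show "expectation (\<lambda>\<omega>. (X k \<omega> + X l \<omega>)\<^sup>2) = c k k + c l l + 2 * c k l"
      "expectation (\<lambda>\<omega>. (X k \<omega> - X l \<omega>)\<^sup>2) = c k k + c l l - 2 * c k l"
      using c_int[of k k] c_int[of l l] c_int[of k l] unfolding expand c_def by simp_all
  qed
  \<comment> \<open>The variances of the sum and of the difference differ only in the sign of 2 *
    \<open>c k l\<close>, so the two exponentials combine to a cosh. The excess over
    \<open>e k * e l\<close> is even in the covariance, whichever sign s has.\<close>
  have E2: "expectation (\<lambda>\<omega>. F (X k \<omega>) * F (X l \<omega>)) = e k * e l * cosh (c k l)" for k l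
  proof -
    have "expectation (\<lambda>\<omega>. F (X k \<omega>) * F (X l \<omega>))
        = (expectation (\<lambda>\<omega>. F (X k \<omega> + X l \<omega>)) + expectation (\<lambda>\<omega>. F (X k \<omega> - X l \<omega>))) / 2"
      unfolding F_prod
      using F_int[OF lincomb_add[OF X[of k] X[of l]]] F_int[OF lincomb_diff[OF X[of k] X[of l]]] by simp
    also have "\<dots> = (exp (s * (c k k + c l l + 2 * c k l) / 2) + exp (s * (c k k + c l l - 2 * c k l) / 2)) / 2"
      by (simp only: F_exp lincomb_add lincomb_diff X sq)
    also have "s * (c k k + c l l + 2 * c k l) / 2 = s * c k k / 2 + s * c l l / 2 + s * c k l" by (simp add: field_simps)
    also have "s * (c k k + c l l - 2 * c k l) / 2 = s * c k k / 2 + s * c l l / 2 + - (s * c k l)" by (simp add: field_simps)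
    also have "(exp (s * c k k / 2 + s * c l l / 2 + s * c k l) + exp (s * c k k / 2 + s * c l l / 2 + - (s * c k l))) / 2
        = e k * e l * cosh (s * c k l)"
      unfolding e_def cosh_field_def exp_add by (simp add: field_simps)
    also have "cosh (s * c k l) = cosh (c k l)" using s by (auto simp: abs_if split: if_splits)
    finally show ?thesis .
  qed
  have D_e: "D \<omega> = (\<Sum>k<m. F (X k \<omega>) - e k)" for \<omega> unfolding D_def e ..
  have D2: "(D \<omega>)\<^sup>2 = (\<Sum>k<m. \<Sum>l<m. F (X k \<omega>) * F (X l \<omega>) - e k * F (X l \<omega>) - e l * F (X k \<omega>) + e k * e l)" for \<omega>
    unfolding D_e unfolding power2_eq_square sum_product by (intro sum.cong refl) (simp add: algebra_simps)
  have int3: "integrable M (\<lambda>\<omega>. F (X k \<omega>) * F (X l \<omega>) - e k * F (X l \<omega>) - e l * F (X k \<omega>) + e k * e l)" for k l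
    using int1[of k] int1[of l] int2[of k l] by simp
  show "integrable M (\<lambda>\<omega>. (D \<omega>)\<^sup>2)"
    unfolding D2 by (intro Bochner_Integration.integrable_sum int3)
  have "expectation (\<lambda>\<omega>. (D \<omega>)\<^sup>2) = (\<Sum>k<m. \<Sum>l<m. expectation (\<lambda>\<omega>. F (X k \<omega>) * F (X l \<omega>) - e k * F (X l \<omega>) - e l * F (X k \<omega>) + e k * e l))"
    unfolding D2 using int3 by (simp add: Bochner_Integration.integral_sum Bochner_Integration.integrable_sum)
  also have "\<dots> = (\<Sum>k<m. \<Sum>l<m. e k * e l * (cosh (c k l) - 1))"
    using int1 int2 by (intro sum.cong refl) (simp add: E1 E2 prob_space algebra_simps)
  also have "\<dots> \<le> (\<Sum>k<m. \<Sum>l<m. exp A * ((cosh A)\<^sup>2 * (c k l)\<^sup>2))"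
  proof (intro sum_mono mult_mono)
    fix k l assume kl: "k \<in> {..<m}" "l \<in> {..<m}"
    have diag: "s * c j j / 2 \<le> A / 2" if "j < m" for j
      using A[OF that that] s unfolding c_def[symmetric] by (auto simp: abs_if split: if_splits)
    have "s * c k k / 2 + s * c l l / 2 \<le> A" using diag[of k] diag[of l] kl by simp
    then show "e k * e l \<le> exp A" unfolding e_def exp_add[symmetric] by simp
    show "cosh (c k l) - 1 \<le> (cosh A)\<^sup>2 * (c k l)\<^sup>2"
      using A[of k l] kl by (intro cosh_minus_one_le) (auto simp: c_def)
  qed (auto simp: cosh_real_ge_1)
  also have "\<dots> = exp A * (cosh A)\<^sup>2 * (\<Sum>k<m. \<Sum>l<m. (c k l)\<^sup>2)"
    by (simp add: sum_distrib_left mult.assoc)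
  finally show "expectation (\<lambda>\<omega>. (D \<omega>)\<^sup>2) \<le> exp A * (cosh A)\<^sup>2 * (\<Sum>k<m. \<Sum>l<m. (expectation (\<lambda>\<omega>. X k \<omega> * X l \<omega>))\<^sup>2)"
    unfolding c_def .
qed

end

section \<open>Increments over the grid\<close>

text \<open>The sum S of the overview, for an arbitrary process: it is applied to W, to the bridge
  and to \<kappa> regarded as a deterministic process, and it is linear in its argument.\<close>

definition bridge_walk :: "nat \<Rightarrow> real \<Rightarrow> (real \<Rightarrow> 'a \<Rightarrow> real) \<Rightarrow> nat \<Rightarrow> nat \<Rightarrow> 'a \<Rightarrow> real" where
  "bridge_walk b H W n k \<omega> = (\<Sum>i\<in>{1..n}. real b powr (H * real i) *
     (W (real (k mod b ^ i) / real b ^ i + 1 / real b ^ i) \<omega> - W (real (k mod b ^ i) / real b ^ i) \<omega>))"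

lemma abs_exp_minus_diff_le:
  fixes x y :: real
  assumes "0 \<le> x" "0 \<le> y"
  shows "\<bar>exp (- x) - exp (- y)\<bar> \<le> \<bar>x - y\<bar>"
proof -
  have *: "exp (- u) - exp (- v) \<le> v - u" if "0 \<le> u" "u \<le> v" for u v :: real
  proof -
    have "exp (- u) - exp (- v) = exp (- u) * (1 - exp (- (v - u)))"
      by (simp add: right_diff_distrib flip: exp_add)
    also have "\<dots> \<le> 1 * (v - u)"
    proof (intro mult_mono)
      show "1 - exp (- (v - u)) \<le> v - u" using exp_ge_add_one_self[of "- (v - u)"] by linarith
    qed (use that in auto)
    finally show ?thesis by simp
  qed
  show ?thesis
  proof (cases "x \<le> y")
    case True
    then have "exp (- y) \<le> exp (- x)" by simp
    then show ?thesis using *[of x y] True assms by simp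
  next
    case False
    then have "exp (- x) \<le> exp (- y)" by simp
    then show ?thesis using *[of y x] False assms by simp
  qed
qed

lemma digit_in_unit_interval:
  fixes b k i :: nat
  assumes "b \<ge> 2"
  shows "real (k mod b ^ i) / real b ^ i \<in> {0..1}" "real (k mod b ^ i) / real b ^ i + 1 / real b ^ i \<in> {0..1}"
proof -
  have "k mod b ^ i < b ^ i" using assms by simp
  then have "k mod b ^ i + 1 \<le> b ^ i" by simp
  then have "real (k mod b ^ i) + 1 \<le> real b ^ i" by (metis of_nat_1 of_nat_add of_nat_le_iff of_nat_power)
  moreover have "real b ^ i > 0" using assms by simp
  ultimately show "real (k mod b ^ i) / real b ^ i \<in> {0..1}" "real (k mod b ^ i) / real b ^ i + 1 / real b ^ i \<in> {0..1}"
    by (auto simp: add_divide_distrib[symmetric])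
qed

lemma tendsto_floor_ratio:
  fixes t z :: real
  assumes "0 \<le> t" "1 < z"
  shows "(\<lambda>n. real (nat \<lfloor>t * z ^ n\<rfloor>) / z ^ n) \<longlonglongrightarrow> t"
proof (rule tendsto_sandwich)
  have "(\<lambda>n. t - (1 / z) ^ n) \<longlonglongrightarrow> t - 0"
    using assms by (intro tendsto_intros LIMSEQ_power_zero) auto
  then show "(\<lambda>n. t - (1 / z) ^ n) \<longlonglongrightarrow> t" by simp
  have "0 \<le> t * z ^ n" for n using assms by simp
  then have fl: "real (nat \<lfloor>t * z ^ n\<rfloor>) \<le> t * z ^ n" "t * z ^ n - 1 \<le> real (nat \<lfloor>t * z ^ n\<rfloor>)" for n
    by (auto simp: of_nat_nat)
  have zp: "0 < z ^ n" for n using assms by simp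
  show "\<forall>\<^sub>F n in sequentially. t - (1 / z) ^ n \<le> real (nat \<lfloor>t * z ^ n\<rfloor>) / z ^ n"
  proof (intro always_eventually allI)
    fix n
    have "t - (1 / z) ^ n = (t * z ^ n - 1) / z ^ n"
      using assms by (simp add: diff_divide_distrib power_divide)
    also have "\<dots> \<le> real (nat \<lfloor>t * z ^ n\<rfloor>) / z ^ n"
      using fl(2)[of n] zp[of n] by (intro divide_right_mono) auto
    finally show "t - (1 / z) ^ n \<le> real (nat \<lfloor>t * z ^ n\<rfloor>) / z ^ n" .
  qed
  show "\<forall>\<^sub>F n in sequentially. real (nat \<lfloor>t * z ^ n\<rfloor>) / z ^ n \<le> t"
    using fl(1) zp by (intro always_eventually allI) (simp add: pos_divide_le_eq)
qed simp

section \<open>The walk of a fractional Brownian motion\<close>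

locale fbm_walk = centered_gaussian_process M W for M :: "'a measure" and W +
  fixes H :: real and b :: nat
  assumes H: "0 < H" "H < 1" and b: "b \<ge> 2"
    and cov: "\<And>s t. s \<in> {0..1} \<Longrightarrow> t \<in> {0..1} \<Longrightarrow>
      expectation (\<lambda>\<omega>. W s \<omega> * W t \<omega>) = (s powr (2 * H) + t powr (2 * H) - \<bar>t - s\<bar> powr (2 * H)) / 2"
begin

abbreviation walk :: "nat \<Rightarrow> nat \<Rightarrow> 'a \<Rightarrow> real" where
  "walk \<equiv> bridge_walk b H W"

lemma expectation_increments:
  assumes "s \<in> {0..1}" "s + L \<in> {0..1}" "t \<in> {0..1}" "t + d \<in> {0..1}"
  shows "expectation (\<lambda>\<omega>. (W (s + L) \<omega> - W s \<omega>) * (W (t + d) \<omega> - W t \<omega>)) = increment_cov H (t - s - L) L d"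
proof -
  have int: "integrable M (\<lambda>\<omega>. W u \<omega> * W v \<omega>)" if "u \<in> {0..1}" "v \<in> {0..1}" for u v
    using that by (intro lincomb_mult_integrable lincomb_W)
  have "expectation (\<lambda>\<omega>. (W (s + L) \<omega> - W s \<omega>) * (W (t + d) \<omega> - W t \<omega>))
     = expectation (\<lambda>\<omega>. W (s + L) \<omega> * W (t + d) \<omega> - W (s + L) \<omega> * W t \<omega> - W s \<omega> * W (t + d) \<omega> + W s \<omega> * W t \<omega>)"
    by (simp add: algebra_simps)
  also have "\<dots> = expectation (\<lambda>\<omega>. W (s + L) \<omega> * W (t + d) \<omega>) - expectation (\<lambda>\<omega>. W (s + L) \<omega> * W t \<omega>)
      - expectation (\<lambda>\<omega>. W s \<omega> * W (t + d) \<omega>) + expectation (\<lambda>\<omega>. W s \<omega> * W t \<omega>)"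
    using int[OF assms(2,4)] int[OF assms(2,3)] int[OF assms(1,4)] int[OF assms(1,3)] by simp
  also have "\<dots> = increment_cov H (t - s - L) L d"
  proof -
    have "\<bar>t + d - (s + L)\<bar> = \<bar>t - s - L + d\<bar>" "\<bar>t - (s + L)\<bar> = \<bar>t - s - L\<bar>"
      "\<bar>t + d - s\<bar> = \<bar>t - s - L + L + d\<bar>" "\<bar>t - s\<bar> = \<bar>t - s - L + L\<bar>" by linarith+
    then show ?thesis
      using cov[OF assms(2,4)] cov[OF assms(2,3)] cov[OF assms(1,4)] cov[OF assms(1,3)]
      unfolding increment_cov_def by (simp only:) (simp add: field_simps)
  qed
  finally show ?thesis .
qed

lemma lincomb_step: "lincomb (\<lambda>\<omega>. real b powr (H * real i) *
    (W (real (k mod b ^ i) / real b ^ i + 1 / real b ^ i) \<omega> - W (real (k mod b ^ i) / real b ^ i) \<omega>))"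
  by (intro lincomb_scale lincomb_diff lincomb_W digit_in_unit_interval b)

lemma lincomb_walk: "lincomb (\<lambda>\<omega>. walk n k \<omega>)"
  unfolding bridge_walk_def by (intro lincomb_sum lincomb_step) simp

lemma walk_cov: "expectation (\<lambda>\<omega>. walk n k \<omega> * walk n l \<omega>) = path_cov H b n k l"
proof -
  define \<xi> where "\<xi> k i \<omega> = real b powr (H * real i) *
    (W (real (k mod b ^ i) / real b ^ i + 1 / real b ^ i) \<omega> - W (real (k mod b ^ i) / real b ^ i) \<omega>)" for k i :: nat and \<omega>
  have int: "integrable M (\<lambda>\<omega>. \<xi> k i \<omega> * \<xi> l j \<omega>)" for k l i j
    unfolding \<xi>_def by (intro lincomb_mult_integrable lincomb_step)
  have E: "expectation (\<lambda>\<omega>. \<xi> k i \<omega> * \<xi> l j \<omega>) = digit_cov H b i j (k mod b ^ i) (l mod b ^ j)" for k l i j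
  proof -
    let ?s = "real (k mod b ^ i) / real b ^ i" and ?L = "1 / real b ^ i"
    let ?t = "real (l mod b ^ j) / real b ^ j" and ?d = "1 / real b ^ j"
    have "(\<lambda>\<omega>. \<xi> k i \<omega> * \<xi> l j \<omega>) = (\<lambda>\<omega>. (real b powr (H * real i) * real b powr (H * real j)) *
        ((W (?s + ?L) \<omega> - W ?s \<omega>) * (W (?t + ?d) \<omega> - W ?t \<omega>)))"
      by (simp add: \<xi>_def fun_eq_iff mult_ac)
    then have "expectation (\<lambda>\<omega>. \<xi> k i \<omega> * \<xi> l j \<omega>) = (real b powr (H * real i) * real b powr (H * real j)) *
        expectation (\<lambda>\<omega>. (W (?s + ?L) \<omega> - W ?s \<omega>) * (W (?t + ?d) \<omega> - W ?t \<omega>))"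
      by (simp only: integral_mult_right_zero)
    also have "expectation (\<lambda>\<omega>. (W (?s + ?L) \<omega> - W ?s \<omega>) * (W (?t + ?d) \<omega> - W ?t \<omega>)) = increment_cov H (?t - ?s - ?L) ?L ?d"
      by (intro expectation_increments digit_in_unit_interval b)
    finally show ?thesis unfolding digit_cov_def by (simp only: distrib_left powr_add)
  qed
  have "(\<lambda>\<omega>. walk n k \<omega> * walk n l \<omega>) = (\<lambda>\<omega>. \<Sum>i\<in>{1..n}. \<Sum>j\<in>{1..n}. \<xi> k i \<omega> * \<xi> l j \<omega>)"
    unfolding bridge_walk_def \<xi>_def sum_product ..
  then have "expectation (\<lambda>\<omega>. walk n k \<omega> * walk n l \<omega>) = expectation (\<lambda>\<omega>. \<Sum>i\<in>{1..n}. \<Sum>j\<in>{1..n}. \<xi> k i \<omega> * \<xi> l j \<omega>)"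
    by (simp only:)
  also have "\<dots> = (\<Sum>i\<in>{1..n}. \<Sum>j\<in>{1..n}. expectation (\<lambda>\<omega>. \<xi> k i \<omega> * \<xi> l j \<omega>))"
    using int by (simp add: Bochner_Integration.integral_sum Bochner_Integration.integrable_sum)
  also have "\<dots> = path_cov H b n k l" unfolding path_cov_def E ..
  finally show ?thesis .
qed

text \<open>At n = 0 the walk is an empty sum and the quotient is 0, so bounds over all n hold there
  too.\<close>

definition nwalk :: "nat \<Rightarrow> nat \<Rightarrow> 'a \<Rightarrow> real" where
  "nwalk n k \<omega> = walk n k \<omega> / sqrt (real n)"

lemma lincomb_nwalk: "lincomb (\<lambda>\<omega>. u * nwalk n k \<omega>)"
  using lincomb_scale[OF lincomb_walk[of n k], of "u / sqrt (real n)"] by (simp add: nwalk_def)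

lemma nwalk_cov: "expectation (\<lambda>\<omega>. (u * nwalk n k \<omega>) * (u * nwalk n l \<omega>)) = u\<^sup>2 * path_cov H b n k l / real n"
proof -
  have "(\<lambda>\<omega>. (u * nwalk n k \<omega>) * (u * nwalk n l \<omega>)) = (\<lambda>\<omega>. (u\<^sup>2 / real n) * (walk n k \<omega> * walk n l \<omega>))"
    by (simp add: nwalk_def fun_eq_iff power2_eq_square field_simps)
  then show ?thesis by (simp only: integral_mult_right_zero walk_cov) simp
qed

section \<open>Almost sure limits of empirical averages\<close>

lemma path_cov_self_nonneg: "0 \<le> path_cov H b n k k"
  unfolding walk_cov[symmetric] by (intro integral_nonneg_AE) simp

text \<open>The second moment of the centred average is at most a constant times the mean squared
  covariance, O(1/n^2). Only the first \<open>m n\<close> cells are averaged, but squared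
  covariances are nonnegative, so the double sum over all b^n cells bounds theirs.\<close>

lemma AE_centered_average:
  fixes F :: "real \<Rightarrow> real"
  assumes F_prod: "\<And>x y. F x * F y = (F (x + y) + F (x - y)) / 2"
    and F_int: "\<And>X. lincomb X \<Longrightarrow> integrable M (\<lambda>\<omega>. F (X \<omega>))"
    and F_exp: "\<And>X. lincomb X \<Longrightarrow> expectation (\<lambda>\<omega>. F (X \<omega>)) = exp (s * expectation (\<lambda>\<omega>. (X \<omega>)\<^sup>2) / 2)"
    and s: "\<bar>s\<bar> = 1" and m: "\<And>n. m n \<le> b ^ n"
  shows "AE \<omega> in M. (\<lambda>n. (\<Sum>k<m n. F (u * nwalk n k \<omega>) - exp (s * (u\<^sup>2 * path_cov H b n k k / real n) / 2)) / real b ^ n) \<longlonglongrightarrow> 0"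
proof -
  obtain C1 where C1: "C1 \<ge> 0" "\<And>n k l. \<bar>path_cov H b n k l\<bar> \<le> C1 * real n"
    using path_cov_bound[OF H b] by blast
  obtain C2 where C2: "C2 \<ge> 0" "\<And>n. (\<Sum>k<b ^ n. \<Sum>l<b ^ n. (path_cov H b n k l)\<^sup>2) \<le> C2 * (real b ^ n)\<^sup>2"
    using path_cov_square[OF H b] by blast
  define A where "A = u\<^sup>2 * C1"
  have cov_le: "\<bar>u\<^sup>2 * path_cov H b n k l / real n\<bar> \<le> A" for n k l
  proof (cases "n = 0")
    case False
    have "\<bar>u\<^sup>2 * path_cov H b n k l / real n\<bar> = u\<^sup>2 * (\<bar>path_cov H b n k l\<bar> / real n)" by (simp add: abs_mult)
    also have "\<dots> \<le> u\<^sup>2 * C1"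
      using C1(2)[of n k l] False by (intro mult_left_mono) (auto simp: pos_divide_le_eq)
    finally show ?thesis by (simp add: A_def)
  qed (use C1 in \<open>simp add: A_def\<close>)
  define D where "D n \<omega> = (\<Sum>k<m n. F (u * nwalk n k \<omega>) - exp (s * (u\<^sup>2 * path_cov H b n k k / real n) / 2))" for n \<omega>
  have var: "expectation (\<lambda>\<omega>. (u * nwalk n k \<omega>)\<^sup>2) = u\<^sup>2 * path_cov H b n k k / real n" for n k
    using nwalk_cov[of u n k k] by (simp add: power2_eq_square)
  note variance = variance_sum_even_function[where F = F and s = s and A = A and X = "\<lambda>k \<omega>. u * nwalk n k \<omega>" and m = "m n" for n,
      OF F_prod F_int F_exp s lincomb_nwalk, unfolded nwalk_cov var, OF _ _ cov_le, folded D_def]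
  have D_int: "integrable M (\<lambda>\<omega>. (D n \<omega>)\<^sup>2)" for n by (rule variance)
  have D_le: "expectation (\<lambda>\<omega>. (D n \<omega>)\<^sup>2) \<le> exp A * (cosh A)\<^sup>2 * (\<Sum>k<m n. \<Sum>l<m n. (u\<^sup>2 * path_cov H b n k l / real n)\<^sup>2)" for n
    by (rule variance)
  have "AE \<omega> in M. (\<lambda>n. D n \<omega> / real b ^ n) \<longlonglongrightarrow> 0"
  proof (rule AE_tendsto_zero_of_square_summable)
    show "integrable M (\<lambda>\<omega>. (D n \<omega> / real b ^ n)\<^sup>2)" for n
      unfolding power_divide by (intro integrable_divide D_int)
    have "(\<lambda>\<omega>. F (u * nwalk n k \<omega>)) \<in> borel_measurable M" for n k
      using F_int[OF lincomb_nwalk] by (rule borel_measurable_integrable)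
    then show "(\<lambda>\<omega>. D n \<omega> / real b ^ n) \<in> borel_measurable M" for n
      unfolding D_def by (intro borel_measurable_divide borel_measurable_sum borel_measurable_diff) auto
    define K where "K = exp A * (cosh A)\<^sup>2 * (u ^ 4 * C2)"
    \<comment> \<open>Dividing the covariances of the walk by n gives the factor 1/n^2 after
      squaring. At n = 0 both sides are 0.\<close>
    have bound: "expectation (\<lambda>\<omega>. (D n \<omega> / real b ^ n)\<^sup>2) \<le> K * (1 / real n ^ 2)" for n
    proof -
      have "(\<Sum>k<m n. \<Sum>l<m n. (path_cov H b n k l)\<^sup>2) \<le> (\<Sum>k<b ^ n. \<Sum>l<b ^ n. (path_cov H b n k l)\<^sup>2)"
        using m[of n] by (intro order_trans[OF sum_mono[OF sum_mono2] sum_mono2]) (auto intro!: sum_nonneg)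
      also have "\<dots> \<le> C2 * (real b ^ n)\<^sup>2" by (rule C2)
      finally have *: "(\<Sum>k<m n. \<Sum>l<m n. (path_cov H b n k l)\<^sup>2) \<le> C2 * (real b ^ n)\<^sup>2" .
      have "(\<Sum>k<m n. \<Sum>l<m n. (u\<^sup>2 * path_cov H b n k l / real n)\<^sup>2)
          = (u ^ 4 / real n ^ 2) * (\<Sum>k<m n. \<Sum>l<m n. (path_cov H b n k l)\<^sup>2)"
        by (simp add: sum_distrib_left power_divide power_mult_distrib flip: power_mult)
      also have "\<dots> \<le> (u ^ 4 / real n ^ 2) * (C2 * (real b ^ n)\<^sup>2)"
        by (intro mult_left_mono *) auto
      finally have "expectation (\<lambda>\<omega>. (D n \<omega>)\<^sup>2) \<le> exp A * (cosh A)\<^sup>2 * ((u ^ 4 / real n ^ 2) * (C2 * (real b ^ n)\<^sup>2))"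
        by (intro order_trans[OF D_le] mult_left_mono) auto
      then have "expectation (\<lambda>\<omega>. (D n \<omega>)\<^sup>2) / (real b ^ n)\<^sup>2
          \<le> exp A * (cosh A)\<^sup>2 * ((u ^ 4 / real n ^ 2) * (C2 * (real b ^ n)\<^sup>2)) / (real b ^ n)\<^sup>2"
        by (intro divide_right_mono) auto
      also have "\<dots> = K * (1 / real n ^ 2)" using b by (simp add: K_def)
      finally show ?thesis by (simp add: power_divide)
    qed
    show "summable (\<lambda>n. expectation (\<lambda>\<omega>. (D n \<omega> / real b ^ n)\<^sup>2))"
    proof (rule summable_comparison_test')
      show "summable (\<lambda>n. K * (1 / real n ^ 2))"
        using inverse_power_summable[of 2, where 'a = real] by (intro summable_mult) (simp add: inverse_eq_divide)
      show "norm (expectation (\<lambda>\<omega>. (D n \<omega> / real b ^ n)\<^sup>2)) \<le> K * (1 / real n ^ 2)" if "n \<ge> 0" for n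
        using bound[of n] by (simp add: integral_nonneg_AE)
    qed
  qed
  then show ?thesis unfolding D_def .
qed

text \<open>On nonnegative numbers exp (- x) is Lipschitz with constant 1, so replacing every
  variance by its typical value 1 costs at most the mean deviation of the variances, O(1/n) by
  \<open>path_cov_diagonal\<close>.\<close>

lemma mean_exp_lim:
  assumes t: "(\<lambda>n. real (m n) / real b ^ n) \<longlonglongrightarrow> t" and m: "\<And>n. m n \<le> b ^ n"
  shows "(\<lambda>n. (\<Sum>k<m n. exp (- 1 * (u\<^sup>2 * path_cov H b n k k / real n) / 2)) / real b ^ n) \<longlonglongrightarrow> t * exp (- u\<^sup>2 / 2)"
proof -
  obtain C where C: "C \<ge> 0" "\<And>n. (\<Sum>k<b ^ n. \<bar>path_cov H b n k k - real n\<bar>) \<le> C * real b ^ n"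
    using path_cov_diagonal[OF H b] by blast
  define g where "g n k = exp (- 1 * (u\<^sup>2 * path_cov H b n k k / real n) / 2)" for n k
  have bound: "\<bar>(\<Sum>k<m n. g n k) / real b ^ n - real (m n) / real b ^ n * exp (- u\<^sup>2 / 2)\<bar> \<le> u\<^sup>2 / 2 * C * (1 / real n)" if "n > 0" for n
  proof -
    have "\<bar>(\<Sum>k<m n. g n k) / real b ^ n - real (m n) / real b ^ n * exp (- u\<^sup>2 / 2)\<bar> = \<bar>\<Sum>k<m n. g n k - exp (- u\<^sup>2 / 2)\<bar> / real b ^ n"
      by (simp add: sum_subtractf diff_divide_distrib[symmetric])
    also have "\<dots> \<le> (\<Sum>k<m n. \<bar>g n k - exp (- u\<^sup>2 / 2)\<bar>) / real b ^ n"
      by (intro divide_right_mono sum_abs) auto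
    also have "\<dots> \<le> (\<Sum>k<m n. u\<^sup>2 / 2 * (1 / real n) * \<bar>path_cov H b n k k - real n\<bar>) / real b ^ n"
    proof (intro divide_right_mono sum_mono)
      fix k
      have "\<bar>g n k - exp (- u\<^sup>2 / 2)\<bar> \<le> \<bar>u\<^sup>2 * path_cov H b n k k / real n / 2 - u\<^sup>2 / 2\<bar>"
        using abs_exp_minus_diff_le[of "u\<^sup>2 * path_cov H b n k k / real n / 2" "u\<^sup>2 / 2"] path_cov_self_nonneg[of n k]
        by (simp add: g_def)
      also have "u\<^sup>2 * path_cov H b n k k / real n / 2 - u\<^sup>2 / 2 = u\<^sup>2 / 2 * (1 / real n) * (path_cov H b n k k - real n)"
        using that by (simp add: field_simps)
      finally show "\<bar>g n k - exp (- u\<^sup>2 / 2)\<bar> \<le> u\<^sup>2 / 2 * (1 / real n) * \<bar>path_cov H b n k k - real n\<bar>"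
        by (simp add: abs_mult)
    qed auto
    also have "\<dots> = u\<^sup>2 / 2 * (1 / real n) * (\<Sum>k<m n. \<bar>path_cov H b n k k - real n\<bar>) / real b ^ n"
      by (simp only: sum_distrib_left)
    also have "\<dots> \<le> u\<^sup>2 / 2 * (1 / real n) * (C * real b ^ n) / real b ^ n"
      using m[of n] by (intro divide_right_mono mult_left_mono order_trans[OF sum_mono2 C(2)]) auto
    also have "\<dots> = u\<^sup>2 / 2 * C * (1 / real n)" using b by simp
    finally show ?thesis .
  qed
  have "(\<lambda>n. u\<^sup>2 / 2 * C * (1 / real n)) \<longlonglongrightarrow> u\<^sup>2 / 2 * C * 0"
    by (intro tendsto_intros lim_1_over_n)
  then have null: "(\<lambda>n. u\<^sup>2 / 2 * C * (1 / real n)) \<longlonglongrightarrow> 0" by simp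
  have "(\<lambda>n. (\<Sum>k<m n. g n k) / real b ^ n - real (m n) / real b ^ n * exp (- u\<^sup>2 / 2)) \<longlonglongrightarrow> 0"
  proof (rule Lim_null_comparison[OF _ null])
    show "\<forall>\<^sub>F n in sequentially. norm ((\<Sum>k<m n. g n k) / real b ^ n - real (m n) / real b ^ n * exp (- u\<^sup>2 / 2))
        \<le> u\<^sup>2 / 2 * C * (1 / real n)"
      unfolding real_norm_def by (rule eventually_mono[OF eventually_gt_at_top[of 0] bound])
  qed
  from tendsto_add[OF this tendsto_mult[OF t tendsto_const[of "exp (- u\<^sup>2 / 2)"]]]
  show ?thesis by (simp add: g_def)
qed

lemma AE_cos_average:
  assumes t: "(\<lambda>n. real (m n) / real b ^ n) \<longlonglongrightarrow> t" and m: "\<And>n. m n \<le> b ^ n"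
  shows "AE \<omega> in M. (\<lambda>n. (\<Sum>k<m n. cos (u * nwalk n k \<omega>)) / real b ^ n) \<longlonglongrightarrow> t * exp (- u\<^sup>2 / 2)"
proof -
  have "AE \<omega> in M. (\<lambda>n. (\<Sum>k<m n. cos (u * nwalk n k \<omega>) - exp (- 1 * (u\<^sup>2 * path_cov H b n k k / real n) / 2)) / real b ^ n) \<longlonglongrightarrow> 0"
  proof (rule AE_centered_average)
    show "cos x * cos y = (cos (x + y) + cos (x - y)) / 2" for x y :: real
      by (simp add: cos_add cos_diff)
    show "integrable M (\<lambda>\<omega>. cos (X \<omega>))" if "lincomb X" for X
      using lincomb_measurable[OF that] by (intro integrable_const_bound[where B = 1]) auto
    show "expectation (\<lambda>\<omega>. cos (X \<omega>)) = exp (- 1 * expectation (\<lambda>\<omega>. (X \<omega>)\<^sup>2) / 2)" if "lincomb X" for X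
      using lincomb_centered(3)[OF that that] by simp
  qed (use m in auto)
  then show ?thesis
  proof eventually_elim
    case (elim \<omega>)
    from tendsto_add[OF elim mean_exp_lim[OF t m, of u]] show ?case
      by (simp add: sum_subtractf diff_divide_distrib)
  qed
qed

text \<open>Only boundedness is wanted, so the uniform variance bound of
  \<open>path_cov_bound\<close> is enough for the means; exponentials of the variances need no
  asymptotics.\<close>

lemma AE_cosh_average_bounded: "AE \<omega> in M. \<exists>C. \<forall>n. (\<Sum>k<b ^ n. cosh (nwalk n k \<omega>)) / real b ^ n \<le> C"
proof -
  obtain C1 where C1: "C1 \<ge> 0" "\<And>n k l. \<bar>path_cov H b n k l\<bar> \<le> C1 * real n"
    using path_cov_bound[OF H b] by blast
  have "AE \<omega> in M. (\<lambda>n. (\<Sum>k<b ^ n. cosh (1 * nwalk n k \<omega>) - exp (1 * (1\<^sup>2 * path_cov H b n k k / real n) / 2)) / real b ^ n) \<longlonglongrightarrow> 0"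
  proof (rule AE_centered_average)
    show "cosh x * cosh y = (cosh (x + y) + cosh (x - y)) / 2" for x y :: real
      by (simp add: cosh_add cosh_diff)
    show "integrable M (\<lambda>\<omega>. cosh (X \<omega>))" if "lincomb X" for X
      by (rule lincomb_centered(4)[OF that that])
    show "expectation (\<lambda>\<omega>. cosh (X \<omega>)) = exp (1 * expectation (\<lambda>\<omega>. (X \<omega>)\<^sup>2) / 2)" if "lincomb X" for X
      using lincomb_centered(5)[OF that that] by simp
  qed auto
  then show ?thesis
  proof eventually_elim
    case (elim \<omega>)
    then have "Bseq (\<lambda>n. (\<Sum>k<b ^ n. cosh (1 * nwalk n k \<omega>) - exp (1 * (1\<^sup>2 * path_cov H b n k k / real n) / 2)) / real b ^ n)"
      by (intro convergent_imp_Bseq) (auto simp: convergent_def)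
    then obtain B where B: "\<And>n. \<bar>(\<Sum>k<b ^ n. cosh (nwalk n k \<omega>) - exp (path_cov H b n k k / real n / 2)) / real b ^ n\<bar> \<le> B"
      unfolding Bseq_def by auto
    have "(\<Sum>k<b ^ n. cosh (nwalk n k \<omega>)) / real b ^ n \<le> B + exp C1" for n
    proof -
      have "exp (path_cov H b n k k / real n / 2) \<le> exp C1" for k
      proof (cases "n = 0")
        case False
        then have "path_cov H b n k k / real n \<le> C1" using C1(2)[of n k k] by (simp add: pos_divide_le_eq)
        then show ?thesis using C1(1) by simp
      qed (use C1 in simp)
      then have "(\<Sum>k<b ^ n. exp (path_cov H b n k k / real n / 2)) \<le> (\<Sum>k<b ^ n. exp C1)"
        by (intro sum_mono)
      then have "(\<Sum>k<b ^ n. exp (path_cov H b n k k / real n / 2)) / real b ^ n \<le> (\<Sum>k<b ^ n. exp C1) / real b ^ n"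
        by (intro divide_right_mono) auto
      also have "(\<Sum>k<b ^ n. exp C1) / real b ^ n = exp C1" using b by simp
      finally show ?thesis using B[of n] by (simp add: sum_subtractf diff_divide_distrib abs_le_iff)
    qed
    then show ?case by blast
  qed
qed

end

section \<open>From fractional Brownian motion to the bridge\<close>

lemma frac_of_nat_divide:
  assumes "d > 0"
  shows "frac (real k / real d) = real (k mod d) / real d"
proof -
  have "real k = real (k div d) * real d + real (k mod d)"
    by (metis div_mult_mod_eq of_nat_add of_nat_mult)
  then have "real k / real d = real (k div d) + real (k mod d) / real d"
    using assms by (simp add: field_simps)
  then show ?thesis by (simp add: frac_def floor_divide_of_nat_eq)
qed

lemma bridge_walk_hoelder_bound:
  assumes b: "b \<ge> 2" and "H < \<tau>" and "hoelder_continuous_on \<tau> {0..1} \<kappa>"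
  shows "\<exists>C\<ge>0. \<forall>n k \<omega>. \<bar>bridge_walk b H (\<lambda>u _. \<kappa> u) n k \<omega>\<bar> \<le> C"
proof -
  obtain C where C: "\<And>s t. s \<in> {0..1} \<Longrightarrow> t \<in> {0..1} \<Longrightarrow> \<bar>\<kappa> s - \<kappa> t\<bar> \<le> C * \<bar>s - t\<bar> powr \<tau>"
    using assms(3) unfolding hoelder_continuous_on_def by blast
  \<comment> \<open>Level i contributes at most \<bar>C\<bar> * q ^ i. The Hoelder constant C may be
    negative a priori, hence the absolute value.\<close>
  define q where "q = real b powr (H - \<tau>)"
  have "real b powr (H - \<tau>) < real b powr 0" using assms b by (intro powr_less_mono) auto
  then have q: "0 < q" "q < 1" using b by (auto simp: q_def)
  show ?thesis
  proof (intro exI conjI allI)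
    show "\<bar>C\<bar> * (1 / (1 - q)) \<ge> 0" using q by simp
    fix n k \<omega>
    have "\<bar>bridge_walk b H (\<lambda>u _. \<kappa> u) n k \<omega>\<bar> \<le> (\<Sum>i\<in>{1..n}. \<bar>C\<bar> * q ^ i)"
      unfolding bridge_walk_def
    proof (intro order_trans[OF sum_abs] sum_mono)
      fix i
      let ?u = "real (k mod b ^ i) / real b ^ i"
      have "\<bar>\<kappa> (?u + 1 / real b ^ i) - \<kappa> ?u\<bar> \<le> C * \<bar>?u + 1 / real b ^ i - ?u\<bar> powr \<tau>"
        by (intro C digit_in_unit_interval b)
      also have "\<dots> \<le> \<bar>C\<bar> * (1 / real b ^ i) powr \<tau>"
        by (intro mult_mono) auto
      finally have "\<bar>\<kappa> (?u + 1 / real b ^ i) - \<kappa> ?u\<bar> \<le> \<bar>C\<bar> * (1 / real b ^ i) powr \<tau>" .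
      then have "\<bar>real b powr (H * real i) * (\<kappa> (?u + 1 / real b ^ i) - \<kappa> ?u)\<bar>
          \<le> real b powr (H * real i) * (\<bar>C\<bar> * (1 / real b ^ i) powr \<tau>)"
        unfolding abs_mult by (intro mult_mono) auto
      also have "(1 / real b ^ i) powr \<tau> = real b powr (- real i * \<tau>)"
      proof -
        have "1 / real b ^ i = real b powr (- real i)"
          using b by (simp add: powr_minus_divide powr_realpow)
        then show ?thesis by (simp only: powr_powr)
      qed
      also have "real b powr (H * real i) * (\<bar>C\<bar> * real b powr (- real i * \<tau>))
          = \<bar>C\<bar> * real b powr (H * real i + - real i * \<tau>)"
        by (simp only: powr_add mult.left_commute)
      also have "real b powr (H * real i + - real i * \<tau>) = q ^ i"
        using b by (simp add: q_def powr_realpow[symmetric] powr_powr algebra_simps)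
      finally show "\<bar>real b powr (H * real i) * (\<kappa> (?u + 1 / real b ^ i) - \<kappa> ?u)\<bar> \<le> \<bar>C\<bar> * q ^ i" .
    qed
    also have "\<dots> = \<bar>C\<bar> * (\<Sum>i\<in>{1..n}. q ^ i)" by (simp only: sum_distrib_left)
    also have "\<dots> \<le> \<bar>C\<bar> * (1 / (1 - q))"
      using q by (intro mult_left_mono sum_inj_power_le[where g = "\<lambda>i. i"]) auto
    finally show "\<bar>bridge_walk b H (\<lambda>u _. \<kappa> u) n k \<omega>\<bar> \<le> \<bar>C\<bar> * (1 / (1 - q))" .
  qed
qed

lemma bridge_walk_fractional_bridge:
  "bridge_walk b H (fractional_bridge \<kappa> W) n k \<omega>
     = bridge_walk b H W n k \<omega> - bridge_walk b H (\<lambda>u _. \<kappa> u) n k \<omega> * W 1 \<omega>"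
  unfolding bridge_walk_def fractional_bridge_def sum_distrib_right sum_subtractf[symmetric]
  by (intro sum.cong refl) (simp add: algebra_simps)

text \<open>For m \<ge> n the point b^m k / b^n is an integer and the bridge vanishes at 0, so the
  series stops at level n. The index i = n - m is the level of the grid on which the remaining terms
  are evaluated.\<close>

lemma wiener_weierstrass_bridge_grid:
  assumes b: "b \<ge> 2" and "\<kappa> 0 = 0" "W 0 \<omega> = 0"
  shows "wiener_weierstrass_bridge \<alpha> b \<kappa> W (real k / real b ^ n) \<omega>
    = (\<Sum>i\<in>{1..n}. \<alpha> ^ (n - i) * fractional_bridge \<kappa> W (real (k mod b ^ i) / real b ^ i) \<omega>)"
proof -
  define B where "B u = fractional_bridge \<kappa> W u \<omega>" for u
  have B0: "B 0 = 0" using assms by (simp add: B_def fractional_bridge_def)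
  have tail: "frac (real b ^ m * (real k / real b ^ n)) = 0" if "m \<ge> n" for m
  proof -
    have "real b ^ m * (real k / real b ^ n) = real (b ^ (m - n) * k)"
    proof -
      have "real b ^ m = real b ^ (m - n) * real b ^ n" using that by (simp add: power_add[symmetric])
      then show ?thesis using b by simp
    qed
    then show ?thesis by (simp only: frac_eq_0_iff Ints_of_nat)
  qed
  have head: "frac (real b ^ m * (real k / real b ^ n)) = real (k mod b ^ (n - m)) / real b ^ (n - m)" if "m < n" for m
  proof -
    have "real b ^ n = real b ^ m * real b ^ (n - m)" using that by (simp add: power_add[symmetric])
    then have "real b ^ m * (real k / real b ^ n) = real k / real (b ^ (n - m))"
      using b by simp
    then show ?thesis using b frac_of_nat_divide[of "b ^ (n - m)" k] by simp
  qed
  have "wiener_weierstrass_bridge \<alpha> b \<kappa> W (real k / real b ^ n) \<omega>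
      = (\<Sum>m<n. \<alpha> ^ m * B (frac (real b ^ m * (real k / real b ^ n))))"
    unfolding wiener_weierstrass_bridge_def B_def[symmetric]
    by (rule suminf_finite) (simp_all only: finite_lessThan lessThan_iff not_less tail B0 mult_zero_right)
  also have "\<dots> = (\<Sum>m<n. \<alpha> ^ m * B (real (k mod b ^ (n - m)) / real b ^ (n - m)))"
    by (intro sum.cong refl) (simp only: lessThan_iff head)
  also have "\<dots> = (\<Sum>i\<in>{1..n}. \<alpha> ^ (n - i) * B (real (k mod b ^ i) / real b ^ i))"
    by (rule sum.reindex_bij_witness[of _ "\<lambda>i. n - i" "\<lambda>m. n - m"]) auto
  finally show ?thesis unfolding B_def .
qed

lemma wiener_weierstrass_bridge_increment:
  assumes b: "b \<ge> 2" and \<kappa>: "\<kappa> 0 = 0" "\<kappa> 1 = 1" and W0: "W 0 \<omega> = 0" and \<alpha>: "\<alpha> = real b powr (- H)"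
  shows "wiener_weierstrass_bridge \<alpha> b \<kappa> W (real (k + 1) / real b ^ n) \<omega>
      - wiener_weierstrass_bridge \<alpha> b \<kappa> W (real k / real b ^ n) \<omega>
    = real b powr (- (real n * H)) * bridge_walk b H (fractional_bridge \<kappa> W) n k \<omega>"
proof -
  define B where "B u = fractional_bridge \<kappa> W u \<omega>" for u
  have B: "B 0 = 0" "B 1 = 0" using \<kappa> W0 by (simp_all add: B_def fractional_bridge_def)
  have shift: "B (real ((k + 1) mod b ^ i) / real b ^ i) = B (real (k mod b ^ i) / real b ^ i + 1 / real b ^ i)" for i
  proof -
    have bi: "b ^ i > 0" using b by simp
    show ?thesis
    proof (cases "Suc (k mod b ^ i) = b ^ i")
      \<comment> \<open>The right end of the last cell has fractional part 0 instead of 1. Both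
        values of the bridge are 0, so the increment over this cell is still the right one.\<close>
      case True
      then have "(k + 1) mod b ^ i = 0" by (simp add: mod_Suc)
      moreover have "real (k mod b ^ i) + 1 = real b ^ i" using True by (metis of_nat_Suc of_nat_power add.commute)
      then have "real (k mod b ^ i) / real b ^ i + 1 / real b ^ i = 1"
        using bi by (simp add: add_divide_distrib[symmetric])
      ultimately show ?thesis using B by simp
    next
      case False
      then have "(k + 1) mod b ^ i = k mod b ^ i + 1" by (simp add: mod_Suc)
      then show ?thesis by (simp add: add_divide_distrib add.commute)
    qed
  qed
  have pw: "\<alpha> ^ (n - i) = real b powr (- (real n * H)) * real b powr (H * real i)" if "i \<le> n" for i
  proof -
    have "\<alpha> ^ (n - i) = real b powr (- H * real (n - i))"
      using b by (simp add: \<alpha> powr_realpow[symmetric] powr_powr)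
    also have "- H * real (n - i) = - (real n * H) + H * real i" using that by (simp add: of_nat_diff algebra_simps)
    finally show ?thesis by (simp only: powr_add)
  qed
  have "wiener_weierstrass_bridge \<alpha> b \<kappa> W (real (k + 1) / real b ^ n) \<omega>
      - wiener_weierstrass_bridge \<alpha> b \<kappa> W (real k / real b ^ n) \<omega>
    = (\<Sum>i\<in>{1..n}. \<alpha> ^ (n - i) * (B (real (k mod b ^ i) / real b ^ i + 1 / real b ^ i) - B (real (k mod b ^ i) / real b ^ i)))"
    unfolding wiener_weierstrass_bridge_grid[of b \<kappa> W \<omega>, OF b \<kappa>(1) W0] B_def[symmetric] shift sum_subtractf[symmetric]
    by (simp only: right_diff_distrib)
  also have "\<dots> = (\<Sum>i\<in>{1..n}. real b powr (- (real n * H)) * (real b powr (H * real i) *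
      (B (real (k mod b ^ i) / real b ^ i + 1 / real b ^ i) - B (real (k mod b ^ i) / real b ^ i))))"
    by (intro sum.cong refl) (simp add: pw)
  finally show ?thesis unfolding bridge_walk_def B_def by (simp only: sum_distrib_left)
qed

section \<open>Perturbed moments, sums of the gauge and the limit in t\<close>

lemma cosh_add_le: "cosh (x + y) \<le> exp \<bar>y\<bar> * cosh (x :: real)"
proof -
  have "exp (x + y) \<le> exp \<bar>y\<bar> * exp x" "exp (- x - y) \<le> exp \<bar>y\<bar> * exp (- x)"
    unfolding exp_add[symmetric] by simp_all
  then show ?thesis unfolding cosh_field_def by (simp add: distrib_left)
qed

text \<open>Transfers the Gaussian averages w to the bridge: a perturbation of order 1 / sqrt n
  changes the cosines by o(1) and the cosh averages by a bounded factor. It also changes the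
  normalisation from z ^ n to the number \<open>m n\<close> of cells.\<close>

lemma perturbed_abs_moment_lim:
  fixes w x :: "nat \<Rightarrow> nat \<Rightarrow> real" and m :: "nat \<Rightarrow> nat" and z t M C p :: real
  assumes z: "1 < z" and t: "0 < t" "(\<lambda>n. real (m n) / z ^ n) \<longlonglongrightarrow> t" and p: "0 < p"
    and M: "0 \<le> M" "\<And>n k. n > 0 \<Longrightarrow> \<bar>x n k - w n k\<bar> \<le> M / sqrt (real n)"
    and cos_lim: "\<And>u. u \<in> \<rat> \<Longrightarrow> (\<lambda>n. (\<Sum>k<m n. cos (u * w n k)) / z ^ n) \<longlonglongrightarrow> t * exp (- u\<^sup>2 / 2)"
    and cosh_le: "\<And>n. (\<Sum>k<m n. cosh (w n k)) / z ^ n \<le> C"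
  shows "(\<lambda>n. (\<Sum>k<m n. \<bar>x n k\<bar> powr p) / z ^ n) \<longlonglongrightarrow> t * (2 powr (p / 2) * Gamma ((p + 1) / 2) / sqrt pi)"
proof -
  have zp: "0 < z ^ n" for n using z by simp
  \<comment> \<open>Beyond n0 there is at least one cell, and passing from z ^ n to
    \<open>m n\<close> costs at most a factor 2 / t. Earlier indices are removed by a shift.\<close>
  have "\<forall>\<^sub>F n in sequentially. t / 2 < real (m n) / z ^ n \<and> n > 0"
    using t by (intro eventually_conj order_tendstoD(1)[OF t(2)] eventually_gt_at_top) auto
  then obtain n0 where n0: "\<And>n. n \<ge> n0 \<Longrightarrow> t / 2 < real (m n) / z ^ n" "\<And>n. n \<ge> n0 \<Longrightarrow> n > 0"
    unfolding eventually_sequentially by blast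
  have x_cos: "(\<lambda>n. (\<Sum>k<m n. cos (u * x n k)) / z ^ n) \<longlonglongrightarrow> t * exp (- u\<^sup>2 / 2)" if u: "u \<in> \<rat>" for u
  proof -
    have bound: "\<bar>(\<Sum>k<m n. cos (u * x n k)) / z ^ n - (\<Sum>k<m n. cos (u * w n k)) / z ^ n\<bar>
        \<le> real (m n) / z ^ n * (\<bar>u\<bar> * M * (1 / sqrt (real n)))" if "n > 0" for n
    proof -
      have "\<bar>(\<Sum>k<m n. cos (u * x n k)) / z ^ n - (\<Sum>k<m n. cos (u * w n k)) / z ^ n\<bar>
          = \<bar>\<Sum>k<m n. cos (u * x n k) - cos (u * w n k)\<bar> / z ^ n"
        using zp[of n] by (simp add: sum_subtractf diff_divide_distrib[symmetric])
      also have "\<dots> \<le> (\<Sum>k<m n. \<bar>cos (u * x n k) - cos (u * w n k)\<bar>) / z ^ n"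
        using zp[of n] by (intro divide_right_mono sum_abs) auto
      also have "\<dots> \<le> (\<Sum>k<m n. \<bar>u\<bar> * (M / sqrt (real n))) / z ^ n"
      proof (intro divide_right_mono sum_mono)
        fix k
        have "\<bar>cos (u * x n k) - cos (u * w n k)\<bar> \<le> \<bar>u * x n k - u * w n k\<bar>" by (rule abs_cos_diff_le)
        also have "\<dots> = \<bar>u\<bar> * \<bar>x n k - w n k\<bar>" by (simp add: right_diff_distrib[symmetric] abs_mult)
        also have "\<dots> \<le> \<bar>u\<bar> * (M / sqrt (real n))" by (intro mult_left_mono M that) auto
        finally show "\<bar>cos (u * x n k) - cos (u * w n k)\<bar> \<le> \<bar>u\<bar> * (M / sqrt (real n))" .
      qed (use zp[of n] in auto)
      finally show ?thesis by (simp add: mult_ac)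
    qed
    have "filterlim (\<lambda>n. sqrt (real n)) at_top sequentially"
      by (rule filterlim_compose[OF sqrt_at_top filterlim_real_sequentially])
    then have sqrt_lim: "(\<lambda>n. 1 / sqrt (real n)) \<longlonglongrightarrow> 0"
      by (rule tendsto_divide_0[OF tendsto_const filterlim_at_top_imp_at_infinity])
    have "(\<lambda>n. real (m n) / z ^ n * (\<bar>u\<bar> * M * (1 / sqrt (real n)))) \<longlonglongrightarrow> t * (\<bar>u\<bar> * M * 0)"
      by (intro tendsto_intros t sqrt_lim)
    then have null: "(\<lambda>n. real (m n) / z ^ n * (\<bar>u\<bar> * M * (1 / sqrt (real n)))) \<longlonglongrightarrow> 0" by simp
    have "(\<lambda>n. (\<Sum>k<m n. cos (u * x n k)) / z ^ n - (\<Sum>k<m n. cos (u * w n k)) / z ^ n) \<longlonglongrightarrow> 0"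
    proof (rule Lim_null_comparison[OF _ null])
      show "\<forall>\<^sub>F n in sequentially. norm ((\<Sum>k<m n. cos (u * x n k)) / z ^ n - (\<Sum>k<m n. cos (u * w n k)) / z ^ n)
          \<le> real (m n) / z ^ n * (\<bar>u\<bar> * M * (1 / sqrt (real n)))"
        unfolding real_norm_def by (rule eventually_mono[OF eventually_gt_at_top[of 0] bound])
    qed
    from tendsto_add[OF this cos_lim[OF u]] show ?thesis by simp
  qed
  have C: "0 \<le> C"
    using cosh_le[of 0] by (rule order_trans[rotated]) (use zp in \<open>auto intro!: divide_nonneg_nonneg sum_nonneg\<close>)
  have x_cosh: "(\<Sum>k<m n. cosh (x n k)) / real (m n) \<le> exp M * C * (2 / t)" if n: "n \<ge> n0" for n
  proof -
    have n1: "n > 0" "1 \<le> sqrt (real n)" using n0(2)[OF n] by auto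
    have "cosh (x n k) \<le> exp M * cosh (w n k)" for k
    proof -
      have "M / sqrt (real n) \<le> M / 1" using n1 M by (intro divide_left_mono) auto
      then have "\<bar>x n k - w n k\<bar> \<le> M" using M(2)[OF n1(1), of k] by linarith
      have "cosh (x n k) \<le> exp \<bar>x n k - w n k\<bar> * cosh (w n k)"
        using cosh_add_le[of "w n k" "x n k - w n k"] by simp
      also have "\<dots> \<le> exp M * cosh (w n k)"
        using \<open>\<bar>x n k - w n k\<bar> \<le> M\<close> by (intro mult_right_mono) auto
      finally show ?thesis .
    qed
    then have "(\<Sum>k<m n. cosh (x n k)) / z ^ n \<le> (\<Sum>k<m n. exp M * cosh (w n k)) / z ^ n"
      using zp[of n] by (intro divide_right_mono sum_mono) auto
    also have "\<dots> = exp M * ((\<Sum>k<m n. cosh (w n k)) / z ^ n)" by (simp add: sum_distrib_left)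
    also have "\<dots> \<le> exp M * C" by (intro mult_left_mono cosh_le) auto
    finally have *: "(\<Sum>k<m n. cosh (x n k)) / z ^ n \<le> exp M * C" .
    have "(\<Sum>k<m n. cosh (x n k)) / real (m n) = ((\<Sum>k<m n. cosh (x n k)) / z ^ n) / (real (m n) / z ^ n)"
      using z by simp
    also have "\<dots> \<le> (exp M * C) / (t / 2)"
      by (rule frac_le) (use * n0(1)[OF n] t C in auto)
    finally show ?thesis by simp
  qed
  interpret empirical_normal "\<lambda>n. m (n + n0)" "\<lambda>n. x (n + n0)" "exp M * C * (2 / t)"
  proof
    show "m (n + n0) > 0" for n
      using n0(1)[of "n + n0"] t by (cases "m (n + n0) = 0") auto
    show "(\<Sum>k<m (n + n0). cosh (x (n + n0) k)) / real (m (n + n0)) \<le> exp M * C * (2 / t)" for n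
      by (rule x_cosh) simp
    show "(\<lambda>n. (\<Sum>k<m (n + n0). cos (u * x (n + n0) k)) / real (m (n + n0))) \<longlonglongrightarrow> exp (- u\<^sup>2 / 2)" if "u \<in> \<rat>" for u
    proof -
      have "(\<lambda>n. ((\<Sum>k<m n. cos (u * x n k)) / z ^ n) / (real (m n) / z ^ n)) \<longlonglongrightarrow> t * exp (- u\<^sup>2 / 2) / t"
        using t by (intro tendsto_divide x_cos that) auto
      moreover have "((\<Sum>k<m n. cos (u * x n k)) / z ^ n) / (real (m n) / z ^ n) = (\<Sum>k<m n. cos (u * x n k)) / real (m n)" for n
        using z by simp
      ultimately have "(\<lambda>n. (\<Sum>k<m n. cos (u * x n k)) / real (m n)) \<longlonglongrightarrow> t * exp (- u\<^sup>2 / 2) / t"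
        by (simp only:)
      then have "(\<lambda>n. (\<Sum>k<m n. cos (u * x n k)) / real (m n)) \<longlonglongrightarrow> exp (- u\<^sup>2 / 2)" using t by simp
      then show ?thesis by (rule LIMSEQ_ignore_initial_segment)
    qed
  qed
  have "(\<lambda>n. (\<Sum>k<m n. \<bar>x n k\<bar> powr p) / real (m n)) \<longlonglongrightarrow> 2 powr (p / 2) * Gamma ((p + 1) / 2) / sqrt pi"
    by (rule LIMSEQ_offset[OF abs_moment_lim[OF p]])
  from tendsto_mult[OF t(2) this]
  have "(\<lambda>n. real (m n) / z ^ n * ((\<Sum>k<m n. \<bar>x n k\<bar> powr p) / real (m n)))
      \<longlonglongrightarrow> t * (2 powr (p / 2) * Gamma ((p + 1) / 2) / sqrt pi)" .
  moreover have "real (m n) / z ^ n * ((\<Sum>k<m n. \<bar>x n k\<bar> powr p) / real (m n)) = (\<Sum>k<m n. \<bar>x n k\<bar> powr p) / z ^ n" for n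
    by (cases "m n = 0") auto
  ultimately show ?thesis by simp
qed

text \<open>The pointwise error in \<open>Phi_asymptotics\<close> is summed over the cells; its
  weights 1 + \<bar>x\<bar> powr (1/H) have averages converging to t + \<mu>, so the total error is
  arbitrarily small.\<close>

lemma Phi_sum_lim:
  fixes \<Phi> :: "real \<Rightarrow> real" and x :: "nat \<Rightarrow> nat \<Rightarrow> real" and m :: "nat \<Rightarrow> nat" and H z C t \<mu> :: real
  assumes H: "0 < H" and z: "1 < z" and C: "0 < C" and \<Phi>0: "\<Phi> 0 = 0"
    and \<Phi>: "\<forall>x. 0 < x \<and> x < 1 / exp 1 \<longrightarrow> \<Phi> x = x powr (1 / H) * (- ln x) powr (- (1 / (2 * H)))"
    and t: "(\<lambda>n. real (m n) / z ^ n) \<longlonglongrightarrow> t"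
    and \<mu>: "(\<lambda>n. (\<Sum>k<m n. \<bar>x n k\<bar> powr (1 / H)) / z ^ n) \<longlonglongrightarrow> \<mu>"
    and x: "\<And>n k. n > 0 \<Longrightarrow> k < m n \<Longrightarrow> \<bar>x n k\<bar> \<le> C * real n"
  shows "(\<lambda>n. \<Sum>k<m n. \<Phi> (z powr (- (real n * H)) * sqrt (real n) * \<bar>x n k\<bar>))
    \<longlonglongrightarrow> (H * ln z) powr (- (1 / (2 * H))) * \<mu>"
proof -
  define c where "c = (H * ln z) powr (- (1 / (2 * H)))"
  define S where "S n = (\<Sum>k<m n. \<Phi> (z powr (- (real n * H)) * sqrt (real n) * \<bar>x n k\<bar>))" for n
  define A where "A n = (\<Sum>k<m n. \<bar>x n k\<bar> powr (1 / H)) / z ^ n" for n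
  have zp: "0 < z ^ n" for n using z by simp
  have "(\<lambda>n. S n - c * A n) \<longlonglongrightarrow> 0"
  proof (rule LIMSEQ_I)
    fix \<epsilon> :: real assume \<epsilon>: "0 < \<epsilon>"
    define R where "R = \<bar>t\<bar> + \<bar>\<mu>\<bar> + 1"
    have R: "R > 0" by (simp add: R_def)
    define \<epsilon>' where "\<epsilon>' = \<epsilon> / (2 * R)"
    have \<epsilon>': "\<epsilon>' > 0" using \<epsilon> R by (simp add: \<epsilon>'_def)
    have "(\<lambda>n. real (m n) / z ^ n + A n) \<longlonglongrightarrow> t + \<mu>" unfolding A_def by (intro tendsto_add t \<mu>)
    then have "\<forall>\<^sub>F n in sequentially. real (m n) / z ^ n + A n < R"
      by (rule order_tendstoD(2)) (auto simp: R_def)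
    with Phi_asymptotics[OF H z C \<epsilon>' \<Phi>0 \<Phi>]
    have "\<forall>\<^sub>F n in sequentially. \<bar>S n - c * A n\<bar> < \<epsilon>"
      using eventually_gt_at_top[of 0]
    proof eventually_elim
      case (elim n)
      have "\<bar>S n - c * A n\<bar> = \<bar>\<Sum>k<m n. z ^ n * \<Phi> (z powr (- (real n * H)) * sqrt (real n) * \<bar>x n k\<bar>) - c * \<bar>x n k\<bar> powr (1 / H)\<bar> / z ^ n"
      proof -
        have "S n - c * A n = (z ^ n * S n - c * (\<Sum>k<m n. \<bar>x n k\<bar> powr (1 / H))) / z ^ n"
          using z by (simp add: A_def diff_divide_distrib)
        also have "z ^ n * S n - c * (\<Sum>k<m n. \<bar>x n k\<bar> powr (1 / H))
            = (\<Sum>k<m n. z ^ n * \<Phi> (z powr (- (real n * H)) * sqrt (real n) * \<bar>x n k\<bar>) - c * \<bar>x n k\<bar> powr (1 / H))"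
          unfolding S_def by (simp only: sum_distrib_left sum_subtractf)
        finally show ?thesis using zp[of n] by (simp only: abs_divide abs_of_pos)
      qed
      also have "\<dots> \<le> (\<Sum>k<m n. \<epsilon>' * (1 + \<bar>x n k\<bar> powr (1 / H))) / z ^ n"
        using elim(1) x[of n] elim(3) zp[of n]
        by (intro divide_right_mono order_trans[OF sum_abs] sum_mono) (auto simp: c_def)
      also have "\<dots> = \<epsilon>' * (real (m n) / z ^ n + A n)"
        by (simp add: sum.distrib sum_distrib_left[symmetric] A_def distrib_left add_divide_distrib)
      also have "\<dots> \<le> \<epsilon>' * R" using elim(2) \<epsilon>' by (intro mult_left_mono) auto
      also have "\<dots> < \<epsilon>" using \<epsilon> R by (simp add: \<epsilon>'_def)
      finally show ?case .
    qed
    then show "\<exists>n0. \<forall>n\<ge>n0. norm (S n - c * A n - 0) < \<epsilon>"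
      by (simp add: eventually_sequentially)
  qed
  from tendsto_add[OF this tendsto_mult[OF tendsto_const[of c] \<mu>[folded A_def]]]
  show ?thesis by (simp add: S_def c_def)
qed

text \<open>An interior t is enclosed by rationals r < t < s at distance less than d, and
  monotonicity squeezes G n t. The endpoints are separate because there is no room on both sides
  within [0,1].\<close>

lemma mono_lim_from_rationals:
  fixes G :: "nat \<Rightarrow> real \<Rightarrow> real" and L :: real
  assumes mono: "\<And>n s t. 0 \<le> s \<Longrightarrow> s \<le> t \<Longrightarrow> G n s \<le> G n t" and G0: "\<And>n. G n 0 = 0"
    and lim: "\<And>t. t \<in> \<rat> \<Longrightarrow> 0 < t \<Longrightarrow> t \<le> 1 \<Longrightarrow> (\<lambda>n. G n t) \<longlonglongrightarrow> L * t"
    and L: "0 \<le> L" and t: "t \<in> {0..1}"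
  shows "(\<lambda>n. G n t) \<longlonglongrightarrow> L * t"
proof -
  consider "t = 0" | "t = 1" | "0 < t" "t < 1" using t by fastforce
  then show ?thesis
  proof cases
    case 1
    then show ?thesis by (simp add: G0)
  next
    case 2
    then show ?thesis using lim[of 1] by simp
  next
    case 3
    show ?thesis
    proof (rule LIMSEQ_I)
      fix \<epsilon> :: real assume \<epsilon>: "0 < \<epsilon>"
      define d where "d = \<epsilon> / (2 * (L + 1))"
      have d: "d > 0" using \<epsilon> L by (simp add: d_def)
      have Ld: "L * d < \<epsilon> / 2" using \<epsilon> L by (simp add: d_def field_simps)
      obtain r where r: "r \<in> \<rat>" "max 0 (t - d) < r" "r < t"
        using Rats_dense_in_real[of "max 0 (t - d)" t] 3 d by auto
      obtain s where s: "s \<in> \<rat>" "t < s" "s < min 1 (t + d)"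
        using Rats_dense_in_real[of t "min 1 (t + d)"] 3 d by auto
      have "L * (t - r) \<le> L * d" "L * (s - t) \<le> L * d" using r s L by (auto intro!: mult_left_mono)
      then have Lr: "L * t - L * r < \<epsilon> / 2" and Ls: "L * s - L * t < \<epsilon> / 2" using Ld by (auto simp: algebra_simps)
      have "\<forall>\<^sub>F n in sequentially. L * r - \<epsilon> / 2 < G n r" "\<forall>\<^sub>F n in sequentially. G n s < L * s + \<epsilon> / 2"
        using order_tendstoD(1)[OF lim[of r]] order_tendstoD(2)[OF lim[of s]] r s 3 \<epsilon> by auto
      then have "\<forall>\<^sub>F n in sequentially. \<bar>G n t - L * t\<bar> < \<epsilon>"
      proof eventually_elim
        case (elim n)
        then show ?case using mono[of r t n] mono[of t s n] r s 3 Lr Ls by (simp add: abs_less_iff)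
      qed
      then show "\<exists>n0. \<forall>n\<ge>n0. norm (G n t - L * t) < \<epsilon>" by (simp add: eventually_sequentially)
    qed
  qed
qed

text \<open>A single term is at most the whole sum, which is of order z ^ n, and the logarithm makes
  this linear in n. Such a crude bound suffices since \<open>Phi_asymptotics\<close> uses only the
  logarithm of it, divided by n.\<close>

lemma linear_bound_of_cosh_average:
  fixes w :: "nat \<Rightarrow> nat \<Rightarrow> real" and z C :: real
  assumes z: "1 < z" and le: "\<And>n. (\<Sum>k<N n. cosh (w n k)) / z ^ n \<le> C"
  shows "\<exists>D>0. \<forall>n>0. \<forall>k<N n. \<bar>w n k\<bar> \<le> D * real n"
proof (intro exI conjI allI impI)
  define C' where "C' = max C 1"
  show "\<bar>ln (2 * C')\<bar> + ln z > 0" using z by (intro add_nonneg_pos) auto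
  fix n k :: nat assume n: "n > 0" and k: "k < N n"
  have "exp \<bar>w n k\<bar> \<le> 2 * cosh (w n k)" by (cases "w n k \<ge> 0") (auto simp: cosh_field_def)
  also have "cosh (w n k) \<le> (\<Sum>k<N n. cosh (w n k))" using k by (intro member_le_sum) auto
  also have "\<dots> \<le> C * z ^ n" using le[of n] z by (simp add: pos_divide_le_eq)
  also have "\<dots> \<le> C' * z ^ n" using z by (intro mult_right_mono) (auto simp: C'_def)
  finally have "exp \<bar>w n k\<bar> \<le> 2 * C' * z ^ n" by simp
  then have "\<bar>w n k\<bar> \<le> ln (2 * C' * z ^ n)" using z by (subst ln_ge_iff) (auto simp: C'_def)
  also have "\<dots> = ln (2 * C') * 1 + real n * ln z" using z by (simp add: ln_mult ln_realpow C'_def)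
  also have "\<dots> \<le> \<bar>ln (2 * C')\<bar> * real n + real n * ln z"
    using n by (intro add_right_mono mult_mono) auto
  finally show "\<bar>w n k\<bar> \<le> (\<bar>ln (2 * C')\<bar> + ln z) * real n" by (simp add: algebra_simps)
qed

theorem theorem2p3:
  fixes M :: "'a measure"
    and W Y :: "real \<Rightarrow> 'a \<Rightarrow> real"
    and H K \<alpha> \<tau> :: real
    and b :: nat
    and \<kappa> \<Phi> :: "real \<Rightarrow> real"
  assumes "prob_space M"
    and "0 < H" "H < 1"
    and "fractional_brownian_motion M H W"
    and "\<kappa> \<in> {0..1} \<rightarrow> {0..1}" "\<kappa> 0 = 0" "\<kappa> 1 = 1"
    and "H < \<tau>" "\<tau> \<le> 1" "hoelder_continuous_on \<tau> {0..1} \<kappa>"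
    and "0 < \<alpha>" "\<alpha> < 1" "b \<ge> 2"
    and "Y = wiener_weierstrass_bridge \<alpha> b \<kappa> W"
    and "K = min 1 (- log (real b) \<alpha>)"
    and "H = K"
    and "\<forall>x\<ge>0. \<Phi> x \<ge> 0" "continuous_on {0..} \<Phi>" "mono_on {0..} \<Phi>" "\<Phi> 0 = 0"
    and "\<forall>x. 0 < x \<and> x < 1 / exp 1 \<longrightarrow>
           \<Phi> x = x powr (1 / H) * (- ln x) powr (- (1 / (2 * H)))"
  shows "AE \<omega> in M. \<forall>t\<in>{0..1}.
           (\<lambda>n. \<Sum>k<nat \<lfloor>t * real b ^ n\<rfloor>.
              \<Phi> \<bar>Y (real (k + 1) / real b ^ n) \<omega> - Y (real k / real b ^ n) \<omega>\<bar>)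
           \<longlonglongrightarrow> 2 powr (1 / (2 * H)) * Gamma ((H + 1) / (2 * H)) /
               (sqrt pi * (- ln \<alpha>) powr (1 / (2 * H))) * t"
proof -
  interpret prob_space M by fact
  have cont_cov: "gaussian_process M {0..1} W" "\<And>t. t \<in> {0..1} \<Longrightarrow> expectation (W t) = 0"
    "\<And>s t. s \<in> {0..1} \<Longrightarrow> t \<in> {0..1} \<Longrightarrow>
      expectation (\<lambda>\<omega>. W s \<omega> * W t \<omega>) = (s powr (2 * H) + t powr (2 * H) - \<bar>t - s\<bar> powr (2 * H)) / 2"
    using assms(4) unfolding fractional_brownian_motion_def by blast+
  interpret fbm_walk M W H b
    by unfold_locales (use assms(2,3,13) cont_cov in auto)
  define z where "z = real b"
  have z: "1 < z" using b by (simp add: z_def)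
  \<comment> \<open>H < 1 excludes that the minimum defining K is 1.\<close>
  have H_log: "H = - log z \<alpha>" using assms(3,15,16) unfolding z_def by (auto simp: min_def split: if_splits)
  have \<alpha>: "\<alpha> = z powr (- H)" using z assms(11) by (simp add: H_log powr_log_cancel)
  have lnz: "H * ln z = - ln \<alpha>" using z by (simp add: \<alpha> ln_powr)
  define p where "p = 1 / H"
  have p: "p > 0" using H by (simp add: p_def)
  define \<mu> where "\<mu> = 2 powr (p / 2) * Gamma ((p + 1) / 2) / sqrt pi"
  define L where "L = (H * ln z) powr (- (1 / (2 * H))) * \<mu>"
  have L_eq: "L = 2 powr (1 / (2 * H)) * Gamma ((H + 1) / (2 * H)) / (sqrt pi * (- ln \<alpha>) powr (1 / (2 * H)))"
  proof -
    have exponents: "(p + 1) / 2 = (H + 1) / (2 * H)" "p / 2 = 1 / (2 * H)"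
      using H by (simp_all add: p_def field_simps)
    show ?thesis unfolding L_def \<mu>_def lnz exponents by (simp add: powr_minus_divide)
  qed
  have L_nonneg: "0 \<le> L"
    unfolding L_def \<mu>_def using p by (intro mult_nonneg_nonneg divide_nonneg_nonneg) (auto intro!: Gamma_real_nonneg)
  obtain K0 where K0: "K0 \<ge> 0" "\<And>n k \<omega>. \<bar>bridge_walk b H (\<lambda>u _. \<kappa> u) n k (\<omega> :: 'a)\<bar> \<le> K0"
    using bridge_walk_hoelder_bound[OF b assms(8,10)] by blast
  define m where "m t n = nat \<lfloor>t * z ^ n\<rfloor>" for t and n :: nat
  have m_le: "m t n \<le> b ^ n" if "t \<le> 1" for t n
  proof -
    have "t * z ^ n \<le> 1 * z ^ n" using that z by (intro mult_right_mono) auto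
    then have "\<lfloor>t * z ^ n\<rfloor> \<le> \<lfloor>real (b ^ n)\<rfloor>" by (intro floor_mono) (simp add: z_def)
    then show ?thesis unfolding m_def by (simp only: floor_of_nat nat_le_iff)
  qed
  have m_lim: "(\<lambda>n. real (m t n) / z ^ n) \<longlonglongrightarrow> t" if "0 \<le> t" for t
    unfolding m_def by (rule tendsto_floor_ratio[OF that z])
  \<comment> \<open>The covariance formula gives W 0 second moment 0. The bridge therefore vanishes
    at both ends outside a null set.\<close>
  have W0: "AE \<omega> in M. W 0 \<omega> = 0"
  proof -
    have "expectation (\<lambda>\<omega>. (W 0 \<omega>)\<^sup>2) = 0" using cov[of 0 0] by (simp add: power2_eq_square)
    moreover have "integrable M (\<lambda>\<omega>. (W 0 \<omega>)\<^sup>2)" by (intro lincomb_centered(2) lincomb_W) auto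
    ultimately show ?thesis by (subst (asm) integral_nonneg_eq_0_iff_AE) auto
  qed
  \<comment> \<open>Both parameters range over countable sets, so one null set serves all of them.
    The value t = 0 is left out because the averages will be divided by t.\<close>
  have cos_ae: "AE \<omega> in M. \<forall>t\<in>\<rat> \<inter> {0<..1}. \<forall>u\<in>\<rat>.
      (\<lambda>n. (\<Sum>k<m t n. cos (u * nwalk n k \<omega>)) / real b ^ n) \<longlonglongrightarrow> t * exp (- u\<^sup>2 / 2)"
  proof (subst AE_ball_countable, intro countable_subset[OF Int_lower1] countable_rat, intro ballI)
    fix t :: real assume t: "t \<in> \<rat> \<inter> {0<..1}"
    show "AE \<omega> in M. \<forall>u\<in>\<rat>. (\<lambda>n. (\<Sum>k<m t n. cos (u * nwalk n k \<omega>)) / real b ^ n) \<longlonglongrightarrow> t * exp (- u\<^sup>2 / 2)"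
      by (subst AE_ball_countable, rule countable_rat, intro ballI AE_cos_average m_le)
        (use t m_lim[of t] in \<open>auto simp: z_def\<close>)
  qed
  show ?thesis
    using W0 cos_ae AE_cosh_average_bounded
  proof eventually_elim
    case (elim \<omega>)
    note W0 = elim(1)
    define S where "S n k = bridge_walk b H (fractional_bridge \<kappa> W) n k \<omega>" for n k
    define x where "x n k = S n k / sqrt (real n)" for n k
    define G where "G n t = (\<Sum>k<m t n. \<Phi> \<bar>Y (real (k + 1) / real b ^ n) \<omega> - Y (real k / real b ^ n) \<omega>\<bar>)" for n t
    obtain C where C: "\<And>n. (\<Sum>k<b ^ n. cosh (nwalk n k \<omega>)) / z ^ n \<le> C"
      using elim(3) by (auto simp: z_def)
    define M0 where "M0 = K0 * \<bar>W 1 \<omega>\<bar>"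
    have M0: "M0 \<ge> 0" using K0 by (simp add: M0_def)
    have close: "\<bar>x n k - nwalk n k \<omega>\<bar> \<le> M0 / sqrt (real n)" for n k
    proof -
      have "x n k - nwalk n k \<omega> = - (bridge_walk b H (\<lambda>u _. \<kappa> u) n k \<omega> * W 1 \<omega>) / sqrt (real n)"
        unfolding x_def nwalk_def S_def bridge_walk_fractional_bridge by (simp add: diff_divide_distrib)
      then have "\<bar>x n k - nwalk n k \<omega>\<bar> = \<bar>bridge_walk b H (\<lambda>u _. \<kappa> u) n k \<omega>\<bar> * \<bar>W 1 \<omega>\<bar> / sqrt (real n)"
        by (simp add: abs_mult)
      also have "\<dots> \<le> M0 / sqrt (real n)"
        unfolding M0_def by (intro divide_right_mono mult_right_mono K0) auto
      finally show ?thesis .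
    qed
    obtain D where D: "D > 0" "\<And>n k. n > 0 \<Longrightarrow> k < b ^ n \<Longrightarrow> \<bar>nwalk n k \<omega>\<bar> \<le> D * real n"
      using linear_bound_of_cosh_average[where N = "\<lambda>n. b ^ n" and w = "\<lambda>n k. nwalk n k \<omega>", OF z C] by blast
    \<comment> \<open>Both the Gaussian part and the bounded correction from \<kappa> are within the
      linear growth that \<open>Phi_sum_lim\<close> allows.\<close>
    have x_le: "\<bar>x n k\<bar> \<le> (D + M0) * real n" if "n > 0" "k < b ^ n" for n k
    proof -
      have n1: "1 \<le> sqrt (real n)" "1 \<le> real n" using that by auto
      have "M0 / sqrt (real n) \<le> M0 / 1" using n1 M0 by (intro divide_left_mono) auto
      moreover have "M0 * 1 \<le> M0 * real n" using n1 M0 by (intro mult_left_mono) auto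
      ultimately show ?thesis using close[of n k] D(2)[OF that] by (simp add: distrib_right)
    qed
    have Y_incr: "\<bar>Y (real (k + 1) / real b ^ n) \<omega> - Y (real k / real b ^ n) \<omega>\<bar> = z powr (- (real n * H)) * sqrt (real n) * \<bar>x n k\<bar>"
      if "n > 0" for n k
    proof -
      have "\<bar>Y (real (k + 1) / real b ^ n) \<omega> - Y (real k / real b ^ n) \<omega>\<bar> = \<bar>z powr (- (real n * H)) * S n k\<bar>"
        unfolding assms(14) S_def z_def
        by (simp only: wiener_weierstrass_bridge_increment[of b \<kappa> W \<omega>, OF b assms(6,7) W0 \<alpha>[unfolded z_def]])
      also have "\<dots> = z powr (- (real n * H)) * sqrt (real n) * \<bar>x n k\<bar>"
        using that by (simp add: abs_mult x_def)
      finally show ?thesis .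
    qed
    have rat_lim: "(\<lambda>n. G n t) \<longlonglongrightarrow> L * t" if t: "t \<in> \<rat>" "0 < t" "t \<le> 1" for t
    proof -
      have moment_lim: "(\<lambda>n. (\<Sum>k<m t n. \<bar>x n k\<bar> powr p) / z ^ n) \<longlonglongrightarrow> t * \<mu>"
        unfolding \<mu>_def
      proof (rule perturbed_abs_moment_lim[where w = "\<lambda>n k. nwalk n k \<omega>" and M = M0 and C = C])
        show "(\<lambda>n. (\<Sum>k<m t n. cos (u * nwalk n k \<omega>)) / z ^ n) \<longlonglongrightarrow> t * exp (- u\<^sup>2 / 2)" if "u \<in> \<rat>" for u
          using elim(2) t that by (auto simp: z_def)
        show "(\<Sum>k<m t n. cosh (nwalk n k \<omega>)) / z ^ n \<le> C" for n
        proof (rule order_trans[OF divide_right_mono[OF sum_mono2] C])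
          show "{..<m t n} \<subseteq> {..<b ^ n}" using m_le[OF t(3), of n] by auto
        qed (use z in auto)
      qed (use z t m_lim p M0 close in auto)
      have "(\<lambda>n. \<Sum>k<m t n. \<Phi> (z powr (- (real n * H)) * sqrt (real n) * \<bar>x n k\<bar>))
          \<longlonglongrightarrow> (H * ln z) powr (- (1 / (2 * H))) * (t * \<mu>)"
      proof (rule Phi_sum_lim[OF H(1) z _ assms(20,21) m_lim moment_lim[unfolded p_def]])
        show "0 < D + M0" using D M0 by simp
        show "\<bar>x n k\<bar> \<le> (D + M0) * real n" if "n > 0" "k < m t n" for n k
          using that m_le[OF t(3), of n] by (intro x_le) auto
      qed (use t in auto)
      moreover have "\<forall>\<^sub>F n in sequentially. (\<Sum>k<m t n. \<Phi> (z powr (- (real n * H)) * sqrt (real n) * \<bar>x n k\<bar>)) = G n t"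
        using eventually_gt_at_top[of 0] by eventually_elim (simp only: G_def Y_incr)
      ultimately have "(\<lambda>n. G n t) \<longlonglongrightarrow> (H * ln z) powr (- (1 / (2 * H))) * (t * \<mu>)"
        by (rule Lim_transform_eventually)
      then show ?thesis by (simp add: L_def mult_ac)
    qed
    \<comment> \<open>A larger t only adds cells, and \<Phi> is nonnegative.\<close>
    have G_mono: "G n s \<le> G n t" if "0 \<le> s" "s \<le> t" for n s t
    proof -
      have "m s n \<le> m t n"
        unfolding m_def using that z by (intro nat_mono floor_mono mult_right_mono) auto
      then show ?thesis unfolding G_def using assms(17) by (intro sum_mono2) auto
    qed
    have "(\<lambda>n. G n t) \<longlonglongrightarrow> L * t" if "t \<in> {0..1}" for t
      by (rule mono_lim_from_rationals[OF G_mono _ rat_lim L_nonneg that]) (auto simp: G_def m_def)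
    then show ?case unfolding G_def m_def z_def L_eq[unfolded z_def] by blast
  qed
qed

end
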